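(* Let $(a,b)\in\mathbb C^2$ be an admissible pair, let $\Omega\subseteq\mathbb R^N$ be open with boundary $\Gamma$, and let $\phi$ be an admissible non-negative potential on $\Omega$. Let $K\subset\Omega$ be any compact subset of $\mathbb R^N$. Let $F\in H^{-1}(\Omega)$ be such that $F_{|\Omega\setminus K}\in L^\infty(\Omega\setminus K)$ and let $u$ be any global weak solution to $$-\Delta u+a\,U+b\,u+\phi\,u=F$$ with the homogeneous Dirichlet boundary condition. Then there exist $M=M(|a|,|b|)$ and $\varepsilon_\star=\varepsilon_\star(\operatorname{dist}(K,\Gamma))$ such that, for any $\varepsilon\in(0,\varepsilon_\star)$, there exists $\delta=\delta(\varepsilon,|a|,|b|,N)$ satisfying that if $\|F\|_{H^{-1}(\Omega)}<\delta$ and $\|F\|_{L^\infty(\Omega\setminus K)}\le\frac1M$ then $\operatorname{supp}u\subset K(\varepsilon)\subset\Omega$, where $$K(\varepsilon)=\{x\in\mathbb R^N:\operatorname{dist}(x,K)\le\varepsilon\}.$$ A similar statement holds for the homogeneous Neumann boundary condition (with $\Omega$ of finite measure and with a Lipschitz continuous boundary, $F\in H^1(\Omega)^\star$, and $\|F\|_{H^1(\Omega)^\star}<\delta$ in place of $\|F\|_{H^{-1}(\Omega)}<\delta$).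
   Context: All functions are complex-valued unless specified and all spaces are real vector spaces; $X^\star$ is the real topological dual; $H^{-1}(\Omega)=H^1_0(\Omega)^\star$; $\langle f,g\rangle_{L^{p'},L^p}=\mathrm{Re}\int_\Omega f\,\overline g\,dx$. A constant written $C(p_1,\dots,p_n)$ is positive and depends only (and continuously) on the listed parameters. Admissible pair: $a,b\in\mathbb A:=\mathbb C\setminus\{z:\mathrm{Re}(z)\le0,\ \mathrm{Im}(z)=0\}$ and either $\mathrm{Im}(a)\mathrm{Im}(b)\ge0$, or $\mathrm{Im}(a)\mathrm{Im}(b)<0$ and $\mathrm{Re}(b)>\frac{\mathrm{Im}(b)}{\mathrm{Im}(a)}\mathrm{Re}(a)$. Admissible non-negative potential: $\phi\in L^\infty(\Omega)+L^{p_\phi}(\Omega)$, real-valued, $\phi\ge0$ a.e., where $p_\phi=2$ if $N=1$, $p_\phi=2+\kappa$ for some $\kappa>0$ if $N=2$, $p_\phi=N$ if $N\ge3$. Saturated section associated to $u$: $U\in L^\infty(\Omega)$ with $\|U\|_{L^\infty}\le1$ and $U=u/|u|$ a.e. where $u\ne0$. Global weak solution: $U$ is a saturated section associated to $u$ and $$\langle\nabla u,\nabla v\rangle_{L^2,L^2}+\langle aU,v\rangle_{L^\infty,L^1}+\langle bu,v\rangle_{L^2,L^2}+\langle\phi u,v\rangle_{L^2,L^2}=\langle F,v\rangle_{X^\star,X}\quad\forall v\in X,$$ where, for the Dirichlet condition, $u\in X=H^1_0(\Omega)\cap L^1(\Omega)$, and, for the Neumann condition, $u\in X=H^1(\Omega)$.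 $F_{|\Omega\setminus K}\in L^\infty(\Omega\setminus K)$ means that there is $G\in L^\infty(\Omega\setminus K)$ (and $\|F\|_{L^\infty(\Omega\setminus K)}:=\|G\|_{L^\infty}$) with $\langle F,v\rangle=\mathrm{Re}\int_{\Omega\setminus K}G\,\overline v\,dx$ for all $v\in C_c^\infty(\Omega\setminus K)$ (Dirichlet case), respectively for all $v\in H^1(\Omega)$ vanishing a.e. in a neighbourhood of $K$ (Neumann case).
   Formalization: The constants M and δ depend continuously on the pair (a,b) itself rather than only on |a|,|b|, because dependence on the moduli alone fails (N=1, u=2cos x−1 on (−π/3,π/3), K={0}, φ=0, a=b=e^{it}, t→π). *)

theory Defs
  imports "HOL-Analysis.Analysis" "HOL-Probability.Essential_Supremum"
begin

section \<open>Euclidean space with a dimension that is a term\<close>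

text \<open>
  Some constants of the theorem may not depend on the dimension, so the dimension has to be
  quantified inside the formula and cannot be a type.  A point of the \<open>N\<close>-dimensional space is a
  function \<open>nat \<Rightarrow> real\<close> that is extensional on \<open>{..<N}\<close>; this is the carrier both of the product
  topology and of the product measure over that index set.  Functions on a set are total
  functions whose values off the set are irrelevant.  A class modulo null sets is given by any
  of its Borel representatives, and a Borel representative always exists.
\<close>

type_synonym pt = "nat \<Rightarrow> real"

abbreviation Rtop :: "nat \<Rightarrow> pt topology" where
  "Rtop N \<equiv> product_topology (\<lambda>_. euclideanreal) {..<N}"

abbreviation Rspace :: "nat \<Rightarrow> pt set" where
  "Rspace N \<equiv> topspace (Rtop N)"

definition rdist :: "nat \<Rightarrow> pt \<Rightarrow> pt \<Rightarrow> real" where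
  "rdist N x y = L2_set (\<lambda>i. x i - y i) {..<N}"

definition rball :: "nat \<Rightarrow> pt \<Rightarrow> real \<Rightarrow> pt set" where
  "rball N x r = {y \<in> Rspace N. rdist N x y < r}"

text \<open>Distances to the empty set are infinite, unlike with \<^const>\<open>infdist\<close> and \<^const>\<open>setdist\<close>:
  the boundary is empty if the open set is the whole space.\<close>

definition pt_set_dist :: "nat \<Rightarrow> pt \<Rightarrow> pt set \<Rightarrow> ennreal" where
  "pt_set_dist N x A = (INF y\<in>A. ennreal (rdist N x y))"

definition set_set_dist :: "nat \<Rightarrow> pt set \<Rightarrow> pt set \<Rightarrow> ennreal" where
  "set_set_dist N A B = (INF x\<in>A. pt_set_dist N x B)"

definition closed_nbhd :: "nat \<Rightarrow> pt set \<Rightarrow> real \<Rightarrow> pt set" where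
  "closed_nbhd N K \<epsilon> = {x \<in> Rspace N. pt_set_dist N x K \<le> ennreal \<epsilon>}"

definition leb :: "nat \<Rightarrow> pt set \<Rightarrow> pt measure" where
  "leb N \<Omega> = restrict_space (Pi\<^sub>M {..<N} (\<lambda>_. lborel)) \<Omega>"


section \<open>Lebesgue spaces\<close>

text \<open>For an exponent in \<open>[1, \<infinity>)\<close>.\<close>
definition Lp :: "nat \<Rightarrow> pt set \<Rightarrow> real \<Rightarrow> (pt \<Rightarrow> 'b::real_normed_vector) set" where
  "Lp N \<Omega> p = {f \<in> borel_measurable (leb N \<Omega>). integrable (leb N \<Omega>) (\<lambda>x. norm (f x) powr p)}"

definition Linf_norm :: "nat \<Rightarrow> pt set \<Rightarrow> (pt \<Rightarrow> 'b::real_normed_vector) \<Rightarrow> ennreal" where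
  "Linf_norm N \<Omega> f = esssup (leb N \<Omega>) (\<lambda>x. ennreal (norm (f x)))"

definition Linf :: "nat \<Rightarrow> pt set \<Rightarrow> (pt \<Rightarrow> 'b::real_normed_vector) set" where
  "Linf N \<Omega> = {f \<in> borel_measurable (leb N \<Omega>). Linf_norm N \<Omega> f < \<infinity>}"

text \<open>The real duality pairing between conjugate Lebesgue spaces.\<close>
definition pairing :: "nat \<Rightarrow> pt set \<Rightarrow> (pt \<Rightarrow> complex) \<Rightarrow> (pt \<Rightarrow> complex) \<Rightarrow> real" where
  "pairing N \<Omega> f g = Re (\<integral>x. f x * cnj (g x) \<partial>leb N \<Omega>)"

text \<open>The support of a class modulo null sets, as a relatively closed subset of \<open>\<Omega>\<close>.\<close>
definition ess_support :: "nat \<Rightarrow> pt set \<Rightarrow> (pt \<Rightarrow> complex) \<Rightarrow> pt set" where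
  "ess_support N \<Omega> u =
     {x \<in> \<Omega>. \<forall>V. openin (Rtop N) V \<and> x \<in> V \<longrightarrow> \<not> (AE y in leb N (\<Omega> \<inter> V). u y = 0)}"


section \<open>Test functions and Sobolev spaces\<close>

definition pderiv_at :: "nat \<Rightarrow> (pt \<Rightarrow> complex) \<Rightarrow> pt \<Rightarrow> complex" where
  "pderiv_at i f x = vector_derivative (\<lambda>t. f (x(i := t))) (at (x i))"

fun iter_pderiv :: "nat list \<Rightarrow> (pt \<Rightarrow> complex) \<Rightarrow> pt \<Rightarrow> complex" where
  "iter_pderiv [] f = f"
| "iter_pderiv (i # is) f = pderiv_at i (iter_pderiv is f)"

definition smooth :: "nat \<Rightarrow> (pt \<Rightarrow> complex) \<Rightarrow> bool" where
  "smooth N f \<longleftrightarrow> (\<forall>is \<in> lists {..<N}.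
     continuous_map (Rtop N) euclidean (iter_pderiv is f) \<and>
     (\<forall>x \<in> Rspace N. \<forall>i<N. (\<lambda>t. iter_pderiv is f (x(i := t))) differentiable (at (x i))))"

text \<open>Test functions on an open set, extended by zero to the whole space.\<close>
definition Cc_inf :: "nat \<Rightarrow> pt set \<Rightarrow> (pt \<Rightarrow> complex) set" where
  "Cc_inf N \<Omega> = {f. smooth N f \<and>
     (\<exists>C. compactin (Rtop N) C \<and> C \<subseteq> \<Omega> \<and> (\<forall>x \<in> Rspace N - C. f x = 0))}"

definition is_weak_deriv ::
  "nat \<Rightarrow> pt set \<Rightarrow> nat \<Rightarrow> (pt \<Rightarrow> complex) \<Rightarrow> (pt \<Rightarrow> complex) \<Rightarrow> bool" where
  "is_weak_deriv N \<Omega> i u g \<longleftrightarrow> (\<forall>\<psi> \<in> Cc_inf N \<Omega>.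
     (\<integral>x. u x * pderiv_at i \<psi> x \<partial>leb N \<Omega>) = - (\<integral>x. g x * \<psi> x \<partial>leb N \<Omega>))"

definition H1 :: "nat \<Rightarrow> pt set \<Rightarrow> (pt \<Rightarrow> complex) set" where
  "H1 N \<Omega> = {u \<in> Lp N \<Omega> 2. \<forall>i<N. \<exists>g \<in> Lp N \<Omega> 2. is_weak_deriv N \<Omega> i u g}"

text \<open>Unique up to null sets for \<open>u\<close> in \<open>H1\<close>.\<close>
definition weak_deriv :: "nat \<Rightarrow> pt set \<Rightarrow> nat \<Rightarrow> (pt \<Rightarrow> complex) \<Rightarrow> pt \<Rightarrow> complex" where
  "weak_deriv N \<Omega> i u = (SOME g. g \<in> Lp N \<Omega> 2 \<and> is_weak_deriv N \<Omega> i u g)"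

definition H1_norm :: "nat \<Rightarrow> pt set \<Rightarrow> (pt \<Rightarrow> complex) \<Rightarrow> real" where
  "H1_norm N \<Omega> u = sqrt ((\<integral>x. (cmod (u x))\<^sup>2 \<partial>leb N \<Omega>)
     + (\<Sum>i<N. \<integral>x. (cmod (weak_deriv N \<Omega> i u x))\<^sup>2 \<partial>leb N \<Omega>))"

definition H10 :: "nat \<Rightarrow> pt set \<Rightarrow> (pt \<Rightarrow> complex) set" where
  "H10 N \<Omega> = {u \<in> H1 N \<Omega>. \<forall>e>0. \<exists>\<psi> \<in> Cc_inf N \<Omega>. H1_norm N \<Omega> (\<lambda>x. u x - \<psi> x) < e}"

text \<open>
  The real topological dual of a subspace \<open>X\<close> of \<open>H1\<close>, with the norm of \<open>H1\<close>.  Boundedness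
  makes its elements compatible with equality almost everywhere.
\<close>
definition dual :: "nat \<Rightarrow> pt set \<Rightarrow> (pt \<Rightarrow> complex) set \<Rightarrow> ((pt \<Rightarrow> complex) \<Rightarrow> real) set" where
  "dual N \<Omega> X = {F.
     (\<forall>v\<in>X. \<forall>w\<in>X. F (\<lambda>x. v x + w x) = F v + F w) \<and>
     (\<forall>v\<in>X. \<forall>c::real. F (\<lambda>x. c *\<^sub>R v x) = c * F v) \<and>
     (\<exists>C. \<forall>v\<in>X. \<bar>F v\<bar> \<le> C * H1_norm N \<Omega> v)}"

definition dual_norm ::
  "nat \<Rightarrow> pt set \<Rightarrow> (pt \<Rightarrow> complex) set \<Rightarrow> ((pt \<Rightarrow> complex) \<Rightarrow> real) \<Rightarrow> real" where
  "dual_norm N \<Omega> X F = (SUP v \<in> {v \<in> X. H1_norm N \<Omega> v \<le> 1}. \<bar>F v\<bar>)"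


section \<open>The elliptic equation\<close>

definition slit_plane :: "complex set" where
  "slit_plane = UNIV - {z. Re z \<le> 0 \<and> Im z = 0}"

definition admissible_pair :: "complex \<Rightarrow> complex \<Rightarrow> bool" where
  "admissible_pair a b \<longleftrightarrow> a \<in> slit_plane \<and> b \<in> slit_plane \<and>
     (Im a * Im b \<ge> 0 \<or> (Im a * Im b < 0 \<and> Re b > Im b / Im a * Re a))"

definition admissible_potential :: "nat \<Rightarrow> pt set \<Rightarrow> (pt \<Rightarrow> real) \<Rightarrow> bool" where
  "admissible_potential N \<Omega> \<phi> \<longleftrightarrow>
     \<phi> \<in> borel_measurable (leb N \<Omega>) \<and>
     (\<exists>p. (if N = 1 then p = 2 else if N = 2 then p > 2 else p = real N) \<and>
        (\<exists>\<phi>1 \<in> Linf N \<Omega>. \<exists>\<phi>2 \<in> Lp N \<Omega> p. AE x in leb N \<Omega>. \<phi> x = \<phi>1 x + \<phi>2 x)) \<and>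
     (AE x in leb N \<Omega>. \<phi> x \<ge> 0)"

definition saturated_section ::
  "nat \<Rightarrow> pt set \<Rightarrow> (pt \<Rightarrow> complex) \<Rightarrow> (pt \<Rightarrow> complex) \<Rightarrow> bool" where
  "saturated_section N \<Omega> u U \<longleftrightarrow> U \<in> Linf N \<Omega> \<and> Linf_norm N \<Omega> U \<le> 1 \<and>
     (AE x in leb N \<Omega>. u x \<noteq> 0 \<longrightarrow> U x = u x / complex_of_real (cmod (u x)))"

text \<open>
  The square integrability of \<open>\<phi> u\<close> is what gives a meaning to its pairing with \<open>v\<close>: a Bochner
  integral of a non-integrable function would silently be zero.
\<close>
definition weak_solution :: "nat \<Rightarrow> pt set \<Rightarrow> (pt \<Rightarrow> complex) set \<Rightarrow> complex \<Rightarrow> complex \<Rightarrow>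
    (pt \<Rightarrow> real) \<Rightarrow> ((pt \<Rightarrow> complex) \<Rightarrow> real) \<Rightarrow> (pt \<Rightarrow> complex) \<Rightarrow> (pt \<Rightarrow> complex) \<Rightarrow> bool" where
  "weak_solution N \<Omega> X a b \<phi> F u U \<longleftrightarrow>
     u \<in> X \<and> saturated_section N \<Omega> u U \<and> (\<lambda>x. complex_of_real (\<phi> x) * u x) \<in> Lp N \<Omega> 2 \<and>
     (\<forall>v\<in>X.
        (\<Sum>i<N. pairing N \<Omega> (weak_deriv N \<Omega> i u) (weak_deriv N \<Omega> i v))
        + pairing N \<Omega> (\<lambda>x. a * U x) v
        + pairing N \<Omega> (\<lambda>x. b * u x) v
        + pairing N \<Omega> (\<lambda>x. complex_of_real (\<phi> x) * u x) v
        = F v)"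

definition dirichlet_weak_solution :: "nat \<Rightarrow> pt set \<Rightarrow> complex \<Rightarrow> complex \<Rightarrow>
    (pt \<Rightarrow> real) \<Rightarrow> ((pt \<Rightarrow> complex) \<Rightarrow> real) \<Rightarrow> (pt \<Rightarrow> complex) \<Rightarrow> (pt \<Rightarrow> complex) \<Rightarrow> bool" where
  "dirichlet_weak_solution N \<Omega> = weak_solution N \<Omega> (H10 N \<Omega> \<inter> Lp N \<Omega> 1)"

definition neumann_weak_solution :: "nat \<Rightarrow> pt set \<Rightarrow> complex \<Rightarrow> complex \<Rightarrow>
    (pt \<Rightarrow> real) \<Rightarrow> ((pt \<Rightarrow> complex) \<Rightarrow> real) \<Rightarrow> (pt \<Rightarrow> complex) \<Rightarrow> (pt \<Rightarrow> complex) \<Rightarrow> bool" where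
  "neumann_weak_solution N \<Omega> = weak_solution N \<Omega> (H1 N \<Omega>)"

text \<open>
  The functional \<open>F\<close> is given off \<open>K\<close> by the bounded function \<open>G\<close>, whose norm is then by definition
  the norm of \<open>F\<close> off \<open>K\<close>.
\<close>
definition dirichlet_rep_off :: "nat \<Rightarrow> pt set \<Rightarrow> pt set \<Rightarrow> ((pt \<Rightarrow> complex) \<Rightarrow> real) \<Rightarrow>
    (pt \<Rightarrow> complex) \<Rightarrow> bool" where
  "dirichlet_rep_off N \<Omega> K F G \<longleftrightarrow> G \<in> Linf N (\<Omega> - K) \<and>
     (\<forall>v \<in> Cc_inf N (\<Omega> - K). F v = pairing N (\<Omega> - K) G v)"

definition neumann_rep_off :: "nat \<Rightarrow> pt set \<Rightarrow> pt set \<Rightarrow> ((pt \<Rightarrow> complex) \<Rightarrow> real) \<Rightarrow>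
    (pt \<Rightarrow> complex) \<Rightarrow> bool" where
  "neumann_rep_off N \<Omega> K F G \<longleftrightarrow> G \<in> Linf N (\<Omega> - K) \<and>
     (\<forall>v \<in> H1 N \<Omega>.
        (\<exists>V. openin (Rtop N) V \<and> K \<subseteq> V \<and> (AE x in leb N (\<Omega> \<inter> V). v x = 0)) \<longrightarrow>
        F v = pairing N (\<Omega> - K) G v)"

text \<open>
  Near each boundary point, \<open>\<Omega>\<close> is the part of a ball above the graph of a Lipschitz function in
  some orthonormal coordinate system.  The vector \<open>e\<close> is the last vector of that system, and
  \<open>\<gamma>\<close> only matters on the hyperplane orthogonal to \<open>e\<close>.
\<close>
definition lipschitz_boundary :: "nat \<Rightarrow> pt set \<Rightarrow> bool" where
  "lipschitz_boundary N \<Omega> \<longleftrightarrow> (\<forall>x \<in> Rtop N frontier_of \<Omega>. \<exists>r>0. \<exists>e \<in> Rspace N. \<exists>\<gamma> L.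
     (\<Sum>i<N. (e i)\<^sup>2) = 1 \<and>
     (\<forall>p \<in> Rspace N. \<forall>q \<in> Rspace N. \<bar>\<gamma> p - \<gamma> q\<bar> \<le> L * rdist N p q) \<and>
     \<Omega> \<inter> rball N x r = {y \<in> rball N x r.
        (\<Sum>i<N. y i * e i) > \<gamma> (\<lambda>k\<in>{..<N}. y k - (\<Sum>i<N. y i * e i) * e k)})"

text \<open>
  A family of constants depending only, and continuously, on \<open>\<epsilon>\<close> and on the pair \<open>(a, b)\<close>
  (respectively on the pair alone).  Dependence on the pair cannot be reduced to dependence on
  the moduli: in dimension one, \<open>u x = 2 * cos x - 1\<close> is positive on \<open>(- pi/3, pi/3)\<close>, vanishes
  at the end points and solves the equation with \<open>\<phi> = 0\<close>, \<open>a = b = cis \<theta>\<close> and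
  \<open>F = (1 + cis \<theta>) * (1 + u)\<close>, which tends to zero as \<open>\<theta>\<close> increases to \<open>pi\<close>, although all these
  pairs are admissible with moduli one and \<open>u\<close> does not change.
\<close>
definition pair_constant :: "(complex \<Rightarrow> complex \<Rightarrow> real) \<Rightarrow> bool" where
  "pair_constant M \<longleftrightarrow> (\<forall>a b. admissible_pair a b \<longrightarrow> M a b > 0) \<and>
     continuous_on {(a, b). admissible_pair a b} (\<lambda>(a, b). M a b)"

definition eps_pair_constant :: "(real \<Rightarrow> complex \<Rightarrow> complex \<Rightarrow> real) \<Rightarrow> bool" where
  "eps_pair_constant \<delta> \<longleftrightarrow> (\<forall>\<epsilon>>0. \<forall>a b. admissible_pair a b \<longrightarrow> \<delta> \<epsilon> a b > 0) \<and>
     continuous_on {(\<epsilon>, a, b). \<epsilon> > 0 \<and> admissible_pair a b} (\<lambda>(\<epsilon>, a, b). \<delta> \<epsilon> a b)"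

definition dist_constant :: "(ennreal \<Rightarrow> real) \<Rightarrow> bool" where
  "dist_constant \<epsilon>\<^sub>0 \<longleftrightarrow> (\<forall>d>0. \<epsilon>\<^sub>0 d > 0) \<and> continuous_on {0<..} \<epsilon>\<^sub>0"

end

theory Submission
  imports Defs
begin

text \<open>
  Let \<open>m\<close> be the distance of 0 to the triangle with vertices \<open>1\<close>, \<open>a\<close> and \<open>b\<close>, the coefficients of the
  gradient, of the saturated and of the linear term.  The admissibility of the pair keeps 0 out of
  the triangle, so \<open>m\<close> is positive, and \<open>1\<close>, \<open>a\<close> and \<open>b\<close> all have real part at least \<open>m\<close> after a division by
  a suitable unit \<open>l\<close> (\<open>coercive_direction\<close>).  Testing the equation with multiples of \<open>l u\<close> thus gives
  estimates with constants that only depend on \<open>m\<close>.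

  The test function \<open>l u\<close> itself bounds the norm of \<open>u\<close> by the norm of \<open>F\<close> divided by \<open>m\<close>
  (\<open>energy_estimate\<close>).  The test function \<open>l \<eta>\<^sup>2 u\<close>, where \<open>\<eta>\<close> is a smooth cutoff that vanishes near \<open>K\<close>,
  gives (\<open>caccioppoli\<close>)
    \<open>\<integral> \<eta>\<^sup>2 |\<nabla>u|\<^sup>2 + \<integral> \<eta>\<^sup>2 |u| \<le> 4 / m\<^sup>2 \<integral> |\<nabla>\<eta>|\<^sup>2 |u|\<^sup>2\<close>
  as soon as \<open>|F| \<le> m / 2\<close> off \<open>K\<close>, because then half of the saturated term absorbs the right-hand side
  of the equation.  Hence \<open>M = 2 / m\<close>.

  The saturated term makes \<open>u\<close> vanish where it is small in the mean.  It controls the integral of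
  \<open>\<eta>\<^sup>2 |u|\<close>, and for \<open>w = \<eta>\<^sup>2 u\<close> the inequality (\<open>nash_inequality\<close>)
    \<open>\<integral> |w|\<^sup>2 \<le> 2 h\<^sup>-\<^sup>N (\<integral> |w|)\<^sup>2 + N h\<^sup>2 \<integral> |\<nabla>w|\<^sup>2\<close>
  turns this into an estimate that is quadratic in the energy, up to a linear term with a factor
  that is small with \<open>h\<close>.  Iterated over concentric cubes that shrink to half of a cube in \<open>\<Omega> - K\<close>, with a
  geometric choice of \<open>h\<close>, it shows that \<open>u\<close> vanishes on the half cube if the integral of \<open>|u|\<^sup>2\<close> is
  below an explicit bound (\<open>vanish_on_half_cube\<close>).  Only cubes inside \<open>\<Omega> - K\<close> matter, whatever the
  condition at the boundary.

  If the norm of \<open>F\<close> is small, \<open>u\<close> therefore vanishes on a collar around \<open>K\<close> that is filled with such half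
  cubes of a size proportional to \<open>\<epsilon>\<close>.  A cutoff that increases from 0 to 1 across the collar has no
  gradient where \<open>u\<close> is not zero, so the right-hand side of the first inequality is zero up to the
  effect of a cutoff at infinity, and \<open>u\<close> vanishes beyond the collar as well
  (\<open>vanish_beyond_collar\<close>).  If \<open>\<epsilon>\<close> is less than the distance of \<open>K\<close> to the boundary, the neighbourhood \<open>K(\<epsilon>)\<close> is contained in \<open>\<Omega>\<close>, because a segment that leaves \<open>\<Omega>\<close>
  meets the boundary (\<open>closed_nbhd_subset\<close>).

  The two boundary conditions only differ in the reason why \<open>l \<eta>\<^sup>2 u\<close> is a test function on which \<open>F\<close> is
  given by a bounded function.  For the Neumann condition this is immediate; for the Dirichlet
  condition it follows by an approximation with smooth functions (\<open>dirichlet_rep_cutoff\<close>).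
\<close>

section \<open>Boxes and the product Lebesgue measure\<close>

abbreviation Leb :: "nat \<Rightarrow> pt measure" where
  "Leb N \<equiv> Pi\<^sub>M {..<N} (\<lambda>_. lborel)"

definition obox :: "nat \<Rightarrow> (nat \<Rightarrow> real) \<Rightarrow> (nat \<Rightarrow> real) \<Rightarrow> pt set" where
  "obox N a b = PiE {..<N} (\<lambda>i. {a i<..<b i})"

abbreviation cube :: "nat \<Rightarrow> pt \<Rightarrow> real \<Rightarrow> pt set" where
  "cube N x r \<equiv> obox N (\<lambda>i. x i - r) (\<lambda>i. x i + r)"

lemma Rspace_PiE: "Rspace N = PiE {..<N} (\<lambda>_. UNIV)"
  by simp

lemma space_Leb [simp]: "space (Leb N) = Rspace N"
  by (simp add: space_PiM)

lemma upd_Rspace: "x \<in> Rspace N \<Longrightarrow> i < N \<Longrightarrow> x(i := t) \<in> Rspace N"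
  by (simp add: PiE_def extensional_def)

lemma obox_subset: "obox N a b \<subseteq> Rspace N"
  by (auto simp: obox_def PiE_iff)

lemma mem_obox: "y \<in> obox N a b \<longleftrightarrow> y \<in> Rspace N \<and> (\<forall>i<N. a i < y i \<and> y i < b i)"
  by (auto simp: obox_def PiE_iff)

lemma mem_cube: "y \<in> cube N x r \<longleftrightarrow> y \<in> Rspace N \<and> (\<forall>i<N. \<bar>y i - x i\<bar> < r)"
  unfolding mem_obox abs_diff_less_iff by (simp add: algebra_simps)

lemma openin_obox: "openin (Rtop N) (obox N a b)"
  unfolding obox_def by (subst openin_PiE) (auto)

lemma sets_obox [measurable]: "obox N a b \<in> sets (Leb N)"
  unfolding obox_def by (intro sets_PiM_I_finite) auto

interpretation lborel_product: product_sigma_finite "\<lambda>_::nat. lborel::real measure"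
  by standard

lemma emeasure_obox: "emeasure (Leb N) (obox N a b) = (\<Prod>i<N. emeasure lborel {a i<..<b i})"
  unfolding obox_def by (subst lborel_product.emeasure_PiM) auto

lemma emeasure_obox_finite: "emeasure (Leb N) (obox N a b) < \<infinity>"
proof -
  have "emeasure lborel {a i<..<b i} < top" for i
    by (cases "a i \<le> b i") auto
  then show ?thesis
    unfolding emeasure_obox by (simp add: ennreal_prod_eq_top less_top[symmetric])
qed

lemma openin_contains_cube:
  assumes S: "openin (Rtop N) S" and x: "x \<in> S"
  obtains r where "r > 0" "cube N x r \<subseteq> S"
proof -
  obtain U where U: "\<And>i. i < N \<Longrightarrow> open (U i)" "x \<in> PiE {..<N} U" "PiE {..<N} U \<subseteq> S"
    using S x unfolding openin_product_topology_alt by simp (metis lessThan_iff)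
  have "\<exists>e>0. ball (x i) e \<subseteq> U i" if "i < N" for i
    using U(1)[OF that] U(2) that by (auto simp: open_contains_ball PiE_iff)
  then obtain e where e: "\<And>i. i < N \<Longrightarrow> e i > 0" "\<And>i. i < N \<Longrightarrow> ball (x i) (e i) \<subseteq> U i"
    by metis
  define r where "r = Min (insert 1 (e ` {..<N}))"
  have r: "r > 0" "\<And>i. i < N \<Longrightarrow> r \<le> e i"
    using e(1) by (auto simp: r_def)
  have "cube N x r \<subseteq> S"
  proof
    fix y assume y: "y \<in> cube N x r"
    have "y i \<in> U i" if "i < N" for i
    proof -
      have "\<bar>y i - x i\<bar> < e i" using y r(2)[OF that] that unfolding mem_cube by force
      then show ?thesis using e(2)[OF that] by (auto simp: dist_real_def abs_minus_commute)
    qed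
    then have "y \<in> PiE {..<N} U"
      using y unfolding mem_cube by (auto simp: PiE_iff)
    then show "y \<in> S" using U(3) by auto
  qed
  then show ?thesis using that r by blast
qed

lemma openin_contains_rat_box:
  assumes S: "openin (Rtop N) S" and x: "x \<in> S"
  shows "\<exists>p \<in> PiE {..<N} (\<lambda>_. \<rat>) \<times> PiE {..<N} (\<lambda>_. \<rat>).
    x \<in> obox N (fst p) (snd p) \<and> obox N (fst p) (snd p) \<subseteq> S"
proof -
  obtain r where r: "r > 0" "cube N x r \<subseteq> S"
    using openin_contains_cube[OF S x] .
  have "\<exists>a\<in>\<rat>. x i - r < a \<and> a < x i" for i using Rats_dense_in_real[of "x i - r" "x i"] r by auto
  then obtain a where a: "\<And>i. a i \<in> \<rat>" "\<And>i. x i - r < a i" "\<And>i. a i < x i" by metis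
  have "\<exists>a\<in>\<rat>. x i < a \<and> a < x i + r" for i using Rats_dense_in_real[of "x i" "x i + r"] r by auto
  then obtain b where b: "\<And>i. b i \<in> \<rat>" "\<And>i. x i < b i" "\<And>i. b i < x i + r" by metis
  have xS: "x \<in> Rspace N" using openin_subset[OF S] x by auto
  have "obox N (restrict a {..<N}) (restrict b {..<N}) \<subseteq> cube N x r"
    using a(2) b(3) by (fastforce simp: subset_iff mem_obox intro: less_trans)
  moreover have "x \<in> obox N (restrict a {..<N}) (restrict b {..<N})"
    using xS a(3) b(2) by (auto simp: mem_obox)
  ultimately show ?thesis using a(1) b(1) r(2)
    by (intro bexI[of _ "(restrict a {..<N}, restrict b {..<N})"]) auto
qed

lemma countable_rat_boxes:
  "countable (PiE {..<N::nat} (\<lambda>_. \<rat>::real set) \<times> PiE {..<N} (\<lambda>_. \<rat>::real set))"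
  by (intro countable_SIGMA countable_PiE) (auto simp: countable_rat)

lemma openin_Union_rat_boxes:
  assumes S: "openin (Rtop N) S"
  shows "\<exists>B. countable B \<and> S = (\<Union>p\<in>B. obox N (fst p) (snd p))"
proof (intro exI conjI)
  let ?B = "{p \<in> PiE {..<N} (\<lambda>_. \<rat>) \<times> PiE {..<N} (\<lambda>_. \<rat>). obox N (fst p) (snd p) \<subseteq> S}"
  show "countable ?B"
    by (rule countable_subset[OF _ countable_rat_boxes[of N]]) auto
  show "S = (\<Union>p\<in>?B. obox N (fst p) (snd p))"
  proof (intro equalityI subsetI)
    fix x assume "x \<in> S"
    from openin_contains_rat_box[OF S this] show "x \<in> (\<Union>p\<in>?B. obox N (fst p) (snd p))"
      by blast
  qed (use subsetD in \<open>blast\<close>)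
qed

lemma openin_sets_Leb:
  assumes S: "openin (Rtop N) S"
  shows "S \<in> sets (Leb N)"
proof -
  obtain B where B: "countable B" and S_eq: "S = (\<Union>p\<in>B. obox N (fst p) (snd p))"
    using openin_Union_rat_boxes[OF S] by blast
  show ?thesis unfolding S_eq by (rule sets.countable_UN''[OF B]) (rule sets_obox)
qed

text \<open>The space is second countable: countably many rational boxes, each with its own null
  set, are enough.\<close>

lemma AE_locally:
  assumes loc: "\<And>x. x \<in> S \<Longrightarrow> \<exists>V. openin (Rtop N) V \<and> x \<in> V \<and> (AE y in Leb N. y \<in> V \<longrightarrow> P y)"
  shows "AE y in Leb N. y \<in> S \<longrightarrow> P y"
proof -
  let ?B = "{p \<in> PiE {..<N} (\<lambda>_. \<rat>) \<times> PiE {..<N} (\<lambda>_. \<rat>).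
    AE y in Leb N. y \<in> obox N (fst p) (snd p) \<longrightarrow> P y}"
  have "countable ?B"
    by (rule countable_subset[OF _ countable_rat_boxes[of N]]) auto
  then have "AE y in Leb N. \<forall>p\<in>?B. y \<in> obox N (fst p) (snd p) \<longrightarrow> P y"
    by (subst AE_ball_countable) auto
  moreover have "\<exists>p\<in>?B. x \<in> obox N (fst p) (snd p)" if x: "x \<in> S" for x
  proof -
    obtain V where V: "openin (Rtop N) V" "x \<in> V" "AE y in Leb N. y \<in> V \<longrightarrow> P y"
      using loc[OF x] by auto
    obtain p where p: "p \<in> PiE {..<N} (\<lambda>_. \<rat>) \<times> PiE {..<N} (\<lambda>_. \<rat>)"
      "x \<in> obox N (fst p) (snd p)" "obox N (fst p) (snd p) \<subseteq> V"
      using openin_contains_rat_box[OF V(1,2)] by blast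
    have "AE y in Leb N. y \<in> obox N (fst p) (snd p) \<longrightarrow> P y"
      using V(3) by eventually_elim (use p(3) in blast)
    then show ?thesis using p(1,2) by blast
  qed
  ultimately show ?thesis
    by (elim eventually_mono) blast
qed

lemma continuous_map_measurable:
  fixes f :: "pt \<Rightarrow> 'a::{second_countable_topology, topological_space}"
  assumes "continuous_map (Rtop N) euclidean f"
  shows "f \<in> borel_measurable (Leb N)"
proof (rule borel_measurableI)
  fix S :: "'a set" assume "open S"
  then have "openin (Rtop N) {x \<in> Rspace N. f x \<in> S}"
    using assms by (simp add: continuous_map_def)
  moreover have "f -` S \<inter> space (Leb N) = {x \<in> Rspace N. f x \<in> S}" by auto
  ultimately show "f -` S \<inter> space (Leb N) \<in> sets (Leb N)"
    using openin_sets_Leb by metis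
qed

subsection \<open>Translations\<close>

definition shift :: "nat \<Rightarrow> pt \<Rightarrow> pt \<Rightarrow> pt" where
  "shift N y x = (\<lambda>i\<in>{..<N}. x i + y i)"

lemma shift_Rspace: "shift N y x \<in> Rspace N"
  by (auto simp: shift_def)

lemma shift_commute: "shift N x y = shift N y x"
  by (auto simp: shift_def add.commute)

lemma measurable_shift2 [measurable]:
  "(\<lambda>(y, x). shift N y x) \<in> Leb N \<Otimes>\<^sub>M Leb N \<rightarrow>\<^sub>M Leb N"
  unfolding shift_def case_prod_beta by (intro measurable_restrict) measurable

lemma measurable_shift [measurable]: "shift N y \<in> Leb N \<rightarrow>\<^sub>M Leb N"
  unfolding shift_def by (intro measurable_restrict) measurable

text \<open>A product measure is determined by its values on boxes, where the translation acts on
  each side separately.\<close>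

lemma distr_shift: "distr (Leb N) (Leb N) (shift N y) = Leb N"
proof (rule lborel_product.PiM_eqI)
  fix A :: "nat \<Rightarrow> real set" assume A: "\<And>i. i \<in> {..<N} \<Longrightarrow> A i \<in> sets lborel"
  have "emeasure (distr (Leb N) (Leb N) (shift N y)) (PiE {..<N} A) =
      emeasure (Leb N) (shift N y -` PiE {..<N} A \<inter> space (Leb N))"
    using A by (intro emeasure_distr measurable_shift sets_PiM_I_finite) auto
  also have "shift N y -` PiE {..<N} A \<inter> space (Leb N) = PiE {..<N} (\<lambda>i. (\<lambda>t. t + y i) -` A i)"
    by (auto simp: shift_def PiE_iff space_PiM extensional_def)
  also have "emeasure (Leb N) \<dots> = (\<Prod>i<N. emeasure lborel ((\<lambda>t. t + y i) -` A i))"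
  proof (rule lborel_product.emeasure_PiM)
    fix i assume "i \<in> {..<N}"
    then have "A i \<in> sets borel" using A by auto
    then show "(\<lambda>t. t + y i) -` A i \<in> sets lborel"
      using measurable_sets[of "\<lambda>t. t + y i" borel borel "A i"] by simp
  qed simp
  also have "\<dots> = (\<Prod>i<N. emeasure lborel (A i))"
  proof (rule prod.cong[OF refl])
    fix i assume "i \<in> {..<N}"
    then have Ai: "A i \<in> sets borel" using A by auto
    have "emeasure lborel (A i) = emeasure (distr lborel borel ((+) (y i))) (A i)"
      by (simp add: lborel_distr_plus)
    also have "\<dots> = emeasure lborel ((\<lambda>t. t + y i) -` A i)"
      using Ai by (subst emeasure_distr) (auto simp: add.commute intro!: arg_cong[where f="emeasure lborel"])
    finally show "emeasure lborel ((\<lambda>t. t + y i) -` A i) = emeasure lborel (A i)" by simp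
  qed
  finally show "emeasure (distr (Leb N) (Leb N) (shift N y)) (PiE {..<N} A) = (\<Prod>i\<in>{..<N}. emeasure lborel (A i))" .
qed simp_all

lemma integral_shift:
  fixes f :: "pt \<Rightarrow> 'a::{banach, second_countable_topology}"
  assumes "f \<in> borel_measurable (Leb N)"
  shows "(\<integral>x. f (shift N y x) \<partial>Leb N) = (\<integral>x. f x \<partial>Leb N)"
proof -
  have "(\<integral>x. f x \<partial>Leb N) = (\<integral>x. f x \<partial>distr (Leb N) (Leb N) (shift N y))"
    by (simp add: distr_shift)
  also have "\<dots> = (\<integral>x. f (shift N y x) \<partial>Leb N)"
    using assms by (intro integral_distr) auto
  finally show ?thesis ..
qed

lemma integrable_shift:
  fixes f :: "pt \<Rightarrow> 'a::{banach, second_countable_topology}"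
  assumes "f \<in> borel_measurable (Leb N)"
  shows "integrable (Leb N) (\<lambda>x. f (shift N y x)) \<longleftrightarrow> integrable (Leb N) f"
  using integrable_distr_eq[OF measurable_shift assms, of y] by (simp add: distr_shift)

lemma nn_integral_shift:
  assumes "f \<in> borel_measurable (Leb N)"
  shows "(\<integral>\<^sup>+x. f (shift N y x) \<partial>Leb N) = (\<integral>\<^sup>+x. f x \<partial>Leb N)"
  using nn_integral_distr[OF measurable_shift, of f N y] assms by (simp add: distr_shift)

section \<open>Calculus of smooth functions\<close>

lemma has_pderiv_cong:
  assumes x: "x \<in> Rspace N" and i: "i < N" and eq: "\<forall>x\<in>Rspace N. f x = g x"
  shows "((\<lambda>t. f (x(i := t))) has_vector_derivative D) F \<longleftrightarrow> ((\<lambda>t. g (x(i := t))) has_vector_derivative D) F"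
proof -
  have "(\<lambda>t. f (x(i := t))) = (\<lambda>t. g (x(i := t)))"
    using eq upd_Rspace[OF x i] by blast
  then show ?thesis by simp
qed

lemma pderiv_cong:
  assumes x: "x \<in> Rspace N" and i: "i < N" and eq: "\<forall>x\<in>Rspace N. f x = g x"
  shows "pderiv_at i f x = pderiv_at i g x"
  unfolding pderiv_at_def vector_derivative_def has_pderiv_cong[OF x i eq] ..

lemma continuous_map_mult:
  fixes f g :: "'a \<Rightarrow> 'b::real_normed_algebra"
  shows "continuous_map X euclidean f \<Longrightarrow> continuous_map X euclidean g \<Longrightarrow>
    continuous_map X euclidean (\<lambda>x. f x * g x)"
  by (simp add: continuous_map_atin tendsto_mult)

text \<open>A function is smooth as soon as it belongs to a class of continuous functions that is
  closed under partial derivatives.  Such a class is easy to name in every case below, whereas a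
  formula for the iterated partial derivatives is not.\<close>

lemma smooth_coinduct:
  assumes f: "P f"
    and cont: "\<And>f. P f \<Longrightarrow> continuous_map (Rtop N) euclidean f"
    and step: "\<And>f i. P f \<Longrightarrow> i < N \<Longrightarrow>
      \<exists>f'. P f' \<and> (\<forall>x\<in>Rspace N. ((\<lambda>t. f (x(i := t))) has_vector_derivative f' x) (at (x i)))"
  shows "smooth N f"
proof -
  have iter: "\<exists>g. P g \<and> (\<forall>x\<in>Rspace N. iter_pderiv is f x = g x)" if "is \<in> lists {..<N}" for "is"
    using that
  proof (induction "is")
    case Nil
    then show ?case using f by auto
  next
    case (Cons i "is")
    then obtain g where g: "P g" "\<forall>x\<in>Rspace N. iter_pderiv is f x = g x" by auto
    have i: "i < N" using Cons by auto
    obtain g' where g': "P g'" "\<And>x. x \<in> Rspace N \<Longrightarrow> ((\<lambda>t. g (x(i := t))) has_vector_derivative g' x) (at (x i))"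
      using step[OF g(1) i] by blast
    have "iter_pderiv (i # is) f x = g' x" if x: "x \<in> Rspace N" for x
    proof -
      have "iter_pderiv (i # is) f x = pderiv_at i g x"
        using pderiv_cong[OF x i g(2)] by simp
      also have "\<dots> = g' x"
        unfolding pderiv_at_def using g'(2)[OF x] by (rule vector_derivative_at)
      finally show ?thesis .
    qed
    with g' show ?case by blast
  qed
  show ?thesis unfolding smooth_def
  proof (intro ballI conjI allI impI)
    fix "is" assume "is": "is \<in> lists {..<N}"
    obtain g where g: "P g" "\<forall>x\<in>Rspace N. iter_pderiv is f x = g x"
      using iter[OF "is"] by blast
    show "continuous_map (Rtop N) euclidean (iter_pderiv is f)"
      using cont[OF g(1)] g(2) continuous_map_eq by metis
    fix x i assume x: "x \<in> Rspace N" and i: "i < N"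
    obtain g' where "\<And>x. x \<in> Rspace N \<Longrightarrow> ((\<lambda>t. g (x(i := t))) has_vector_derivative g' x) (at (x i))"
      using step[OF g(1) i] by blast
    from this[OF x] have "((\<lambda>t. iter_pderiv is f (x(i := t))) has_vector_derivative g' x) (at (x i))"
      using has_pderiv_cong[OF x i g(2)] by blast
    then show "(\<lambda>t. iter_pderiv is f (x(i := t))) differentiable at (x i)"
      by (rule differentiableI_vector)
  qed
qed

lemma smooth_imp_continuous: "smooth N f \<Longrightarrow> continuous_map (Rtop N) euclidean f"
  unfolding smooth_def by (metis iter_pderiv.simps(1) lists.Nil)

lemma smooth_measurable: "smooth N f \<Longrightarrow> f \<in> borel_measurable (Leb N)"
  by (intro continuous_map_measurable smooth_imp_continuous)

lemma smooth_has_pderiv: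
  assumes "smooth N f" "x \<in> Rspace N" "i < N"
  shows "((\<lambda>t. f (x(i := t))) has_vector_derivative pderiv_at i f x) (at (x i))"
proof -
  have "(\<lambda>t. f (x(i := t))) differentiable at (x i)"
    using assms unfolding smooth_def by (metis iter_pderiv.simps(1) lists.Nil)
  then show ?thesis
    unfolding pderiv_at_def using vector_derivative_works by blast
qed

lemma smooth_has_pderiv':
  assumes "smooth N f" "x \<in> Rspace N" "i < N"
  shows "((\<lambda>t. f (x(i := t))) has_vector_derivative pderiv_at i f (x(i := s))) (at s)"
  using smooth_has_pderiv[OF assms(1) upd_Rspace[OF assms(2,3), of s] assms(3)] by simp

lemma pderiv_eqI:
  "((\<lambda>t. f (x(i := t))) has_vector_derivative D) (at (x i)) \<Longrightarrow> pderiv_at i f x = D"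
  unfolding pderiv_at_def by (rule vector_derivative_at)

lemma iter_pderiv_snoc: "iter_pderiv is (pderiv_at i f) = iter_pderiv (is @ [i]) f"
  by (induction "is") auto

lemma smooth_pderiv: "smooth N f \<Longrightarrow> i < N \<Longrightarrow> smooth N (pderiv_at i f)"
  unfolding smooth_def iter_pderiv_snoc using append_in_lists_conv[of _ "[i]" "{..<N}"] by auto

lemma smooth_const: "smooth N (\<lambda>x. c)"
proof (rule smooth_coinduct[where P = "\<lambda>f. f \<in> range (\<lambda>c x. c)"])
  fix f :: "pt \<Rightarrow> complex" and i assume "f \<in> range (\<lambda>c x. c)"
  then obtain c where f: "f = (\<lambda>x. c)" by blast
  show "continuous_map (Rtop N) euclidean f" by (simp add: f)
  have "((\<lambda>t. f (x(i := t))) has_vector_derivative 0) (at (x i))" for x by (simp add: f)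
  then show "\<exists>f'. f' \<in> range (\<lambda>c x. c) \<and>
      (\<forall>x\<in>Rspace N. ((\<lambda>t. f (x(i := t))) has_vector_derivative f' x) (at (x i)))"
    by (intro exI[of _ "\<lambda>x. 0"] conjI ballI rangeI)
qed (rule rangeI)

text \<open>Products alone are not closed under differentiation; finite sums of products are.\<close>

lemma smooth_sum_mult:
  assumes "\<And>f g. (f, g) \<in> set L \<Longrightarrow> smooth N f \<and> smooth N g"
  shows "smooth N (\<lambda>x. \<Sum>(f, g)\<leftarrow>L. f x * g x)"
proof -
  let ?P = "\<lambda>h. \<exists>L. (\<forall>(f, g)\<in>set L. smooth N f \<and> smooth N g) \<and> h = (\<lambda>x. \<Sum>(f, g)\<leftarrow>L. f x * g x)"
  show ?thesis
  proof (rule smooth_coinduct[where P = ?P])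
    show "?P (\<lambda>x. \<Sum>(f, g)\<leftarrow>L. f x * g x)" using assms by blast
  next
    fix h assume "?P h"
    then obtain L where L: "\<And>f g. (f, g) \<in> set L \<Longrightarrow> smooth N f \<and> smooth N g"
      and h: "h = (\<lambda>x. \<Sum>(f, g)\<leftarrow>L. f x * g x)" by blast
    show "continuous_map (Rtop N) euclidean h"
      unfolding h using L
    proof (induction L)
      case (Cons p L)
      obtain f g where p: "p = (f, g)" by (cases p)
      have "smooth N f" "smooth N g" using Cons.prems[of f g] p by auto
      then have "continuous_map (Rtop N) euclidean f" "continuous_map (Rtop N) euclidean g"
        by (auto intro: smooth_imp_continuous)
      moreover have "continuous_map (Rtop N) euclidean (\<lambda>x. \<Sum>(f, g)\<leftarrow>L. f x * g x)"
        using Cons by auto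
      ultimately show ?case unfolding p
        by (auto intro!: continuous_map_add continuous_map_mult)
    qed simp
    fix i assume i: "i < N"
    let ?L = "\<lambda>L. map (\<lambda>(f, g). (pderiv_at i f, g)) L @ map (\<lambda>(f, g). (f, pderiv_at i g)) L"
    have "\<forall>(f, g)\<in>set (?L L). smooth N f \<and> smooth N g"
      using L smooth_pderiv[OF _ i] by auto
    moreover have "((\<lambda>t. h (x(i := t))) has_vector_derivative (\<Sum>(f, g)\<leftarrow>?L L. f x * g x)) (at (x i))"
      if x: "x \<in> Rspace N" for x
      unfolding h using L
    proof (induction L)
      case (Cons p L)
      obtain f g where p: "p = (f, g)" by (cases p)
      have fg: "smooth N f" "smooth N g" using Cons.prems[of f g] p by auto
      have "((\<lambda>t. f (x(i := t)) * g (x(i := t))) has_vector_derivative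
          f (x(i := x i)) * pderiv_at i g x + pderiv_at i f x * g (x(i := x i))) (at (x i))"
        by (intro has_vector_derivative_mult smooth_has_pderiv[OF _ x i] fg)
      moreover have "((\<lambda>t. \<Sum>(f, g)\<leftarrow>L. f (x(i := t)) * g (x(i := t))) has_vector_derivative
          (\<Sum>(f, g)\<leftarrow>?L L. f x * g x)) (at (x i))"
        using Cons by (meson list.set_intros(2))
      ultimately have "((\<lambda>t. \<Sum>(f, g)\<leftarrow>p # L. f (x(i := t)) * g (x(i := t))) has_vector_derivative
          f (x(i := x i)) * pderiv_at i g x + pderiv_at i f x * g (x(i := x i)) +
          (\<Sum>(f, g)\<leftarrow>?L L. f x * g x)) (at (x i))"
        unfolding p list.map sum_list.Cons prod.case by (rule has_vector_derivative_add)
      moreover have "f (x(i := x i)) * pderiv_at i g x + pderiv_at i f x * g (x(i := x i)) +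
          (\<Sum>(f, g)\<leftarrow>?L L. f x * g x) = (\<Sum>(f, g)\<leftarrow>?L (p # L). f x * g x)"
        unfolding p by (simp add: algebra_simps)
      ultimately show ?case by (simp only:)
    qed simp
    ultimately show "\<exists>f'. ?P f' \<and> (\<forall>x\<in>Rspace N. ((\<lambda>t. h (x(i := t))) has_vector_derivative f' x) (at (x i)))"
      by blast
  qed
qed

lemma smooth_mult: "smooth N f \<Longrightarrow> smooth N g \<Longrightarrow> smooth N (\<lambda>x. f x * g x)"
  using smooth_sum_mult[of "[(f, g)]" N] by simp

lemma smooth_diff: "smooth N f \<Longrightarrow> smooth N g \<Longrightarrow> smooth N (\<lambda>x. f x - g x)"
  using smooth_sum_mult[of "[(f, \<lambda>x. 1), (g, \<lambda>x. -1)]" N] smooth_const[of N "-1"] smooth_const[of N 1] by auto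

lemma pderiv_mult:
  assumes "smooth N f" "smooth N g" "x \<in> Rspace N" "i < N"
  shows "pderiv_at i (\<lambda>x. f x * g x) x = f x * pderiv_at i g x + pderiv_at i f x * g x"
proof (rule pderiv_eqI)
  have "((\<lambda>t. f (x(i := t)) * g (x(i := t))) has_vector_derivative
      f (x(i := x i)) * pderiv_at i g x + pderiv_at i f x * g (x(i := x i))) (at (x i))"
    by (intro has_vector_derivative_mult smooth_has_pderiv[OF _ assms(3,4)] assms)
  then show "((\<lambda>t. f (x(i := t)) * g (x(i := t))) has_vector_derivative
      f x * pderiv_at i g x + pderiv_at i f x * g x) (at (x i))" by simp
qed

lemma pderiv_const [simp]: "pderiv_at i (\<lambda>x. c) x = 0"
  by (rule pderiv_eqI) simp

lemma shift_upd: "i < N \<Longrightarrow> shift N y (x(i := t)) = (shift N y x)(i := t + y i)"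
  by (auto simp: shift_def)

lemma has_pderiv_shift:
  assumes f: "smooth N f" and x: "x \<in> Rspace N" and i: "i < N"
  shows "((\<lambda>t. f (shift N y (x(i := t)))) has_vector_derivative pderiv_at i f (shift N y x)) (at (x i))"
proof -
  have eq: "shift N y x i = x i + y i" using i by (simp add: shift_def)
  have *: "((\<lambda>t. f ((shift N y x)(i := t))) has_vector_derivative pderiv_at i f (shift N y x)) (at (x i + y i))"
    using smooth_has_pderiv[OF f shift_Rspace i, of y x] unfolding eq .
  have "((\<lambda>t. t + y i) has_vector_derivative 1) (at (x i))"
    by (auto intro!: derivative_eq_intros)
  from vector_diff_chain_at[OF this *] show ?thesis
    unfolding shift_upd[OF i] by (simp add: o_def)
qed

lemma continuous_map_shift: "continuous_map (Rtop N) (Rtop N) (shift N y)"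
  unfolding continuous_map_componentwise
proof (intro conjI ballI)
  fix k assume k: "k \<in> {..<N}"
  have "continuous_map (Rtop N) euclideanreal (\<lambda>x. x k + y k)"
    using k by (intro continuous_map_add continuous_map_product_projection) auto
  then show "continuous_map (Rtop N) euclideanreal (\<lambda>x. shift N y x k)"
    using k by (simp add: shift_def)
qed (auto simp: shift_def)

lemma smooth_shift:
  assumes "smooth N f" shows "smooth N (\<lambda>x. f (shift N y x))"
proof (rule smooth_coinduct[where P = "\<lambda>h. \<exists>f. smooth N f \<and> h = (\<lambda>x. f (shift N y x))"])
  fix h i assume "\<exists>f. smooth N f \<and> h = (\<lambda>x. f (shift N y x))"
  then obtain f where f: "smooth N f" and h: "h = (\<lambda>x. f (shift N y x))" by blast
  show "continuous_map (Rtop N) euclidean h"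
    unfolding h using continuous_map_compose[OF continuous_map_shift smooth_imp_continuous[OF f], of y]
    by (simp add: o_def)
  assume "i < N"
  then show "\<exists>f'. (\<exists>f. smooth N f \<and> f' = (\<lambda>x. f (shift N y x))) \<and>
      (\<forall>x\<in>Rspace N. ((\<lambda>t. h (x(i := t))) has_vector_derivative f' x) (at (x i)))"
    using f smooth_pderiv[OF f] has_pderiv_shift[OF f] unfolding h by blast
qed (use assms in blast)

subsection \<open>Smooth cutoffs\<close>

text \<open>The coinductive description of a smooth function on the line, as a membership in a class that
  is closed under derivatives.\<close>

definition smooth1 :: "(real \<Rightarrow> real) \<Rightarrow> bool" where
  "smooth1 h \<longleftrightarrow> (\<exists>S. h \<in> S \<and> (\<forall>g\<in>S. \<exists>g'\<in>S. \<forall>t. (g has_real_derivative g' t) (at t)))"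

lemma smooth_coordinate:
  assumes "smooth1 h" "j < N"
  shows "smooth N (\<lambda>x. complex_of_real (h (c * x j + e)))"
proof -
  obtain S where S: "h \<in> S" "\<And>g. g \<in> S \<Longrightarrow> \<exists>g'\<in>S. \<forall>t. (g has_real_derivative g' t) (at t)"
    using assms(1) unfolding smooth1_def by blast
  \<comment> \<open>The factor k collects the powers of c from the chain rule; it is zero after a derivative
    in another direction than j.\<close>
  let ?P = "\<lambda>f. \<exists>g\<in>S. \<exists>k. f = (\<lambda>x::pt. complex_of_real (k * g (c * x j + e)))"
  show ?thesis
  proof (rule smooth_coinduct[where P = ?P])
    show "?P (\<lambda>x. complex_of_real (h (c * x j + e)))"
      using S(1) by (intro bexI[of _ h] exI[of _ 1]) auto
  next
    fix f i assume "?P f"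
    then obtain g k where g: "g \<in> S" and f: "f = (\<lambda>x. complex_of_real (k * g (c * x j + e)))" by blast
    obtain g' where g': "g' \<in> S" "\<And>t. (g has_real_derivative g' t) (at t)" using S(2)[OF g] by blast
    have "continuous_on UNIV g"
      using g'(2) by (meson DERIV_isCont continuous_at_imp_continuous_on)
    then have "continuous_on UNIV (\<lambda>t. g (c * t + e))"
      by (rule continuous_on_compose2) (auto intro!: continuous_intros)
    then have "continuous_on UNIV (\<lambda>t. complex_of_real (k * g (c * t + e)))"
      by (rule continuous_on_of_real[OF continuous_on_mult_left])
    then have "continuous_map euclideanreal euclidean (\<lambda>t. complex_of_real (k * g (c * t + e)))"
      by simp
    from continuous_map_compose[OF continuous_map_product_projection[of j "{..<N}" "\<lambda>_. euclideanreal"] this]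
    show "continuous_map (Rtop N) euclidean f" unfolding f using assms(2) by (simp add: o_def)
    assume i: "i < N"
    define K where "K = (if i = j then k * c else 0)"
    have "((\<lambda>t. f (x(i := t))) has_vector_derivative complex_of_real (K * g' (c * x j + e))) (at (x i))" for x
    proof (cases "i = j")
      case True
      have "((\<lambda>t. k * g (c * t + e)) has_real_derivative k * (g' (c * x i + e) * (c * 1 + 0))) (at (x i))"
        by (intro DERIV_cmult DERIV_chain2[of g] g'(2) DERIV_add DERIV_const DERIV_ident)
      then have "((\<lambda>t. complex_of_real (k * g (c * t + e))) has_vector_derivative
          of_real (k * (g' (c * x i + e) * (c * 1 + 0)))) (at (x i))"
        by (intro has_vector_derivative_of_real) (simp add: has_real_derivative_iff_has_vector_derivative)
      then show ?thesis using True by (simp add: f K_def algebra_simps)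
    qed (simp add: f K_def)
    then show "\<exists>f'. ?P f' \<and> (\<forall>x\<in>Rspace N. ((\<lambda>t. f (x(i := t))) has_vector_derivative f' x) (at (x i)))"
      using g'(1) by (intro exI[of _ "\<lambda>x. complex_of_real (K * g' (c * x j + e))"]) blast
  qed
qed

text \<open>The functions \<open>p(1/t) exp(-1/t)\<close>, extended by zero to the negative half line.  With
  polynomial \<open>p\<close> they form a class that is closed under derivatives, and all of them are flat at 0.\<close>

definition flat :: "real poly \<Rightarrow> real \<Rightarrow> real" where
  "flat p t = (if t > 0 then poly p (1 / t) * exp (- (1 / t)) else 0)"

lemma poly_exp_tendsto_0: "((\<lambda>x::real. poly p x * exp (- x)) \<longlongrightarrow> 0) at_top"
proof -
  have "((\<lambda>x::real. (\<Sum>i\<le>degree p. coeff p i * (x ^ i / exp x))) \<longlongrightarrow> (\<Sum>i\<le>degree p. coeff p i * 0)) at_top"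
    by (intro tendsto_intros tendsto_power_div_exp_0)
  then show ?thesis
    by (simp add: poly_altdef sum_distrib_right exp_minus divide_inverse mult.assoc)
qed

lemma flat_has_derivative:
  "(flat p has_real_derivative flat (pCons 0 (pCons 0 (p - pderiv p))) t) (at t)"
proof -
  consider "t > 0" | "t < 0" | "t = 0" by linarith
  then show ?thesis
  proof cases
    case 1
    have "((\<lambda>t. poly p (1 / t) * exp (- (1 / t))) has_real_derivative
        flat (pCons 0 (pCons 0 (p - pderiv p))) t) (at t)"
      using 1 by (auto intro!: derivative_eq_intros poly_DERIV[THEN DERIV_chain2]
          simp: flat_def field_simps power2_eq_square)
    moreover have "eventually (\<lambda>s. flat p s = poly p (1 / s) * exp (- (1 / s))) (nhds t)"
      using eventually_nhds_in_open[of "{0<..}" t] 1 by (auto elim!: eventually_mono simp: flat_def)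
    ultimately show ?thesis by (subst DERIV_cong_ev[OF refl _ refl])
  next
    case 2
    have "eventually (\<lambda>s. flat p s = 0) (nhds t)"
      using eventually_nhds_in_open[of "{..<0}" t] 2 by (auto elim!: eventually_mono simp: flat_def)
    then have "(flat p has_real_derivative 0) (at t)"
      using DERIV_cong_ev[OF refl, of "flat p" "\<lambda>_. 0" t 0 0] by simp
    then show ?thesis using 2 by (simp add: flat_def)
  next
    case 3
    have "((\<lambda>h. flat p h / h) \<longlongrightarrow> 0) (at_left 0)"
      by (rule Lim_transform_eventually[OF tendsto_const])
        (auto simp: eventually_at_filter flat_def)
    moreover have "((\<lambda>h. flat p h / h) \<longlongrightarrow> 0) (at_right 0)"
    proof -
      have "((\<lambda>h::real. poly (pCons 0 p) (inverse h) * exp (- inverse h)) \<longlongrightarrow> 0) (at_right 0)"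
        by (rule filterlim_compose[OF poly_exp_tendsto_0 filterlim_inverse_at_top_right])
      then show ?thesis
        by (rule Lim_transform_eventually)
          (auto simp: eventually_at_filter flat_def divide_inverse)
    qed
    ultimately have "((\<lambda>h. flat p h / h) \<longlongrightarrow> 0) (at 0)"
      by (simp add: filterlim_at_split)
    then show ?thesis using 3 by (simp add: DERIV_def flat_def)
  qed
qed

lemma flat_nonneg: "flat 1 t \<ge> 0" and flat_le_1: "flat 1 t \<le> 1"
  and flat_pos: "t > 0 \<Longrightarrow> flat 1 t > 0" and flat_eq_0: "t \<le> 0 \<Longrightarrow> flat p t = 0"
  by (auto simp: flat_def)

text \<open>The step is the normalised primitive of \<open>exp(-1/t) exp(-1/(1-t))\<close>, a smooth function that is
  positive exactly on the open unit interval.\<close>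

lemma smooth_step:
  "\<exists>(C::real) (s::real \<Rightarrow> real) s'. C > 0 \<and> smooth1 s \<and>
     (\<forall>t. 0 \<le> s t \<and> s t \<le> 1 \<and> (t \<le> 0 \<longrightarrow> s t = 0) \<and> (t \<ge> 1 \<longrightarrow> s t = 1) \<and>
       (s has_real_derivative s' t) (at t) \<and> \<bar>s' t\<bar> \<le> C)"
proof -
  \<comment> \<open>The derivatives of the integrand are sums of such products.\<close>
  define B where "B L t = (\<Sum>(p, q)\<leftarrow>L. flat p t * flat q (1 - t))" for L t
  have B: "\<exists>L'. \<forall>t. (B L has_real_derivative B L' t) (at t)" for L
  proof -
    let ?d = "\<lambda>p. pCons 0 (pCons 0 (p - pderiv p)) :: real poly"
    let ?L = "map (\<lambda>(p, q). (?d p, q)) L @ map (\<lambda>(p, q). (- p, ?d q)) L"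
    have "(B L has_real_derivative B ?L t) (at t)" for t
    proof (induction L)
      case (Cons x L)
      obtain p q where x: "x = (p, q)" by (cases x)
      have minus: "flat (- p) u = - flat p u" for p u by (simp add: flat_def)
      have "((\<lambda>t. flat q (1 - t)) has_real_derivative flat (?d q) (1 - t) * (0 - 1)) (at t)"
        by (intro DERIV_chain2[OF flat_has_derivative] DERIV_diff DERIV_const DERIV_ident)
      from DERIV_add[OF DERIV_mult[OF flat_has_derivative[of p t] this] Cons.IH]
      show ?case unfolding x by (auto simp: B_def minus algebra_simps)
    qed (simp add: B_def)
    then show ?thesis by blast
  qed
  define b where "b = B [(1, 1)]"
  have b: "b t = flat 1 t * flat 1 (1 - t)" for t by (simp add: b_def B_def)
  have b0: "b t \<ge> 0" "b t \<le> 1" for t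
    unfolding b using flat_nonneg flat_le_1 by (auto intro: mult_le_one)
  have bcont: "continuous_on A b" for A
    using B[of "[(1, 1)]"] unfolding b_def
    by (metis DERIV_continuous_on has_field_derivative_at_within)
  \<comment> \<open>The integral starts at -1 rather than at 0, where the integrand already vanishes, so that 0
    is an interior point and the fundamental theorem applies there in both directions.\<close>
  define I where "I t = integral {-1..t} b" for t
  have I0: "I t = 0" if "t \<le> 0" for t
    unfolding I_def using that by (intro integral_eq_0_iff[THEN iffD2] integral_unique has_integral_is_0) (auto simp: b flat_eq_0)
  have I': "(I has_real_derivative b t) (at t)" for t
  proof (cases "t < 0")
    case True
    have "eventually (\<lambda>s. I s = 0) (nhds t)"
      using eventually_nhds_in_open[of "{..<0}" t] True by (auto elim!: eventually_mono simp: I0)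
    then have "(I has_real_derivative 0) (at t)"
      using DERIV_cong_ev[OF refl, of I "\<lambda>_. 0" t 0 0] by simp
    then show ?thesis using True by (simp add: b flat_eq_0)
  next
    case False
    have "(I has_real_derivative b t) (at t within {-1..t+1})"
      unfolding I_def using False by (intro integral_has_real_derivative bcont) auto
    then show ?thesis using False by (simp add: at_within_Icc_at)
  qed
  have mono: "I u \<le> I v" if "u \<le> v" for u v
    by (rule DERIV_nonneg_imp_nondecreasing[OF that]) (use I' b0(1) in blast)
  have I1: "I t = I 1" if "t \<ge> 1" for t
  proof (cases "t = 1")
    case False
    show ?thesis
    proof (rule DERIV_isconst_end[of 1 t I])
      show "1 < t" using False that by simp
      show "continuous_on {1..t} I"
        using I' by (intro DERIV_continuous_on) (auto intro: has_field_derivative_at_within)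
      show "(I has_real_derivative 0) (at x)" if "1 < x" "x < t" for x
        using I'[of x] that by (simp add: b flat_eq_0)
    qed
  qed simp
  have I01: "I 1 > 0"
  proof -
    have "I 0 < I 1"
    proof (rule DERIV_pos_imp_increasing_open[of 0 1 I])
      show "continuous_on {0..1} I"
        using I' by (intro DERIV_continuous_on) (auto intro: has_field_derivative_at_within)
      show "\<exists>y. (I has_real_derivative y) (at x) \<and> 0 < y" if "0 < x" "x < 1" for x
        using I'[of x] that flat_pos[of x] flat_pos[of "1 - x"] by (intro exI[of _ "b x"]) (auto simp: b)
    qed simp
    then show ?thesis using I0[of 0] by simp
  qed
  have s': "((\<lambda>t. I t / I 1) has_real_derivative b t / I 1) (at t)" for t
    by (intro DERIV_cdivide I')
  show ?thesis
  proof (rule exI[of _ "1 / I 1"], rule exI[of _ "\<lambda>t. I t / I 1"], rule exI[of _ "\<lambda>t. b t / I 1"],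
      intro conjI allI impI)
    let ?S = "insert (\<lambda>t. I t / I 1) (range (\<lambda>L t. B L t / I 1))"
    have "\<exists>g'\<in>?S. \<forall>t. (g has_real_derivative g' t) (at t)" if gS: "g \<in> ?S" for g
    proof -
      consider "g = (\<lambda>t. I t / I 1)" | L where "g = (\<lambda>t. B L t / I 1)" using gS by blast
      then show ?thesis
      proof cases
        case 1
        show ?thesis
          by (rule bexI[of _ "\<lambda>t. B [(1, 1)] t / I 1"]) (use s' in \<open>unfold 1 b_def, blast+\<close>)
      next
        case 2
        obtain L' where L': "\<And>t. (B L has_real_derivative B L' t) (at t)" using B by blast
        show ?thesis
          by (rule bexI[of _ "\<lambda>t. B L' t / I 1"]) (unfold 2, use L' DERIV_cdivide in blast, blast)
      qed
    qed
    note * = this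
    show "smooth1 (\<lambda>t. I t / I 1)"
      unfolding smooth1_def by (intro exI[of _ ?S] conjI ballI insertI1) (rule *)
    show "0 \<le> I t / I 1" for t
      using mono[of "min t 0" t] I0[of "min t 0"] I01 by simp
    show "I t / I 1 \<le> 1" for t
      using mono[of t "max t 1"] I01 unfolding I1[OF max.cobounded2] by simp
    show "\<bar>b t / I 1\<bar> \<le> 1 / I 1" for t
      using b0[of t] I01 by (simp add: divide_right_mono)
    show "I t / I 1 = 1" if "t \<ge> 1" for t
      unfolding I1[OF that] using I01 by simp
  qed (use I0 I01 s' in auto)
qed

definition rsmooth :: "nat \<Rightarrow> (pt \<Rightarrow> real) \<Rightarrow> bool" where
  "rsmooth N \<eta> \<longleftrightarrow> smooth N (\<lambda>x. complex_of_real (\<eta> x))"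

definition rpd :: "nat \<Rightarrow> (pt \<Rightarrow> real) \<Rightarrow> pt \<Rightarrow> real" where
  "rpd i \<eta> x = Re (pderiv_at i (\<lambda>x. complex_of_real (\<eta> x)) x)"

lemma rsmooth_has_rpd:
  assumes "rsmooth N \<eta>" "x \<in> Rspace N" "i < N"
  shows "((\<lambda>t. \<eta> (x(i := t))) has_real_derivative rpd i \<eta> x) (at (x i))"
    and "pderiv_at i (\<lambda>x. complex_of_real (\<eta> x)) x = complex_of_real (rpd i \<eta> x)"
proof -
  have *: "((\<lambda>t. complex_of_real (\<eta> (x(i := t)))) has_vector_derivative
      pderiv_at i (\<lambda>x. complex_of_real (\<eta> x)) x) (at (x i))"
    using smooth_has_pderiv[of N "\<lambda>x. complex_of_real (\<eta> x)"] assms unfolding rsmooth_def by blast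
  from bounded_linear.has_vector_derivative[OF bounded_linear_Re *]
  show "((\<lambda>t. \<eta> (x(i := t))) has_real_derivative rpd i \<eta> x) (at (x i))"
    by (simp add: rpd_def has_real_derivative_iff_has_vector_derivative)
  then have "((\<lambda>t. \<eta> (x(i := t))) has_real_derivative rpd i \<eta> x) (at (x i))" .
  from has_vector_derivative_of_real[OF this]
  show "pderiv_at i (\<lambda>x. complex_of_real (\<eta> x)) x = complex_of_real (rpd i \<eta> x)"
    by (rule pderiv_eqI)
qed

lemma rpd_eqI:
  assumes "((\<lambda>t. \<eta> (x(i := t))) has_real_derivative D) (at (x i))"
  shows "rpd i \<eta> x = D"
  using pderiv_eqI[where f = "\<lambda>x. complex_of_real (\<eta> x)", OF has_vector_derivative_of_real[OF assms]]
  by (simp add: rpd_def)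

lemma rsmooth_mult: "rsmooth N f \<Longrightarrow> rsmooth N g \<Longrightarrow> rsmooth N (\<lambda>x. f x * g x)"
  unfolding rsmooth_def of_real_mult by (rule smooth_mult)

lemma rsmooth_const: "rsmooth N (\<lambda>x. c)"
  unfolding rsmooth_def by (rule smooth_const)

lemma rsmooth_diff: "rsmooth N f \<Longrightarrow> rsmooth N g \<Longrightarrow> rsmooth N (\<lambda>x. f x - g x)"
  unfolding rsmooth_def of_real_diff by (rule smooth_diff)

lemma rsmooth_prod:
  assumes "finite J" "\<And>j. j \<in> J \<Longrightarrow> rsmooth N (f j)"
  shows "rsmooth N (\<lambda>x. \<Prod>j\<in>J. f j x)"
  using assms by (induction J rule: finite_induct) (auto simp: rsmooth_const intro!: rsmooth_mult)

lemma rpd_mult: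
  assumes "rsmooth N f" "rsmooth N g" "x \<in> Rspace N" "i < N"
  shows "rpd i (\<lambda>x. f x * g x) x = f x * rpd i g x + rpd i f x * g x"
  using pderiv_mult[OF assms(1,2)[unfolded rsmooth_def] assms(3,4)]
  unfolding rsmooth_has_rpd(2)[OF assms(1,3,4)] rsmooth_has_rpd(2)[OF assms(2,3,4)]
  by (simp add: rpd_def)

text \<open>An extreme value of a cutoff is a critical point along every coordinate line.  This locates
  the gradient of a cutoff without a description of its support.\<close>

lemma rpd_extremum:
  assumes \<eta>: "rsmooth N \<eta>" "\<And>x. x \<in> Rspace N \<Longrightarrow> 0 \<le> \<eta> x \<and> \<eta> x \<le> 1"
    and x: "x \<in> Rspace N" "i < N" "\<eta> x = 0 \<or> \<eta> x = 1"
  shows "rpd i \<eta> x = 0"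
proof -
  note D = rsmooth_has_rpd(1)[OF \<eta>(1) x(1,2)]
  have b: "0 \<le> \<eta> (x(i := t)) \<and> \<eta> (x(i := t)) \<le> 1" for t
    using \<eta>(2)[OF upd_Rspace[OF x(1,2)]] by blast
  from x(3) show ?thesis
  proof
    assume 0: "\<eta> x = 0"
    show ?thesis
      by (rule DERIV_local_min[OF D zero_less_one]) (unfold fun_upd_triv 0, use b in blast)
  next
    assume 1: "\<eta> x = 1"
    show ?thesis
      by (rule DERIV_local_max[OF D zero_less_one]) (unfold fun_upd_triv 1, use b in blast)
  qed
qed

text \<open>A number \<open>C\<close> such that the characteristic function of any box, in any dimension, can be smoothed
  within a layer of width \<open>d\<close> at the cost of a gradient at most \<open>C / d\<close>.\<close>

definition bump_constant :: "real \<Rightarrow> bool" where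
  "bump_constant C \<longleftrightarrow> C > 0 \<and> (\<forall>N lo hi (d::real). d > 0 \<longrightarrow> (\<exists>\<eta>. rsmooth N \<eta> \<and>
     (\<forall>x\<in>Rspace N. 0 \<le> \<eta> x \<and> \<eta> x \<le> 1) \<and>
     (\<forall>x\<in>Rspace N. (\<forall>i<N. lo i \<le> x i \<and> x i \<le> hi i) \<longrightarrow> \<eta> x = 1) \<and>
     (\<forall>x\<in>Rspace N. x \<notin> obox N (\<lambda>i. lo i - d) (\<lambda>i. hi i + d) \<longrightarrow> \<eta> x = 0) \<and>
     (\<forall>x\<in>Rspace N. \<forall>i<N. \<bar>rpd i \<eta> x\<bar> \<le> C / d)))"

text \<open>A product of one step up and one step down in every coordinate.  The constant does not
  depend on the dimension because a partial derivative only hits one of the factors and the others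
  are at most one.\<close>

lemma ex_bump_constant: "\<exists>C. bump_constant C"
proof -
  obtain C :: real and s s' :: "real \<Rightarrow> real" where s: "C > 0" "smooth1 s" "\<And>t. 0 \<le> s t" "\<And>t. s t \<le> 1"
    "\<And>t. t \<le> 0 \<Longrightarrow> s t = 0" "\<And>t. t \<ge> 1 \<Longrightarrow> s t = 1"
    "\<And>t. (s has_real_derivative s' t) (at t)" "\<And>t. \<bar>s' t\<bar> \<le> C"
    using smooth_step by metis
  show ?thesis
  unfolding bump_constant_def
  proof (intro exI[of _ "2 * C"] conjI allI impI)
    show "2 * C > 0" using s(1) by simp
    fix N and lo hi :: "nat \<Rightarrow> real" and d :: real assume d: "d > 0"
    define h where "h i t = s ((1 / d) * t + (1 - lo i / d)) * s ((- 1 / d) * t + (1 + hi i / d))" for i t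
    define h' where "h' i t = s ((1 / d) * t + (1 - lo i / d)) * (s' ((- 1 / d) * t + (1 + hi i / d)) * (- 1 / d))
      + s' ((1 / d) * t + (1 - lo i / d)) * (1 / d) * s ((- 1 / d) * t + (1 + hi i / d))" for i t
    define \<eta> where "\<eta> x = (\<Prod>i<N. h i (x i))" for x :: pt
    have h01: "0 \<le> h i t" "h i t \<le> 1" for i t
      unfolding h_def using s(3,4) by (auto intro: mult_le_one)
    have h1: "h i t = 1" if "lo i \<le> t" "t \<le> hi i" for i t
      unfolding h_def using that d by (subst (1 2) s(6)) (auto simp: field_simps)
    have h0: "h i t = 0" if "\<not> (lo i - d < t \<and> t < hi i + d)" for i t
    proof -
      have "(1 / d) * t + (1 - lo i / d) \<le> 0 \<or> (- 1 / d) * t + (1 + hi i / d) \<le> 0"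
      proof -
        have "(1 / d) * t + (1 - lo i / d) = (t - (lo i - d)) / d"
          "(- 1 / d) * t + (1 + hi i / d) = (hi i + d - t) / d"
          using d by (simp_all add: field_simps)
        then show ?thesis using that d by (simp add: divide_le_0_iff) linarith
      qed
      then show ?thesis unfolding h_def using s(5) by auto
    qed
    have hd: "(h i has_real_derivative h' i t) (at t)" for i t
    proof -
      have "((\<lambda>t. s (a * t + c)) has_real_derivative s' (a * t + c) * a) (at t)" for a c
      proof -
        have "((\<lambda>t. a * t + c) has_real_derivative a) (at t)"
          by (auto intro!: derivative_eq_intros)
        from DERIV_chain2[OF _ this, of s] show ?thesis using s(7) by blast
      qed
      from DERIV_mult[OF this[of "1 / d" "1 - lo i / d"] this[of "- 1 / d" "1 + hi i / d"]]
      show ?thesis unfolding h_def h'_def by (simp add: add.commute mult.commute)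
    qed
    have hb: "\<bar>h' i t\<bar> \<le> 2 * C / d" for i t
    proof -
      have "\<bar>x * (y * (- 1 / d)) + z * (1 / d) * w\<bar> \<le> 2 * C / d"
        if "0 \<le> x" "x \<le> 1" "0 \<le> w" "w \<le> 1" "\<bar>y\<bar> \<le> C" "\<bar>z\<bar> \<le> C" for x y z w
      proof -
        have "\<bar>x * y\<bar> \<le> C" "\<bar>z * w\<bar> \<le> C"
          using mult_mono[of x 1 "\<bar>y\<bar>" C] mult_mono[of "\<bar>z\<bar>" C w 1] that s(1) by (auto simp: abs_mult)
        then have "\<bar>z * w - x * y\<bar> \<le> 2 * C" by linarith
        then have "\<bar>(z * w - x * y) / d\<bar> \<le> 2 * C / d"
          using d by (simp add: divide_right_mono)
        also have "(z * w - x * y) / d = x * (y * (- 1 / d)) + z * (1 / d) * w"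
          using d by (simp add: field_simps)
        finally show ?thesis .
      qed
      then show ?thesis unfolding h'_def using s(3,4,8) by blast
    qed
    have sm: "rsmooth N (\<lambda>x. h i (x i))" if "i < N" for i
      unfolding h_def by (intro rsmooth_mult; unfold rsmooth_def; intro smooth_coordinate s(2) that)
    have "rsmooth N \<eta>"
      unfolding \<eta>_def by (intro rsmooth_prod sm) auto
    moreover have "\<forall>x\<in>Rspace N. 0 \<le> \<eta> x \<and> \<eta> x \<le> 1"
      unfolding \<eta>_def using h01 by (auto intro: prod_nonneg prod_le_1)
    moreover have "\<forall>x\<in>Rspace N. (\<forall>i<N. lo i \<le> x i \<and> x i \<le> hi i) \<longrightarrow> \<eta> x = 1"
      unfolding \<eta>_def using h1 by (auto intro: prod.neutral)
    moreover have "\<forall>x\<in>Rspace N. x \<notin> obox N (\<lambda>i. lo i - d) (\<lambda>i. hi i + d) \<longrightarrow> \<eta> x = 0"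
    proof (intro ballI impI)
      fix x assume "x \<in> Rspace N" "x \<notin> obox N (\<lambda>i. lo i - d) (\<lambda>i. hi i + d)"
      then obtain i where "i < N" "\<not> (lo i - d < x i \<and> x i < hi i + d)" unfolding mem_obox by blast
      then show "\<eta> x = 0" unfolding \<eta>_def using h0 by (intro prod_zero) auto
    qed
    moreover have "\<forall>x\<in>Rspace N. \<forall>i<N. \<bar>rpd i \<eta> x\<bar> \<le> 2 * C / d"
    proof (intro ballI allI impI)
      fix x i assume x: "x \<in> Rspace N" and i: "i < N"
      define P where "P = (\<Prod>j\<in>{..<N} - {i}. h j (x j))"
      have P: "0 \<le> P" "P \<le> 1" unfolding P_def using h01 by (auto intro: prod_nonneg prod_le_1)
      have "\<eta> (x(i := t)) = h i t * P" for t
        unfolding \<eta>_def P_def using i by (subst prod.remove[of _ i]) auto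
      then have "((\<lambda>t. \<eta> (x(i := t))) has_real_derivative h' i (x i) * P) (at (x i))"
        using DERIV_cmult_right[OF hd[of i "x i"], of P] by simp
      then have "rpd i \<eta> x = h' i (x i) * P" by (rule rpd_eqI)
      then show "\<bar>rpd i \<eta> x\<bar> \<le> 2 * C / d"
        using mult_mono[OF hb[of i "x i"] P(2)] P(1) d s(1) by (simp add: abs_mult)
    qed
    ultimately show "\<exists>\<eta>. rsmooth N \<eta> \<and> (\<forall>x\<in>Rspace N. 0 \<le> \<eta> x \<and> \<eta> x \<le> 1) \<and>
       (\<forall>x\<in>Rspace N. (\<forall>i<N. lo i \<le> x i \<and> x i \<le> hi i) \<longrightarrow> \<eta> x = 1) \<and>
       (\<forall>x\<in>Rspace N. x \<notin> obox N (\<lambda>i. lo i - d) (\<lambda>i. hi i + d) \<longrightarrow> \<eta> x = 0) \<and>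
       (\<forall>x\<in>Rspace N. \<forall>i<N. \<bar>rpd i \<eta> x\<bar> \<le> 2 * C / d)"
      by blast
  qed
qed

lemma bump_constantD:
  assumes "bump_constant C" "d > 0"
  shows "\<exists>\<eta>. rsmooth N \<eta> \<and> (\<forall>x\<in>Rspace N. 0 \<le> \<eta> x \<and> \<eta> x \<le> 1) \<and>
     (\<forall>x\<in>Rspace N. (\<forall>i<N. lo i \<le> x i \<and> x i \<le> hi i) \<longrightarrow> \<eta> x = 1) \<and>
     (\<forall>x\<in>Rspace N. x \<notin> obox N (\<lambda>i. lo i - d) (\<lambda>i. hi i + d) \<longrightarrow> \<eta> x = 0) \<and>
     (\<forall>x\<in>Rspace N. \<forall>i<N. \<bar>rpd i \<eta> x\<bar> \<le> C / d)"
  using assms unfolding bump_constant_def by (elim conjE allE impE)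

subsection \<open>Test functions\<close>

text \<open>The cubes about the origin with integer side exhaust the space.\<close>

lemma compactin_subset_cube:
  assumes C: "compactin (Rtop N) C"
  shows "\<exists>R>0. C \<subseteq> cube N (\<lambda>_. 0) R"
proof -
  let ?U = "range (\<lambda>n::nat. cube N (\<lambda>_. 0) (real n))"
  have "C \<subseteq> \<Union>?U"
  proof
    fix x assume "x \<in> C"
    then have x: "x \<in> Rspace N" using compactin_subset_topspace[OF C] by blast
    obtain n :: nat where n: "(\<Sum>i<N. \<bar>x i\<bar>) < real n" using reals_Archimedean2 by blast
    have "\<bar>x i\<bar> < real n" if "i < N" for i
      using member_le_sum[of i "{..<N}" "\<lambda>i. \<bar>x i\<bar>"] n that by auto
    then have "x \<in> cube N (\<lambda>_. 0) (real n)" using x unfolding mem_cube by simp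
    then show "x \<in> \<Union>?U" by blast
  qed
  moreover have "openin (Rtop N) U" if "U \<in> ?U" for U using that openin_obox by blast
  ultimately obtain F where F: "finite F" "F \<subseteq> ?U" "C \<subseteq> \<Union>F"
    using compactinD[OF C, of ?U] by blast
  obtain A where A: "finite A" "F = (\<lambda>n. cube N (\<lambda>_. 0) (real n)) ` A"
    using finite_subset_image[OF F(1,2)] by blast
  define R where "R = real (Max (insert 0 A)) + 1"
  have "C \<subseteq> cube N (\<lambda>_. 0) R"
  proof
    fix x assume "x \<in> C"
    then obtain n where n: "n \<in> A" "x \<in> cube N (\<lambda>_. 0) (real n)" using F(3) unfolding A(2) by blast
    have "n \<le> Max (insert 0 A)" using A n by simp
    then have "real n < R" unfolding R_def by simp
    then show "x \<in> cube N (\<lambda>_. 0) R" using n(2) less_trans unfolding mem_cube by blast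
  qed
  moreover have "R > 0" unfolding R_def by simp
  ultimately show ?thesis by blast
qed

lemma Cc_inf_smooth: "f \<in> Cc_inf N \<Omega> \<Longrightarrow> smooth N f"
  by (simp add: Cc_inf_def)

lemma Cc_infI:
  "smooth N f \<Longrightarrow> compactin (Rtop N) C \<Longrightarrow> C \<subseteq> \<Omega> \<Longrightarrow> (\<forall>x\<in>Rspace N - C. f x = 0) \<Longrightarrow>
    f \<in> Cc_inf N \<Omega>"
  unfolding Cc_inf_def by blast

lemma Cc_infE:
  assumes "f \<in> Cc_inf N \<Omega>"
  shows "\<exists>C. compactin (Rtop N) C \<and> C \<subseteq> \<Omega> \<and> (\<forall>x\<in>Rspace N - C. f x = 0)"
  using assms unfolding Cc_inf_def by blast

lemma Cc_inf_mono: "f \<in> Cc_inf N \<Omega> \<Longrightarrow> \<Omega> \<subseteq> \<Omega>' \<Longrightarrow> f \<in> Cc_inf N \<Omega>'"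
  unfolding Cc_inf_def by blast

lemma Cc_inf_bounded_support:
  assumes "f \<in> Cc_inf N \<Omega>"
  shows "\<exists>R>0. \<forall>x\<in>Rspace N - cube N (\<lambda>_. 0) R. f x = 0"
proof -
  obtain C where C: "compactin (Rtop N) C" "\<forall>x\<in>Rspace N - C. f x = 0"
    using Cc_infE[OF assms] by blast
  obtain R where R: "R > 0" "C \<subseteq> cube N (\<lambda>_. 0) R" using compactin_subset_cube[OF C(1)] by blast
  have "\<forall>x\<in>Rspace N - cube N (\<lambda>_. 0) R. f x = 0" using C(2) R(2) by blast
  then show ?thesis using R(1) by blast
qed

lemma Cc_inf_bounded:
  assumes f: "f \<in> Cc_inf N \<Omega>"
  shows "\<exists>B>0. \<forall>x\<in>Rspace N. cmod (f x) \<le> B"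
proof -
  obtain C where C: "compactin (Rtop N) C" "\<forall>x\<in>Rspace N - C. f x = 0"
    using Cc_infE[OF f] by blast
  have "compactin euclidean (f ` C)"
    using image_compactin[OF C(1) smooth_imp_continuous[OF Cc_inf_smooth[OF f]]] .
  then have "bounded (f ` C)" by (simp add: compact_imp_bounded)
  then obtain B where B: "B > 0" "\<And>x. x \<in> C \<Longrightarrow> cmod (f x) \<le> B"
    unfolding bounded_pos by blast
  have "cmod (f x) \<le> B" if "x \<in> Rspace N" for x
    using B(1) B(2)[of x] C(2) that by (cases "x \<in> C") auto
  then have "\<forall>x\<in>Rspace N. cmod (f x) \<le> B" ..
  then show ?thesis using B(1) by blast
qed

lemma Cc_inf_Rspace:
  assumes "smooth N f" "\<forall>x\<in>Rspace N - cube N (\<lambda>_. 0) R. f x = 0"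
  shows "f \<in> Cc_inf N (Rspace N)"
proof (rule Cc_infI[OF assms(1)])
  show "compactin (Rtop N) (PiE {..<N} (\<lambda>_. {-R..R}))"
    unfolding compactin_PiE by simp
  show "PiE {..<N} (\<lambda>_. {-R..R}) \<subseteq> Rspace N" unfolding Rspace_PiE by (rule PiE_mono) simp
  show "\<forall>x\<in>Rspace N - PiE {..<N} (\<lambda>_. {-R..R}). f x = 0"
  proof
    fix x assume x: "x \<in> Rspace N - PiE {..<N} (\<lambda>_. {-R..R})"
    then obtain i where "i < N" "x i \<notin> {-R..R}" unfolding Rspace_PiE PiE_iff by blast
    then have "x \<notin> cube N (\<lambda>_. 0) R" unfolding mem_cube by (auto simp: abs_less_iff)
    then show "f x = 0" using assms(2) x by blast
  qed
qed

lemma Cc_inf_pderiv: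
  assumes f: "f \<in> Cc_inf N \<Omega>" and i: "i < N"
  shows "pderiv_at i f \<in> Cc_inf N \<Omega>"
proof -
  obtain C where C: "compactin (Rtop N) C" "C \<subseteq> \<Omega>" "\<forall>x\<in>Rspace N - C. f x = 0"
    using Cc_infE[OF f] by blast
  have sm: "smooth N f" using f by (rule Cc_inf_smooth)
  show ?thesis
  proof (rule Cc_infI[OF smooth_pderiv[OF sm i] C(1,2)], rule ballI)
    fix x assume "x \<in> Rspace N - C"
    then have x: "x \<in> Rspace N" "x \<notin> C" by blast+
    have "Hausdorff_space (Rtop N)" by (simp add: Hausdorff_space_product_topology)
    then have "closedin (Rtop N) C" using C(1) compactin_imp_closedin by blast
    then have "openin (Rtop N) (Rspace N - C)" by (rule openin_diff[OF openin_topspace])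
    then obtain r where r: "r > 0" "cube N x r \<subseteq> Rspace N - C"
      using openin_contains_cube[of N "Rspace N - C" x] x by blast
    have "f (x(i := t)) = 0" if "\<bar>t - x i\<bar> < r" for t
    proof -
      have "x(i := t) \<in> cube N x r" using upd_Rspace[OF x(1) i] that r(1) unfolding mem_cube by simp
      then show ?thesis using r(2) C(3) by blast
    qed
    then have "eventually (\<lambda>t. f (x(i := t)) = 0) (nhds (x i))"
      unfolding eventually_nhds_metric dist_real_def using r(1) by blast
    then have "((\<lambda>t. f (x(i := t))) has_vector_derivative 0) (at (x i))"
      using has_vector_derivative_cong_ev[where S = UNIV and f = "\<lambda>t. f (x(i := t))" and g = "\<lambda>t. 0"
          and x = "x i" and f' = 0] C(3) x
      by simp
    then show "pderiv_at i f x = 0" by (rule pderiv_eqI)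
  qed
qed

lemma Cc_inf_mult:
  assumes g: "smooth N g" and f: "f \<in> Cc_inf N \<Omega>"
  shows "(\<lambda>x. g x * f x) \<in> Cc_inf N \<Omega>"
proof -
  obtain C where "compactin (Rtop N) C" "C \<subseteq> \<Omega>" "\<forall>x\<in>Rspace N - C. f x = 0"
    using Cc_infE[OF f] by blast
  then show ?thesis
    by (intro Cc_infI[OF smooth_mult[OF g Cc_inf_smooth[OF f]]]) auto
qed

text \<open>The compact set that carries the product is the old one without the open set \<open>V\<close>.\<close>

lemma Cc_inf_mult_off:
  assumes g: "smooth N g" and f: "f \<in> Cc_inf N \<Omega>"
    and V: "openin (Rtop N) V" "K \<subseteq> V" "\<And>x. x \<in> V \<Longrightarrow> g x = 0"
  shows "(\<lambda>x. g x * f x) \<in> Cc_inf N (\<Omega> - K)"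
proof -
  obtain C where C: "compactin (Rtop N) C" "C \<subseteq> \<Omega>" "\<forall>x\<in>Rspace N - C. f x = 0"
    using Cc_infE[OF f] by blast
  have "compactin (Rtop N) (C \<inter> (Rspace N - V))"
    using C(1) closedin_diff[OF closedin_topspace V(1)] by (rule compact_Int_closedin)
  then show ?thesis
    using C V(2,3) by (intro Cc_infI[OF smooth_mult[OF g Cc_inf_smooth[OF f]]]) auto
qed

lemma Cc_inf_diff:
  assumes f: "f \<in> Cc_inf N \<Omega>" and g: "g \<in> Cc_inf N \<Omega>"
  shows "(\<lambda>x. f x - g x) \<in> Cc_inf N \<Omega>"
proof -
  obtain C where C: "compactin (Rtop N) C" "C \<subseteq> \<Omega>" "\<forall>x\<in>Rspace N - C. f x = 0"
    using Cc_infE[OF f] by blast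
  obtain D where D: "compactin (Rtop N) D" "D \<subseteq> \<Omega>" "\<forall>x\<in>Rspace N - D. g x = 0"
    using Cc_infE[OF g] by blast
  show ?thesis
    using C D by (intro Cc_infI[OF smooth_diff[OF Cc_inf_smooth[OF f] Cc_inf_smooth[OF g]], of "C \<union> D"]
        compactin_Un) auto
qed

lemma zero_Cc_inf: "(\<lambda>x. 0) \<in> Cc_inf N \<Omega>"
  by (rule Cc_infI[of _ _ "{}"]) (auto simp: smooth_const)

lemma Cc_inf_shift:
  assumes f: "f \<in> Cc_inf N (Rspace N)"
  shows "(\<lambda>x. f (shift N y x)) \<in> Cc_inf N (Rspace N)"
proof -
  obtain R where R: "\<forall>x\<in>Rspace N - cube N (\<lambda>_. 0) R. f x = 0"
    using Cc_inf_bounded_support[OF f] by blast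
  define Y where "Y = (\<Sum>i<N. \<bar>y i\<bar>)"
  have Y: "\<bar>y i\<bar> \<le> Y" if "i < N" for i
    unfolding Y_def using member_le_sum[of i "{..<N}" "\<lambda>i. \<bar>y i\<bar>"] that by auto
  show ?thesis
  proof (rule Cc_inf_Rspace[OF smooth_shift[OF Cc_inf_smooth[OF f]], where R = "R + Y"], rule ballI)
    fix x assume x: "x \<in> Rspace N - cube N (\<lambda>_. 0) (R + Y)"
    then obtain i where i: "i < N" "\<not> \<bar>x i\<bar> < R + Y" unfolding mem_cube Diff_iff by auto
    then have "\<not> \<bar>shift N y x i\<bar> < R" using Y[of i] by (simp add: shift_def)
    then have "shift N y x \<notin> cube N (\<lambda>_. 0) R" using i(1) unfolding mem_cube by auto
    then show "f (shift N y x) = 0" using R shift_Rspace by blast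
  qed
qed

lemma Cc_inf_measurable: "f \<in> Cc_inf N \<Omega> \<Longrightarrow> f \<in> borel_measurable (Leb N)"
  by (intro smooth_measurable Cc_inf_smooth)

section \<open>Square integrable functions and the density of test functions\<close>

definition sqint :: "'a measure \<Rightarrow> ('a \<Rightarrow> complex) \<Rightarrow> bool" where
  "sqint M f \<longleftrightarrow> f \<in> borel_measurable M \<and> integrable M (\<lambda>x. (cmod (f x))\<^sup>2)"

lemma sqint_measurable [measurable_dest]: "sqint M f \<Longrightarrow> f \<in> borel_measurable M"
  and sqint_integrable: "sqint M f \<Longrightarrow> integrable M (\<lambda>x. (cmod (f x))\<^sup>2)"
  by (auto simp: sqint_def)

lemma cmod_add_sq_le: "(cmod (a + b))\<^sup>2 \<le> 2 * (cmod a)\<^sup>2 + 2 * (cmod b)\<^sup>2"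
proof -
  have "(cmod (a + b))\<^sup>2 \<le> (cmod a + cmod b)\<^sup>2"
    by (intro power_mono norm_triangle_ineq) simp
  also have "\<dots> \<le> 2 * (cmod a)\<^sup>2 + 2 * (cmod b)\<^sup>2"
    using sum_squares_bound[of "cmod a" "cmod b"] by (simp add: power2_sum)
  finally show ?thesis .
qed

lemma sqint_bound:
  assumes "sqint M g" "f \<in> borel_measurable M" "AE x in M. cmod (f x) \<le> B * cmod (g x)"
  shows "sqint M f"
proof -
  have "integrable M (\<lambda>x. (cmod (f x))\<^sup>2)"
  proof (rule Bochner_Integration.integrable_bound)
    show "integrable M (\<lambda>x. B\<^sup>2 * (cmod (g x))\<^sup>2)"
      using sqint_integrable[OF assms(1)] by simp
    show "AE x in M. norm ((cmod (f x))\<^sup>2) \<le> norm (B\<^sup>2 * (cmod (g x))\<^sup>2)"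
      using assms(3)
    proof eventually_elim
      case (elim x)
      have "(cmod (f x))\<^sup>2 \<le> (B * cmod (g x))\<^sup>2"
        using elim by (intro power_mono) auto
      then show ?case by (simp add: power_mult_distrib)
    qed
  qed (use assms(2) in measurable)
  then show ?thesis using assms(2) by (simp add: sqint_def)
qed

lemma sqint_add:
  assumes "sqint M f" "sqint M g"
  shows "sqint M (\<lambda>x. f x + g x)"
    and "(\<integral>x. (cmod (f x + g x))\<^sup>2 \<partial>M) \<le> 2 * (\<integral>x. (cmod (f x))\<^sup>2 \<partial>M) + 2 * (\<integral>x. (cmod (g x))\<^sup>2 \<partial>M)"
proof -
  note [measurable] = assms[THEN sqint_measurable]
  have i: "integrable M (\<lambda>x. 2 * (cmod (f x))\<^sup>2 + 2 * (cmod (g x))\<^sup>2)"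
    using assms[THEN sqint_integrable] by simp
  have j: "integrable M (\<lambda>x. (cmod (f x + g x))\<^sup>2)"
    by (rule Bochner_Integration.integrable_bound[OF i]) (use cmod_add_sq_le in auto)
  then show "sqint M (\<lambda>x. f x + g x)" by (simp add: sqint_def)
  have "(\<integral>x. (cmod (f x + g x))\<^sup>2 \<partial>M) \<le> (\<integral>x. 2 * (cmod (f x))\<^sup>2 + 2 * (cmod (g x))\<^sup>2 \<partial>M)"
    by (intro integral_mono i j cmod_add_sq_le)
  also have "\<dots> = 2 * (\<integral>x. (cmod (f x))\<^sup>2 \<partial>M) + 2 * (\<integral>x. (cmod (g x))\<^sup>2 \<partial>M)"
    using assms[THEN sqint_integrable] by simp
  finally show "(\<integral>x. (cmod (f x + g x))\<^sup>2 \<partial>M) \<le> 2 * (\<integral>x. (cmod (f x))\<^sup>2 \<partial>M) + 2 * (\<integral>x. (cmod (g x))\<^sup>2 \<partial>M)" .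
qed

lemma sqint_cmult: "sqint M f \<Longrightarrow> sqint M (\<lambda>x. c * f x)"
  by (rule sqint_bound[of M f _ "cmod c"]) (auto simp: norm_mult sqint_def)

lemma sqint_diff:
  assumes "sqint M f" "sqint M g"
  shows "sqint M (\<lambda>x. f x - g x)"
    and "(\<integral>x. (cmod (f x - g x))\<^sup>2 \<partial>M) \<le> 2 * (\<integral>x. (cmod (f x))\<^sup>2 \<partial>M) + 2 * (\<integral>x. (cmod (g x))\<^sup>2 \<partial>M)"
  using sqint_add[OF assms(1) sqint_cmult[OF assms(2), of "-1"]] by simp_all

lemma cnj_borel_measurable [measurable]: "f \<in> borel_measurable M \<Longrightarrow> (\<lambda>x. cnj (f x)) \<in> borel_measurable M"
  by (rule measurable_compose[OF _ borel_measurable_continuous_onI[OF continuous_on_cnj[OF continuous_on_id]]])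

lemma sqint_cnj: "sqint M f \<Longrightarrow> sqint M (\<lambda>x. cnj (f x))"
  by (auto simp: sqint_def intro!: cnj_borel_measurable)

lemma sqint_mult_integrable:
  assumes "sqint M f" "sqint M g"
  shows "integrable M (\<lambda>x. f x * g x)"
proof (rule Bochner_Integration.integrable_bound)
  note [measurable] = assms[THEN sqint_measurable]
  show "integrable M (\<lambda>x. (cmod (f x))\<^sup>2 + (cmod (g x))\<^sup>2)"
    using assms[THEN sqint_integrable] by simp
  have "cmod (f x) * cmod (g x) \<le> (cmod (f x))\<^sup>2 + (cmod (g x))\<^sup>2" for x
    using sum_squares_bound[of "cmod (f x)" "cmod (g x)"]
      mult_nonneg_nonneg[OF norm_ge_zero[of "f x"] norm_ge_zero[of "g x"]] by linarith
  then show "AE x in M. norm (f x * g x) \<le> norm ((cmod (f x))\<^sup>2 + (cmod (g x))\<^sup>2)"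
    by (auto simp: norm_mult)
qed (use assms in measurable)

lemma young_ineq: "t > 0 \<Longrightarrow> a * b \<le> t / 2 * a\<^sup>2 + 1 / (2 * t) * b\<^sup>2" for a b t :: real
  using zero_le_power2[of "t * a - b"] by (simp add: field_simps power2_eq_square)

text \<open>The Cauchy-Schwarz inequality in additive form: a free weight \<open>t\<close> is more convenient than square
  roots when one of the two terms is absorbed later on.\<close>

lemma young_integral:
  assumes "sqint M f" "sqint M g" "t > 0"
  shows "cmod (\<integral>x. f x * g x \<partial>M) \<le> t / 2 * (\<integral>x. (cmod (f x))\<^sup>2 \<partial>M) + 1 / (2 * t) * (\<integral>x. (cmod (g x))\<^sup>2 \<partial>M)"
proof -
  note i = assms(1,2)[THEN sqint_integrable]
  have "cmod (\<integral>x. f x * g x \<partial>M) \<le> (\<integral>x. cmod (f x * g x) \<partial>M)"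
    by (rule Bochner_Integration.integral_norm_bound)
  also have "\<dots> \<le> (\<integral>x. t / 2 * (cmod (f x))\<^sup>2 + 1 / (2 * t) * (cmod (g x))\<^sup>2 \<partial>M)"
  proof (rule integral_mono)
    show "integrable M (\<lambda>x. cmod (f x * g x))"
      by (rule integrable_norm[OF sqint_mult_integrable[OF assms(1,2)]])
    show "integrable M (\<lambda>x. t / 2 * (cmod (f x))\<^sup>2 + 1 / (2 * t) * (cmod (g x))\<^sup>2)"
      using i by simp
    show "cmod (f x * g x) \<le> t / 2 * (cmod (f x))\<^sup>2 + 1 / (2 * t) * (cmod (g x))\<^sup>2" for x
      unfolding norm_mult by (rule young_ineq[OF assms(3)])
  qed
  also have "\<dots> = t / 2 * (\<integral>x. (cmod (f x))\<^sup>2 \<partial>M) + 1 / (2 * t) * (\<integral>x. (cmod (g x))\<^sup>2 \<partial>M)"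
    using i by simp
  finally show ?thesis .
qed

lemma indicator_sqint:
  assumes "A \<in> sets M" "emeasure M A < \<infinity>"
  shows "sqint M (indicator A :: _ \<Rightarrow> complex)"
proof -
  have "(\<lambda>x. (cmod (indicator A x))\<^sup>2) = (indicator A :: _ \<Rightarrow> real)"
    by (auto simp: indicator_def)
  then show ?thesis using assms by (simp add: sqint_def)
qed

lemma bounded_box_sqint:
  assumes [measurable]: "f \<in> borel_measurable (Leb N)"
    and b: "\<forall>x\<in>Rspace N. cmod (f x) \<le> B" and z: "\<forall>x\<in>Rspace N - obox N lo hi. f x = 0"
  shows "sqint (Leb N) f" and "integrable (Leb N) f"
proof -
  have i: "sqint (Leb N) (indicator (obox N lo hi))"
    by (intro indicator_sqint sets_obox emeasure_obox_finite)
  show s: "sqint (Leb N) f"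
  proof (rule sqint_bound[OF i])
    show "AE x in Leb N. cmod (f x) \<le> B * cmod (indicator (obox N lo hi) x)"
      using b z by (intro AE_I2) (auto simp: indicator_def simp del: topspace_product_topology)
  qed simp
  have "integrable (Leb N) (\<lambda>x. f x * indicator (obox N lo hi) x)"
    by (rule sqint_mult_integrable[OF s i])
  then show "integrable (Leb N) f"
    by (rule Bochner_Integration.integrable_cong[THEN iffD1, rotated -1])
      (use z in \<open>auto simp: indicator_def simp del: topspace_product_topology\<close>)
qed

lemma Cc_inf_sqint:
  assumes f: "f \<in> Cc_inf N \<Omega>"
  shows "sqint (Leb N) f" and "integrable (Leb N) f"
proof -
  obtain R where R: "\<forall>x\<in>Rspace N - cube N (\<lambda>_. 0) R. f x = 0" using Cc_inf_bounded_support[OF f] by blast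
  obtain B where B: "\<forall>x\<in>Rspace N. cmod (f x) \<le> B" using Cc_inf_bounded[OF f] by blast
  show "sqint (Leb N) f" "integrable (Leb N) f"
    using bounded_box_sqint[OF Cc_inf_measurable[OF f] B R] by auto
qed

text \<open>The closure of the test functions in the square mean.\<close>

definition approx :: "nat \<Rightarrow> (pt \<Rightarrow> complex) \<Rightarrow> bool" where
  "approx N w \<longleftrightarrow> sqint (Leb N) w \<and>
     (\<forall>e>0. \<exists>f\<in>Cc_inf N (Rspace N). (\<integral>x. (cmod (w x - f x))\<^sup>2 \<partial>Leb N) < e)"

lemma approx_limit:
  assumes w: "sqint (Leb N) w"
    and lim: "\<And>e. e > 0 \<Longrightarrow> \<exists>v. approx N v \<and> (\<integral>x. (cmod (w x - v x))\<^sup>2 \<partial>Leb N) < e"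
  shows "approx N w"
  unfolding approx_def
proof (intro conjI w allI impI)
  fix e :: real assume e: "e > 0"
  obtain v where v: "approx N v" "(\<integral>x. (cmod (w x - v x))\<^sup>2 \<partial>Leb N) < e / 4"
    using lim[of "e / 4"] e by auto
  obtain f where f: "f \<in> Cc_inf N (Rspace N)" "(\<integral>x. (cmod (v x - f x))\<^sup>2 \<partial>Leb N) < e / 4"
    using v(1) e unfolding approx_def by (meson divide_pos_pos zero_less_numeral)
  have vs: "sqint (Leb N) v" using v(1) by (simp add: approx_def)
  have "(\<integral>x. (cmod (w x - f x))\<^sup>2 \<partial>Leb N) = (\<integral>x. (cmod ((w x - v x) + (v x - f x)))\<^sup>2 \<partial>Leb N)"
    by simp
  also have "\<dots> \<le> 2 * (\<integral>x. (cmod (w x - v x))\<^sup>2 \<partial>Leb N) + 2 * (\<integral>x. (cmod (v x - f x))\<^sup>2 \<partial>Leb N)"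
    by (intro sqint_add sqint_diff w vs Cc_inf_sqint(1)[OF f(1)])
  also have "\<dots> < e" using v(2) f(2) by simp
  finally show "\<exists>f\<in>Cc_inf N (Rspace N). (\<integral>x. (cmod (w x - f x))\<^sup>2 \<partial>Leb N) < e" using f(1) by blast
qed

lemma approx_sequence:
  assumes w: "sqint (Leb N) w" and v: "\<And>n. approx N (v n)"
    and lim: "AE x in Leb N. (\<lambda>n. v n x) \<longlonglongrightarrow> w x"
    and dom: "integrable (Leb N) h" "\<And>n. AE x in Leb N. (cmod (w x - v n x))\<^sup>2 \<le> h x"
  shows "approx N w"
proof (rule approx_limit[OF w])
  fix e :: real assume e: "e > 0"
  have vs: "sqint (Leb N) (v n)" for n using v by (simp add: approx_def)
  note [measurable] = sqint_measurable[OF w] sqint_measurable[OF vs]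
  have "(\<lambda>n. \<integral>x. (cmod (w x - v n x))\<^sup>2 \<partial>Leb N) \<longlonglongrightarrow> (\<integral>x. 0 \<partial>Leb N)"
  proof (rule integral_dominated_convergence[OF _ _ dom(1)])
    show "AE x in Leb N. (\<lambda>n. (cmod (w x - v n x))\<^sup>2) \<longlonglongrightarrow> 0"
      using lim
    proof eventually_elim
      case (elim x)
      then have "(\<lambda>n. (cmod (w x - v n x))\<^sup>2) \<longlonglongrightarrow> (cmod (w x - w x))\<^sup>2"
        by (intro tendsto_intros)
      then show ?case by simp
    qed
    show "AE x in Leb N. norm ((cmod (w x - v n x))\<^sup>2) \<le> h x" for n
      using dom(2)[of n] by simp
  qed measurable
  then have "eventually (\<lambda>n. (\<integral>x. (cmod (w x - v n x))\<^sup>2 \<partial>Leb N) < e) sequentially"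
    using e by (intro order_tendstoD(2)) auto
  then obtain n where "(\<integral>x. (cmod (w x - v n x))\<^sup>2 \<partial>Leb N) < e"
    by (auto simp: eventually_sequentially)
  then show "\<exists>v. approx N v \<and> (\<integral>x. (cmod (w x - v x))\<^sup>2 \<partial>Leb N) < e" using v by blast
qed

lemma approx_diff:
  assumes "approx N v" "approx N w"
  shows "approx N (\<lambda>x. v x - w x)"
  unfolding approx_def
proof (intro conjI allI impI)
  have s: "sqint (Leb N) v" "sqint (Leb N) w" using assms by (auto simp: approx_def)
  show "sqint (Leb N) (\<lambda>x. v x - w x)" using sqint_diff[OF s] by simp
  fix e :: real assume e: "e > 0"
  obtain f where f: "f \<in> Cc_inf N (Rspace N)" "(\<integral>x. (cmod (v x - f x))\<^sup>2 \<partial>Leb N) < e / 4"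
    using assms(1) e unfolding approx_def by (meson divide_pos_pos zero_less_numeral)
  obtain g where g: "g \<in> Cc_inf N (Rspace N)" "(\<integral>x. (cmod (w x - g x))\<^sup>2 \<partial>Leb N) < e / 4"
    using assms(2) e unfolding approx_def by (meson divide_pos_pos zero_less_numeral)
  have "(\<integral>x. (cmod (v x - w x - (f x - g x)))\<^sup>2 \<partial>Leb N) = (\<integral>x. (cmod ((v x - f x) - (w x - g x)))\<^sup>2 \<partial>Leb N)"
    by (simp add: algebra_simps)
  also have "\<dots> \<le> 2 * (\<integral>x. (cmod (v x - f x))\<^sup>2 \<partial>Leb N) + 2 * (\<integral>x. (cmod (w x - g x))\<^sup>2 \<partial>Leb N)"
    by (intro sqint_diff s Cc_inf_sqint(1)[OF f(1)] Cc_inf_sqint(1)[OF g(1)])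
  also have "\<dots> < e" using f(2) g(2) by simp
  finally show "\<exists>f\<in>Cc_inf N (Rspace N). (\<integral>x. (cmod (v x - w x - f x))\<^sup>2 \<partial>Leb N) < e"
    using Cc_inf_diff[OF f(1) g(1)] by (intro bexI[of _ "\<lambda>x. f x - g x"])
qed

lemma approx_cmult:
  assumes "approx N w"
  shows "approx N (\<lambda>x. c * w x)"
  unfolding approx_def
proof (intro conjI allI impI)
  have s: "sqint (Leb N) w" using assms by (auto simp: approx_def)
  show "sqint (Leb N) (\<lambda>x. c * w x)" using sqint_cmult[OF s] .
  fix e :: real assume e: "e > 0"
  define k where "k = (cmod c)\<^sup>2 + 1"
  have k: "k > 0" unfolding k_def by (simp add: add_nonneg_pos)
  obtain f where f: "f \<in> Cc_inf N (Rspace N)" "(\<integral>x. (cmod (w x - f x))\<^sup>2 \<partial>Leb N) < e / k"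
    using assms e k unfolding approx_def by (meson divide_pos_pos)
  have "(\<integral>x. (cmod (c * w x - c * f x))\<^sup>2 \<partial>Leb N) = (cmod c)\<^sup>2 * (\<integral>x. (cmod (w x - f x))\<^sup>2 \<partial>Leb N)"
    by (simp add: norm_mult power_mult_distrib flip: right_diff_distrib)
  also have "\<dots> \<le> k * (\<integral>x. (cmod (w x - f x))\<^sup>2 \<partial>Leb N)"
    by (intro mult_right_mono) (auto simp: k_def)
  also have "\<dots> < e" using f(2) k by (simp add: field_simps)
  finally show "\<exists>f\<in>Cc_inf N (Rspace N). (\<integral>x. (cmod (c * w x - f x))\<^sup>2 \<partial>Leb N) < e"
    using Cc_inf_mult[OF smooth_const f(1)] by (intro bexI[of _ "\<lambda>x. c * f x"])
qed

lemma approx_add: "approx N v \<Longrightarrow> approx N w \<Longrightarrow> approx N (\<lambda>x. v x + w x)"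
  using approx_diff[of N v "\<lambda>x. (-1) * w x"] approx_cmult[of N w "-1"] by simp

lemma approx_zero: "approx N (\<lambda>x. 0)"
  unfolding approx_def by (auto simp: sqint_def intro!: bexI[OF _ zero_Cc_inf])

lemma approx_sum:
  "finite J \<Longrightarrow> (\<And>j. j \<in> J \<Longrightarrow> approx N (w j)) \<Longrightarrow> approx N (\<lambda>x. \<Sum>j\<in>J. w j x)"
proof (induction J rule: finite_induct)
  case (insert j J)
  then show ?case using approx_add[of N "w j" "\<lambda>x. \<Sum>j\<in>J. w j x"] by simp
qed (simp add: approx_zero)

lemma approx_cong:
  assumes "approx N v" "\<And>x. x \<in> Rspace N \<Longrightarrow> v x = w x"
  shows "approx N w"
proof -
  have "sqint (Leb N) v \<longleftrightarrow> sqint (Leb N) w"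
    unfolding sqint_def using assms(2)
    by (intro conj_cong measurable_cong Bochner_Integration.integrable_cong refl) simp_all
  moreover have "(\<integral>x. (cmod (v x - f x))\<^sup>2 \<partial>Leb N) = (\<integral>x. (cmod (w x - f x))\<^sup>2 \<partial>Leb N)" for f
    using assms(2) by (intro Bochner_Integration.integral_cong refl) simp
  ultimately show ?thesis using assms(1) by (simp add: approx_def)
qed

text \<open>Cutoffs supported in the box, with ever thinner layers, converge pointwise to its indicator.\<close>

lemma approx_indicator_obox: "approx N (indicator (obox N a b))"
proof -
  obtain C where C: "bump_constant C" using ex_bump_constant by blast
  define d where "d n = 1 / real (Suc n)" for n
  have d: "d n > 0" for n by (simp add: d_def)
  have dlim: "d \<longlonglongrightarrow> 0" unfolding d_def by (rule LIMSEQ_Suc[OF lim_1_over_n])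
  have "\<exists>\<eta>. rsmooth N \<eta> \<and> (\<forall>x\<in>Rspace N. 0 \<le> \<eta> x \<and> \<eta> x \<le> 1) \<and>
       (\<forall>x\<in>Rspace N. (\<forall>i<N. a i + d n \<le> x i \<and> x i \<le> b i - d n) \<longrightarrow> \<eta> x = 1) \<and>
       (\<forall>x\<in>Rspace N - obox N a b. \<eta> x = 0)" for n
    using bump_constantD[OF C d[of n], of N "\<lambda>i. a i + d n" "\<lambda>i. b i - d n"] by fastforce
  then obtain \<eta> where \<eta>: "\<forall>n. rsmooth N (\<eta> n)" "\<forall>n. \<forall>x\<in>Rspace N. 0 \<le> \<eta> n x \<and> \<eta> n x \<le> 1"
    "\<forall>n. \<forall>x\<in>Rspace N. (\<forall>i<N. a i + d n \<le> x i \<and> x i \<le> b i - d n) \<longrightarrow> \<eta> n x = 1"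
    "\<forall>n. \<forall>x\<in>Rspace N - obox N a b. \<eta> n x = 0"
    by metis
  \<comment> \<open>The sides of the box may be reversed, in which case it is empty; R bounds it in any case.\<close>
  define R where "R = (\<Sum>i<N. \<bar>a i\<bar>) + (\<Sum>i<N. \<bar>b i\<bar>)"
  have R: "obox N a b \<subseteq> cube N (\<lambda>_. 0) R"
  proof
    fix x assume x: "x \<in> obox N a b"
    have "\<bar>x i - 0\<bar> < R" if "i < N" for i
      using x that member_le_sum[of i "{..<N}" "\<lambda>i. \<bar>a i\<bar>"] member_le_sum[of i "{..<N}" "\<lambda>i. \<bar>b i\<bar>"]
      unfolding R_def mem_obox by fastforce
    then show "x \<in> cube N (\<lambda>_. 0) R" using x unfolding mem_cube mem_obox by blast
  qed
  let ?v = "\<lambda>n x. complex_of_real (\<eta> n x)"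
  have Cc: "?v n \<in> Cc_inf N (Rspace N)" for n
  proof (rule Cc_inf_Rspace)
    show "smooth N (?v n)" using \<eta>(1) unfolding rsmooth_def by blast
    show "\<forall>x\<in>Rspace N - cube N (\<lambda>_. 0) R. ?v n x = 0" using \<eta>(4) R by auto
  qed
  show ?thesis
  proof (rule approx_sequence[where v = ?v and h = "indicator (obox N a b)"])
    show "sqint (Leb N) (indicator (obox N a b))"
      by (intro indicator_sqint sets_obox emeasure_obox_finite)
    show "integrable (Leb N) (indicator (obox N a b) :: _ \<Rightarrow> real)"
      using emeasure_obox_finite[of N a b] by simp
    show "approx N (?v n)" for n
      unfolding approx_def using Cc[of n] Cc_inf_sqint(1)[OF Cc] by (auto intro!: bexI[of _ "?v n"])
    show "AE x in Leb N. (cmod (indicator (obox N a b) x - ?v n x))\<^sup>2 \<le> indicator (obox N a b) x" for n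
    proof (rule AE_I2)
      fix x assume x: "x \<in> space (Leb N)"
      show "(cmod (indicator (obox N a b) x - ?v n x))\<^sup>2 \<le> indicator (obox N a b) x"
      proof (cases "x \<in> obox N a b")
        case True
        have "cmod (1 - ?v n x) = 1 - \<eta> n x"
          using \<eta>(2) x unfolding space_Leb by (metis abs_of_nonneg diff_ge_0_iff_ge norm_of_real of_real_1 of_real_diff)
        moreover have "0 \<le> \<eta> n x" "\<eta> n x \<le> 1" using \<eta>(2) x unfolding space_Leb by blast+
        ultimately show ?thesis using True by (simp add: power_le_one)
      next
        case False
        then have "\<eta> n x = 0" using \<eta>(4) x unfolding space_Leb by blast
        then show ?thesis using False by simp
      qed
    qed
    show "AE x in Leb N. (\<lambda>n. ?v n x) \<longlonglongrightarrow> indicator (obox N a b) x"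
    proof (rule AE_I2)
      fix x assume x: "x \<in> space (Leb N)"
      show "(\<lambda>n. ?v n x) \<longlonglongrightarrow> indicator (obox N a b) x"
      proof (cases "x \<in> obox N a b")
        case True
        have "eventually (\<lambda>n. \<forall>i\<in>{..<N}. a i + d n \<le> x i \<and> x i \<le> b i - d n) sequentially"
        proof (intro eventually_ball_finite ballI)
          fix i assume "i \<in> {..<N}"
          then have "a i < x i" "x i < b i" using True unfolding mem_obox by auto
          then have "eventually (\<lambda>n. d n < x i - a i) sequentially" "eventually (\<lambda>n. d n < b i - x i) sequentially"
            by (auto intro!: order_tendstoD(2)[OF dlim])
          then show "eventually (\<lambda>n. a i + d n \<le> x i \<and> x i \<le> b i - d n) sequentially"
            by eventually_elim auto
        qed simp
        then have "eventually (\<lambda>n. ?v n x = 1) sequentially"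
          by eventually_elim (use \<eta>(3) x in \<open>auto simp del: topspace_product_topology\<close>)
        then show ?thesis using True by (simp add: tendsto_eventually)
      next
        case False
        then have "\<eta> n x = 0" for n using \<eta>(4) x unfolding space_Leb by blast
        then show ?thesis using False by simp
      qed
    qed
  qed
qed

text \<open>Open sets are countable unions of boxes, and the measurable cylinders of the product sigma
  algebra are generated by open cylinders.\<close>

lemma sets_Leb_eq: "sets (Leb N) = sigma_sets (Rspace N) (range (\<lambda>(a, b). obox N a b))"
proof
  let ?S = "sigma_sets (Rspace N) (range (\<lambda>(a, b). obox N a b))"
  have pow: "range (\<lambda>(a, b). obox N a b) \<subseteq> Pow (Rspace N)" using obox_subset by blast
  have op: "S \<in> ?S" if S: "openin (Rtop N) S" for S
  proof -
    obtain B where B: "countable B" and S_eq: "S = (\<Union>p\<in>B. obox N (fst p) (snd p))"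
      using openin_Union_rat_boxes[OF S] by blast
    show ?thesis unfolding S_eq
    proof (rule sigma_sets_UNION)
      show "countable ((\<lambda>p. obox N (fst p) (snd p)) ` B)" by (intro countable_image B)
      show "A \<in> ?S" if "A \<in> (\<lambda>p. obox N (fst p) (snd p)) ` B" for A
        using that by (intro sigma_sets.Basic) auto
    qed
  qed
  let ?\<Sigma> = "sigma (Rspace N) (range (\<lambda>(a, b). obox N a b))"
  have sp: "space ?\<Sigma> = Rspace N" and st: "sets ?\<Sigma> = ?S"
    using pow by (rule space_measure_of, rule sets_measure_of)
  have vimage: "(\<lambda>x. x i) -` A \<inter> space ?\<Sigma> = {x \<in> Rspace N. x i \<in> A}" for i and A :: "real set"
    unfolding sp by blast
  have meas: "(\<lambda>x. x i) \<in> borel_measurable ?\<Sigma>" if "i < N" for i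
  proof (rule borel_measurableI)
    fix T :: "real set" assume "open T"
    then have "openin (Rtop N) {x \<in> Rspace N. x i \<in> T}"
      using that by (intro openin_continuous_map_preimage[OF continuous_map_product_projection]) auto
    then show "(\<lambda>x. x i) -` T \<inter> space ?\<Sigma> \<in> sets ?\<Sigma>"
      unfolding vimage st by (rule op)
  qed
  have cyl: "{f \<in> Rspace N. f i \<in> A} \<in> ?S" if "i < N" "A \<in> sets borel" for i A
    using measurable_sets[OF meas[OF that(1)] that(2)] unfolding vimage st .
  show "sets (Leb N) \<subseteq> ?S"
    unfolding sets_PiM_single space_lborel space_borel sets_lborel Rspace_PiE[symmetric]
  proof (intro sigma_sets_mono subsetI)
    fix B :: "pt set" assume "B \<in> {{f \<in> Rspace N. f i \<in> A} |i A. i \<in> {..<N} \<and> A \<in> sets borel}"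
    then obtain i A where "i < N" "A \<in> sets borel" "B = {f \<in> Rspace N. f i \<in> A}" by blast
    then show "B \<in> ?S" using cyl by blast
  qed
  show "?S \<subseteq> sets (Leb N)"
  proof -
    have "range (\<lambda>(a, b). obox N a b) \<subseteq> sets (Leb N)" using sets_obox by auto
    from sets.sigma_sets_subset[OF this] show ?thesis unfolding space_Leb .
  qed
qed

text \<open>The sets whose trace on a fixed cube has an approximable indicator form a Dynkin system, and
  the boxes are a generator of the measurable sets that is stable under intersection.  The cube keeps
  the measures finite, so that countable disjoint unions are limits in the mean.\<close>

lemma approx_indicator:
  assumes "A \<in> sets (Leb N)"
  shows "approx N (indicator (A \<inter> cube N (\<lambda>_. 0) r))"
proof -
  let ?Q = "cube N (\<lambda>_. 0) r" and ?G = "range (\<lambda>(a, b). obox N a b)"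
  have int: "obox N a b \<inter> obox N c d = obox N (\<lambda>i. max (a i) (c i)) (\<lambda>i. min (b i) (d i))" for a b c d
    unfolding set_eq_iff Int_iff mem_obox max_less_iff_conj min_less_iff_conj by blast
  have "Int_stable ?G"
  proof (rule Int_stableI)
    fix A B assume "A \<in> ?G" "B \<in> ?G"
    then obtain a b c d where "A = obox N a b" "B = obox N c d" by auto
    then have "A \<inter> B = (\<lambda>(a, b). obox N a b) (\<lambda>i. max (a i) (c i), \<lambda>i. min (b i) (d i))"
      using int by simp
    then show "A \<inter> B \<in> ?G" by (rule image_eqI) (rule UNIV_I)
  qed
  moreover have "?G \<subseteq> Pow (Rspace N)" using obox_subset by blast
  moreover have "A \<in> sigma_sets (Rspace N) ?G" using assms unfolding sets_Leb_eq .
  ultimately show ?thesis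
  proof (induction rule: sigma_sets_induct_disjoint)
    case (basic A)
    then obtain a b where "A = obox N a b" by auto
    then show ?case by (simp only: int approx_indicator_obox)
  next
    case empty
    have "indicator ({} \<inter> ?Q) = (\<lambda>x. 0 :: complex)" by auto
    then show ?case using approx_zero by simp
  next
    case (compl A)
    have "approx N (\<lambda>x. indicator ?Q x - indicator (A \<inter> ?Q) x)"
      by (intro approx_diff compl.IH approx_indicator_obox)
    then show ?case
      by (rule approx_cong) (use obox_subset in \<open>auto simp: indicator_def simp del: topspace_product_topology\<close>)
  next
    case (union A)
    have Am: "A n \<in> sets (Leb N)" for n using union.hyps(2) unfolding sets_Leb_eq by blast
    let ?v = "\<lambda>n x. \<Sum>k<n. indicator (A k \<inter> ?Q) x :: complex"
    have v: "?v n x = indicator ((\<Union>k<n. A k) \<inter> ?Q) x" for n x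
    proof (induction n)
      case (Suc n)
      have "A k \<inter> A n = {}" if "k < n" for k
        using union.hyps(1) that unfolding disjoint_family_on_def by (metis UNIV_I less_irrefl)
      then have disj: "(\<Union>k<n. A k) \<inter> A n = {}" by blast
      have "?v (Suc n) x = indicator ((\<Union>k<n. A k) \<inter> ?Q) x + indicator (A n \<inter> ?Q) x"
        using Suc by simp
      also have "\<dots> = indicator ((\<Union>k<Suc n. A k) \<inter> ?Q) x"
        unfolding lessThan_Suc UN_insert using disj by (auto split: split_indicator)
      finally show ?case .
    qed simp
    show ?case
    proof (rule approx_sequence[where v = ?v and h = "indicator ?Q"])
      show "sqint (Leb N) (indicator ((\<Union> (range A)) \<inter> ?Q))"
      proof (rule indicator_sqint)
        show "\<Union> (range A) \<inter> ?Q \<in> sets (Leb N)" using Am by auto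
        have "emeasure (Leb N) (\<Union> (range A) \<inter> ?Q) \<le> emeasure (Leb N) ?Q"
          by (intro emeasure_mono) auto
        then show "emeasure (Leb N) (\<Union> (range A) \<inter> ?Q) < \<infinity>"
          using emeasure_obox_finite le_less_trans by blast
      qed
      show "approx N (?v n)" for n by (intro approx_sum union.IH) auto
      show "integrable (Leb N) (indicator ?Q :: _ \<Rightarrow> real)" using emeasure_obox_finite[of N] by simp
      show "AE x in Leb N. (cmod (indicator (\<Union> (range A) \<inter> ?Q) x - ?v n x))\<^sup>2 \<le> indicator ?Q x" for n
        unfolding v by (auto simp: indicator_def)
      show "AE x in Leb N. (\<lambda>n. ?v n x) \<longlonglongrightarrow> indicator (\<Union> (range A) \<inter> ?Q) x"
      proof (rule AE_I2)
        fix x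
        show "(\<lambda>n. ?v n x) \<longlonglongrightarrow> indicator (\<Union> (range A) \<inter> ?Q) x"
        proof (cases "x \<in> \<Union> (range A) \<inter> ?Q")
          case True
          then obtain k where k: "x \<in> A k" "x \<in> ?Q" by blast
          have "eventually (\<lambda>n. ?v n x = 1) sequentially"
            using eventually_gt_at_top[of k] by eventually_elim (unfold v, use k in \<open>auto simp: indicator_def\<close>)
          then show ?thesis using True by (simp add: tendsto_eventually)
        next
          case False
          then have "?v n x = 0" for n unfolding v by (auto simp: indicator_def)
          then show ?thesis using False by simp
        qed
      qed
    qed
  qed
qed

text \<open>Simple functions, cut off to large cubes, are linear combinations of indicators of bounded
  measurable sets and converge to \<open>w\<close> under the majorant \<open>9 |w|\<^sup>2\<close>.\<close>

theorem Cc_inf_dense: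
  assumes w: "sqint (Leb N) w" and e: "e > 0"
  shows "\<exists>f\<in>Cc_inf N (Rspace N). (\<integral>x. (cmod (w x - f x))\<^sup>2 \<partial>Leb N) < e"
proof -
  note [measurable] = sqint_measurable[OF w]
  obtain F where F: "\<forall>n. simple_function (Leb N) (F n)"
    "\<forall>x\<in>space (Leb N). (\<lambda>n. F n x) \<longlonglongrightarrow> w x" "\<forall>n. \<forall>x\<in>space (Leb N). dist (F n x) 0 \<le> 2 * dist (w x) 0"
    using borel_measurable_implies_sequence_metric[of w "Leb N" 0] by auto
  let ?Q = "\<lambda>n. cube N (\<lambda>_. 0) (real n)"
  let ?v = "\<lambda>n x. F n x * indicator (?Q n) x"
  have "approx N w"
  proof (rule approx_sequence[where v = ?v and h = "\<lambda>x. 9 * (cmod (w x))\<^sup>2"])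
    show "integrable (Leb N) (\<lambda>x. 9 * (cmod (w x))\<^sup>2)" using sqint_integrable[OF w] by simp
    show "approx N (?v n)" for n
    proof -
      let ?A = "\<lambda>c. F n -` {c} \<inter> space (Leb N)"
      have fin: "finite (F n ` space (Leb N))" using F(1) by (simp add: simple_function_def)
      have "approx N (\<lambda>x. \<Sum>c\<in>F n ` space (Leb N). c * indicator (?A c \<inter> ?Q n) x)"
        using F(1) by (intro approx_sum fin approx_cmult approx_indicator simple_functionD(2)) auto
      then show ?thesis
      proof (rule approx_cong)
        fix x assume x: "x \<in> Rspace N"
        have "(\<Sum>c\<in>F n ` space (Leb N). c * indicator (?A c \<inter> ?Q n) x) =
            (\<Sum>c\<in>F n ` space (Leb N). if c = F n x then F n x * indicator (?Q n) x else 0)"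
          using x by (intro sum.cong refl) (auto simp: indicator_def simp del: topspace_product_topology)
        also have "\<dots> = F n x * indicator (?Q n) x" using fin x by (subst sum.delta) auto
        finally show "(\<Sum>c\<in>F n ` space (Leb N). c * indicator (?A c \<inter> ?Q n) x) = F n x * indicator (?Q n) x" .
      qed
    qed
    show "AE x in Leb N. (cmod (w x - ?v n x))\<^sup>2 \<le> 9 * (cmod (w x))\<^sup>2" for n
    proof (rule AE_I2)
      fix x assume x: "x \<in> space (Leb N)"
      have "cmod (w x - ?v n x) \<le> cmod (w x) + cmod (?v n x)" by (rule norm_triangle_ineq4)
      also have "cmod (?v n x) \<le> 2 * cmod (w x)"
        using F(3)[rule_format, OF x, of n] by (auto simp: indicator_def norm_mult)
      finally have "(cmod (w x - ?v n x))\<^sup>2 \<le> (3 * cmod (w x))\<^sup>2" by (intro power_mono) auto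
      then show "(cmod (w x - ?v n x))\<^sup>2 \<le> 9 * (cmod (w x))\<^sup>2" by (simp add: power_mult_distrib)
    qed
    show "AE x in Leb N. (\<lambda>n. ?v n x) \<longlonglongrightarrow> w x"
    proof (rule AE_I2)
      fix x assume x: "x \<in> space (Leb N)"
      obtain m :: nat where m: "(\<Sum>i<N. \<bar>x i\<bar>) < real m" using reals_Archimedean2 by blast
      have mem: "x \<in> ?Q n" if "n \<ge> m" for n
      proof -
        have "\<bar>x i - 0\<bar> < real n" if "i < N" for i
          using member_le_sum[of i "{..<N}" "\<lambda>i. \<bar>x i\<bar>"] m that \<open>n \<ge> m\<close> by auto
        then show ?thesis using x unfolding mem_cube space_Leb by blast
      qed
      have "eventually (\<lambda>n. F n x = ?v n x) sequentially"
        using eventually_ge_at_top[of m] by eventually_elim (simp only: mem indicator_simps mult_1_right)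
      then show "(\<lambda>n. ?v n x) \<longlonglongrightarrow> w x"
        using F(2)[rule_format, OF x] by (rule Lim_transform_eventually[rotated])
    qed
  qed (rule w)
  then show ?thesis using e unfolding approx_def by blast
qed

section \<open>Pairings with translated test functions\<close>

definition single :: "nat \<Rightarrow> real \<Rightarrow> pt" where
  "single i s = (\<lambda>j. if j = i then s else 0)"

lemma shift_single: "x \<in> Rspace N \<Longrightarrow> i < N \<Longrightarrow> shift N (single i s) x = x(i := x i + s)"
  by (auto simp: shift_def single_def PiE_iff extensional_def)

lemma shift_shift: "shift N y (shift N z x) = shift N (\<lambda>j. y j + z j) x"
  by (auto simp: shift_def)

lemma shift_zero: "x \<in> Rspace N \<Longrightarrow> shift N (\<lambda>_. 0) x = x"
  by (auto simp: shift_def PiE_iff extensional_def)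

text \<open>The difference quotient is the form of the derivative that dominated convergence needs.\<close>

lemma has_vector_derivative_iff_quotient:
  fixes F :: "real \<Rightarrow> 'a::real_normed_vector"
  shows "(F has_vector_derivative D) (at x) \<longleftrightarrow> ((\<lambda>h. (F (x + h) - F x) /\<^sub>R h) \<longlongrightarrow> D) (at 0)"
proof -
  have "norm (F (x + h) - F x - h *\<^sub>R D) / norm h = norm ((F (x + h) - F x) /\<^sub>R h - D)" if h: "h \<noteq> 0" for h
  proof -
    have "(F (x + h) - F x) /\<^sub>R h - D = (F (x + h) - F x - h *\<^sub>R D) /\<^sub>R h"
      using h by (simp add: scaleR_diff_right)
    then show ?thesis by (simp only: norm_scaleR abs_inverse real_norm_def divide_inverse mult.commute)
  qed
  then have "eventually (\<lambda>h. norm (F (x + h) - F x - h *\<^sub>R D) / norm h = norm ((F (x + h) - F x) /\<^sub>R h - D)) (at 0)"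
    unfolding eventually_at_filter by (intro always_eventually allI impI)
  from tendsto_cong[OF this] show ?thesis
    unfolding has_vector_derivative_def has_derivative_at
    by (simp only: bounded_linear_scaleR_left simp_thms tendsto_norm_zero_iff LIM_zero_iff)
qed

lemma smooth_increment_bound:
  assumes f: "smooth N f" and B: "\<forall>x\<in>Rspace N. cmod (pderiv_at i f x) \<le> B" and x: "x \<in> Rspace N" and i: "i < N"
  shows "cmod (f (x(i := x i + s)) - f x) \<le> B * \<bar>s\<bar>"
proof -
  have "cmod (f (x(i := x i + s)) - f (x(i := x i))) \<le> B * norm ((x i + s) - x i)"
  proof (rule differentiable_bound[of UNIV "\<lambda>t. f (x(i := t))" "\<lambda>t h. h *\<^sub>R pderiv_at i f (x(i := t))" B])
    show "((\<lambda>t. f (x(i := t))) has_derivative (\<lambda>h. h *\<^sub>R pderiv_at i f (x(i := t)))) (at t within UNIV)" for t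
      using smooth_has_pderiv'[OF f x i] unfolding has_vector_derivative_def .
    show "onorm (\<lambda>h. h *\<^sub>R pderiv_at i f (x(i := t))) \<le> B" for t
    proof (rule onorm_le)
      fix h :: real
      have "cmod (pderiv_at i f (x(i := t))) \<le> B" using B upd_Rspace[OF x i] by blast
      from mult_left_mono[OF this abs_ge_zero[of h]]
      show "norm (h *\<^sub>R pderiv_at i f (x(i := t))) \<le> B * norm h"
        by (simp add: mult.commute)
    qed
  qed auto
  then show ?thesis by simp
qed

text \<open>Dominated convergence of the difference quotients, with the majorant \<open>B |w|\<close>, where \<open>B\<close> bounds
  the partial derivative of \<open>f\<close>.\<close>

lemma pairing_shift_derivative_0:
  assumes w: "integrable (Leb N) w" and f: "f \<in> Cc_inf N (Rspace N)" and i: "i < N"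
  shows "((\<lambda>s. \<integral>x. w x * f (shift N (single i s) x) \<partial>Leb N) has_vector_derivative
    (\<integral>x. w x * pderiv_at i f x \<partial>Leb N)) (at 0)"
proof -
  note sm = Cc_inf_smooth[OF f]
  have [measurable]: "w \<in> borel_measurable (Leb N)" using w by simp
  note [measurable] = Cc_inf_measurable[OF f] Cc_inf_measurable[OF Cc_inf_pderiv[OF f i]]
  have wf: "integrable (Leb N) (\<lambda>x. w x * g x)" if g: "g \<in> Cc_inf N (Rspace N)" for g
  proof -
    note [measurable] = Cc_inf_measurable[OF g]
    obtain B where B: "\<forall>x\<in>Rspace N. cmod (g x) \<le> B" using Cc_inf_bounded[OF g] by blast
    show ?thesis
    proof (rule Bochner_Integration.integrable_bound)
      show "integrable (Leb N) (\<lambda>x. B * cmod (w x))" using w by simp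
      show "AE x in Leb N. norm (w x * g x) \<le> norm (B * cmod (w x))"
      proof (rule AE_I2)
        fix x assume "x \<in> space (Leb N)"
        then have "cmod (g x) \<le> \<bar>B\<bar>" using B unfolding space_Leb by fastforce
        then show "norm (w x * g x) \<le> norm (B * cmod (w x))"
          by (simp add: norm_mult abs_mult mult.commute mult_right_mono)
      qed
    qed measurable
  qed
  obtain B where B: "B > 0" "\<forall>x\<in>Rspace N. cmod (pderiv_at i f x) \<le> B"
    using Cc_inf_bounded[OF Cc_inf_pderiv[OF f i]] by blast
  let ?\<Phi> = "\<lambda>s. \<integral>x. w x * f (shift N (single i s) x) \<partial>Leb N"
  have "((\<lambda>h. (?\<Phi> h - ?\<Phi> 0) /\<^sub>R h) \<longlongrightarrow> (\<integral>x. w x * pderiv_at i f x \<partial>Leb N)) (at 0)"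
    unfolding tendsto_at_iff_sequentially
  proof (intro allI impI)
    fix X :: "nat \<Rightarrow> real" assume X: "\<forall>n. X n \<in> UNIV - {0}" "X \<longlonglongrightarrow> 0"
    let ?q = "\<lambda>n x. (f (shift N (single i (X n)) x) - f (shift N (single i 0) x)) /\<^sub>R X n"
    have eq: "(?\<Phi> (X n) - ?\<Phi> 0) /\<^sub>R X n = (\<integral>x. w x * ?q n x \<partial>Leb N)" for n
    proof -
      have "?\<Phi> (X n) - ?\<Phi> 0 =
        (\<integral>x. w x * f (shift N (single i (X n)) x) - w x * f (shift N (single i 0) x) \<partial>Leb N)"
        by (intro Bochner_Integration.integral_diff[symmetric] wf Cc_inf_shift f)
      then show ?thesis
        by (simp flip: integral_scaleR_right add: right_diff_distrib)
    qed
    have "(\<lambda>n. \<integral>x. w x * ?q n x \<partial>Leb N) \<longlonglongrightarrow> (\<integral>x. w x * pderiv_at i f x \<partial>Leb N)"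
    proof (rule integral_dominated_convergence[where w = "\<lambda>x. B * cmod (w x)"])
      show "integrable (Leb N) (\<lambda>x. B * cmod (w x))" using w by simp
      show "AE x in Leb N. (\<lambda>n. w x * ?q n x) \<longlonglongrightarrow> w x * pderiv_at i f x"
      proof (rule AE_I2)
        fix x assume "x \<in> space (Leb N)"
        then have x: "x \<in> Rspace N" unfolding space_Leb .
        have "((\<lambda>h. (f (x(i := x i + h)) - f (x(i := x i))) /\<^sub>R h) \<longlongrightarrow> pderiv_at i f x) (at 0)"
          using smooth_has_pderiv[OF sm x i] unfolding has_vector_derivative_iff_quotient .
        then have "((\<lambda>h. (f (x(i := x i + h)) - f (x(i := x i))) /\<^sub>R h) \<circ> X) \<longlonglongrightarrow> pderiv_at i f x"
          unfolding tendsto_at_iff_sequentially using X by blast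
        then have "(\<lambda>n. ?q n x) \<longlonglongrightarrow> pderiv_at i f x"
          by (simp only: o_def shift_single[OF x i] add_0_right)
        then show "(\<lambda>n. w x * ?q n x) \<longlonglongrightarrow> w x * pderiv_at i f x"
          by (intro tendsto_intros)
      qed
      show "AE x in Leb N. norm (w x * ?q n x) \<le> B * cmod (w x)" for n
      proof (rule AE_I2)
        fix x assume "x \<in> space (Leb N)"
        then have x: "x \<in> Rspace N" unfolding space_Leb .
        have X0: "X n \<noteq> 0" using X(1) by blast
        have "norm (?q n x) = cmod (f (x(i := x i + X n)) - f x) / \<bar>X n\<bar>"
          by (simp only: shift_single[OF x i] add_0_right fun_upd_triv norm_scaleR abs_inverse divide_inverse mult.commute)
        also have "\<dots> \<le> B"
          using smooth_increment_bound[OF sm B(2) x i, of "X n"] X0 by (simp add: divide_le_eq)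
        finally have "norm (?q n x) \<le> B" .
        from mult_left_mono[OF this norm_ge_zero[of "w x"]] show "norm (w x * ?q n x) \<le> B * cmod (w x)"
          unfolding norm_mult mult.commute[of B] .
      qed
    qed measurable
    then show "((\<lambda>h. (?\<Phi> h - ?\<Phi> 0) /\<^sub>R h) \<circ> X) \<longlonglongrightarrow> (\<integral>x. w x * pderiv_at i f x \<partial>Leb N)"
      unfolding o_def eq .
  qed
  then show ?thesis unfolding has_vector_derivative_iff_quotient add_0_left .
qed

lemma pairing_shift_derivative:
  assumes w: "integrable (Leb N) w" and f: "f \<in> Cc_inf N (Rspace N)" and i: "i < N"
  shows "((\<lambda>s. \<integral>x. w x * f (shift N (single i s) x) \<partial>Leb N) has_vector_derivative
    (\<integral>x. w x * pderiv_at i (\<lambda>x. f (shift N (single i s) x)) x \<partial>Leb N)) (at s)"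
proof -
  let ?f = "\<lambda>x. f (shift N (single i s) x)"
  let ?\<Psi> = "\<lambda>t. \<integral>x. w x * ?f (shift N (single i t) x) \<partial>Leb N"
  have 1: "((\<lambda>t. t - s) has_vector_derivative 1) (at s)"
    by (auto intro!: derivative_eq_intros)
  have 2: "(?\<Psi> has_vector_derivative (\<integral>x. w x * pderiv_at i ?f x \<partial>Leb N)) (at (s - s))"
    using pairing_shift_derivative_0[OF w Cc_inf_shift[OF f] i] by simp
  have "(\<lambda>j. single i s j + single i (t - s) j) = single i t" for t
    by (auto simp: single_def)
  then have "?\<Psi> (t - s) = (\<integral>x. w x * f (shift N (single i t) x) \<partial>Leb N)" for t
    by (simp only: shift_shift)
  with vector_diff_chain_at[OF 1 2] show ?thesis by (simp add: o_def)
qed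

text \<open>By translation invariance the integral of \<open>f\<close> does not change when \<open>f\<close> is translated, so the
  derivative of that integral along a translation is zero.  The derivative is known for pairings
  with integrable functions, hence the indicator of a large cube in place of the constant one.\<close>

lemma integral_pderiv_zero:
  assumes f: "f \<in> Cc_inf N (Rspace N)" and i: "i < N"
  shows "(\<integral>x. pderiv_at i f x \<partial>Leb N) = 0"
proof -
  obtain R1 where R1: "\<forall>x\<in>Rspace N - cube N (\<lambda>_. 0) R1. f x = 0"
    using Cc_inf_bounded_support[OF f] by blast
  obtain R2 where R2: "\<forall>x\<in>Rspace N - cube N (\<lambda>_. 0) R2. pderiv_at i f x = 0"
    using Cc_inf_bounded_support[OF Cc_inf_pderiv[OF f i]] by blast
  define R where "R = max R1 R2 + 1"
  let ?Q = "cube N (\<lambda>_. 0) R"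
  let ?w = "indicator ?Q :: pt \<Rightarrow> complex"
  have w: "integrable (Leb N) ?w"
    by (rule bounded_box_sqint(2)[where B = 1 and lo = "\<lambda>_. 0 - R" and hi = "\<lambda>_. 0 + R"])
      (auto simp: indicator_def simp del: topspace_product_topology)
  let ?\<Phi> = "\<lambda>s. \<integral>x. ?w x * f (shift N (single i s) x) \<partial>Leb N"
  have const: "?\<Phi> s = (\<integral>x. f x \<partial>Leb N)" if s: "\<bar>s\<bar> < 1" for s
  proof -
    have "?\<Phi> s = (\<integral>x. f (shift N (single i s) x) \<partial>Leb N)"
    proof (rule Bochner_Integration.integral_cong[OF refl])
      fix x assume "x \<in> space (Leb N)"
      then have x: "x \<in> Rspace N" unfolding space_Leb .
      show "?w x * f (shift N (single i s) x) = f (shift N (single i s) x)"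
      proof (cases "x \<in> ?Q")
        case False
        then obtain j where j: "j < N" "\<not> \<bar>x j - 0\<bar> < R" using x unfolding mem_cube by blast
        then have "\<not> \<bar>shift N (single i s) x j - 0\<bar> < R1"
          using s by (auto simp: shift_def single_def R_def)
        then have "shift N (single i s) x \<notin> cube N (\<lambda>_. 0) R1" using j(1) unfolding mem_cube by blast
        then have "f (shift N (single i s) x) = 0" using R1 shift_Rspace by blast
        then show ?thesis by simp
      qed simp
    qed
    then show ?thesis using integral_shift[OF Cc_inf_measurable[OF f]] by simp
  qed
  have "eventually (\<lambda>s. ?\<Phi> s = (\<integral>x. f x \<partial>Leb N)) (nhds 0)"
    unfolding eventually_nhds_metric using const by (auto simp: dist_real_def intro!: exI[of _ 1])
  then have "(?\<Phi> has_vector_derivative 0) (at 0)"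
    using has_vector_derivative_cong_ev[where S = UNIV and f = ?\<Phi> and g = "\<lambda>_. \<integral>x. f x \<partial>Leb N"
      and x = 0 and f' = 0] const[of 0] by simp
  with pairing_shift_derivative_0[OF w f i] have "(\<integral>x. ?w x * pderiv_at i f x \<partial>Leb N) = 0"
    by (rule vector_derivative_unique_at)
  moreover have "(\<integral>x. ?w x * pderiv_at i f x \<partial>Leb N) = (\<integral>x. pderiv_at i f x \<partial>Leb N)"
  proof (rule Bochner_Integration.integral_cong[OF refl])
    fix x assume "x \<in> space (Leb N)"
    then have x: "x \<in> Rspace N" unfolding space_Leb .
    have "cube N (\<lambda>_. 0) R2 \<subseteq> ?Q" unfolding R_def by (fastforce simp only: subset_iff mem_cube)
    then show "?w x * pderiv_at i f x = pderiv_at i f x"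
      using R2 x by (cases "x \<in> ?Q") auto
  qed
  ultimately show ?thesis by simp
qed

section \<open>A Nash type inequality\<close>

text \<open>The derivative in \<open>s\<close> of the pairing of \<open>w\<close> with a test function translated by \<open>s\<close> is, up to its
  sign, the pairing of the weak derivative \<open>g\<close> with the translated test function.  It is bounded
  independently of \<open>s\<close>, and the mean value theorem gives the factor \<open>s\<close>.\<close>

lemma weak_translation_single:
  assumes w: "integrable (Leb N) w" and g: "sqint (Leb N) g" and i: "i < N"
    and weak: "\<forall>f\<in>Cc_inf N (Rspace N). (\<integral>x. w x * pderiv_at i f x \<partial>Leb N) = - (\<integral>x. g x * f x \<partial>Leb N)"
    and f: "f \<in> Cc_inf N (Rspace N)" and t: "t > 0" and s: "s \<ge> 0"
  shows "cmod ((\<integral>x. w x * f (shift N (single i s) x) \<partial>Leb N) - (\<integral>x. w x * f x \<partial>Leb N)) \<le>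
    s * (t / 2 * (\<integral>x. (cmod (g x))\<^sup>2 \<partial>Leb N) + 1 / (2 * t) * (\<integral>x. (cmod (f x))\<^sup>2 \<partial>Leb N))"
proof -
  let ?\<Phi> = "\<lambda>s. \<integral>x. w x * f (shift N (single i s) x) \<partial>Leb N"
  let ?K = "t / 2 * (\<integral>x. (cmod (g x))\<^sup>2 \<partial>Leb N) + 1 / (2 * t) * (\<integral>x. (cmod (f x))\<^sup>2 \<partial>Leb N)"
  define D where "D s = (\<integral>x. w x * pderiv_at i (\<lambda>x. f (shift N (single i s) x)) x \<partial>Leb N)" for s
  have D: "cmod (D s) \<le> ?K" for s
  proof -
    let ?f = "\<lambda>x. f (shift N (single i s) x)"
    have f': "?f \<in> Cc_inf N (Rspace N)" using Cc_inf_shift[OF f] .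
    have "cmod (D s) = cmod (\<integral>x. g x * ?f x \<partial>Leb N)"
      unfolding D_def bspec[OF weak f'] norm_minus_cancel ..
    also have "\<dots> \<le> t / 2 * (\<integral>x. (cmod (g x))\<^sup>2 \<partial>Leb N) + 1 / (2 * t) * (\<integral>x. (cmod (?f x))\<^sup>2 \<partial>Leb N)"
      by (rule young_integral[OF g Cc_inf_sqint(1)[OF f'] t])
    also have "(\<integral>x. (cmod (?f x))\<^sup>2 \<partial>Leb N) = (\<integral>x. (cmod (f x))\<^sup>2 \<partial>Leb N)"
      using integral_shift[of "\<lambda>x. (cmod (f x))\<^sup>2" N "single i s"] Cc_inf_measurable[OF f] by simp
    finally show ?thesis .
  qed
  have "cmod (?\<Phi> s - ?\<Phi> 0) \<le> ?K * norm (s - 0)"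
  proof (rule differentiable_bound[of UNIV ?\<Phi> "\<lambda>u h. h *\<^sub>R D u" ?K])
    show "(?\<Phi> has_derivative (\<lambda>h. h *\<^sub>R D u)) (at u within UNIV)" for u
      using pairing_shift_derivative[OF w f i, of u] unfolding has_vector_derivative_def D_def .
    show "onorm (\<lambda>h. h *\<^sub>R D u) \<le> ?K" for u
    proof (rule onorm_le)
      fix h :: real
      show "norm (h *\<^sub>R D u) \<le> ?K * norm h"
        unfolding norm_scaleR real_norm_def using mult_right_mono[OF D[of u] abs_ge_zero[of h]]
        by (simp only: mult.commute)
    qed
  qed auto
  moreover have "?\<Phi> 0 = (\<integral>x. w x * f x \<partial>Leb N)"
  proof (rule Bochner_Integration.integral_cong[OF refl])
    fix x assume "x \<in> space (Leb N)"
    then show "w x * f (shift N (single i 0) x) = w x * f x"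
      unfolding space_Leb by (simp only: shift_single[OF _ i] add_0_right fun_upd_triv)
  qed
  ultimately show ?thesis using s by (simp add: mult.commute)
qed

text \<open>A translation is performed one coordinate at a time; the test function of each stage is the
  translate from the stage before, which has the same norm.\<close>

lemma weak_translation:
  assumes w: "integrable (Leb N) w" and g: "\<forall>i<N. sqint (Leb N) (g i)"
    and weak: "\<forall>i<N. \<forall>f\<in>Cc_inf N (Rspace N).
      (\<integral>x. w x * pderiv_at i f x \<partial>Leb N) = - (\<integral>x. g i x * f x \<partial>Leb N)"
    and f: "f \<in> Cc_inf N (Rspace N)" and t: "t > 0" and y: "\<forall>i<N. 0 \<le> y i \<and> y i \<le> h"
  shows "cmod ((\<integral>x. w x * f (shift N y x) \<partial>Leb N) - (\<integral>x. w x * f x \<partial>Leb N)) \<le>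
    (\<Sum>i<N. h * (t / 2 * (\<integral>x. (cmod (g i x))\<^sup>2 \<partial>Leb N) + 1 / (2 * t) * (\<integral>x. (cmod (f x))\<^sup>2 \<partial>Leb N)))"
proof -
  define K where "K i = t / 2 * (\<integral>x. (cmod (g i x))\<^sup>2 \<partial>Leb N) + 1 / (2 * t) * (\<integral>x. (cmod (f x))\<^sup>2 \<partial>Leb N)" for i
  have K: "K i \<ge> 0" for i unfolding K_def using t by simp
  define z where "z k = (\<lambda>j. if j < k then y j else 0)" for k :: nat
  let ?\<Psi> = "\<lambda>k. \<integral>x. w x * f (shift N (z k) x) \<partial>Leb N"
  have "k \<le> N \<Longrightarrow> cmod (?\<Psi> k - ?\<Psi> 0) \<le> (\<Sum>i<k. h * K i)" for k
  proof (induction k)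
    case (Suc k)
    then have k: "k < N" by simp
    let ?f = "\<lambda>x. f (shift N (z k) x)"
    have zk: "(\<lambda>j. z k j + single k (y k) j) = z (Suc k)"
      by (auto simp: z_def single_def)
    have "cmod ((\<integral>x. w x * ?f (shift N (single k (y k)) x) \<partial>Leb N) - ?\<Psi> k) \<le> y k *
        (t / 2 * (\<integral>x. (cmod (g k x))\<^sup>2 \<partial>Leb N) + 1 / (2 * t) * (\<integral>x. (cmod (?f x))\<^sup>2 \<partial>Leb N))"
      using weak_translation_single[OF w _ k _ Cc_inf_shift[OF f] t, of "g k" "y k" "z k"] g weak y k by blast
    also have "(\<integral>x. (cmod (?f x))\<^sup>2 \<partial>Leb N) = (\<integral>x. (cmod (f x))\<^sup>2 \<partial>Leb N)"
      using integral_shift[of "\<lambda>x. (cmod (f x))\<^sup>2" N "z k"] Cc_inf_measurable[OF f] by simp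
    finally have "cmod (?\<Psi> (Suc k) - ?\<Psi> k) \<le> y k * K k"
      unfolding K_def shift_shift zk .
    also have "\<dots> \<le> h * K k" using y k K by (intro mult_right_mono) auto
    finally have "cmod (?\<Psi> (Suc k) - ?\<Psi> k) \<le> h * K k" .
    moreover have "cmod (?\<Psi> (Suc k) - ?\<Psi> 0) \<le> cmod (?\<Psi> (Suc k) - ?\<Psi> k) + cmod (?\<Psi> k - ?\<Psi> 0)"
      using norm_triangle_ineq[of "?\<Psi> (Suc k) - ?\<Psi> k" "?\<Psi> k - ?\<Psi> 0"] by simp
    ultimately show ?case using Suc by simp
  qed simp
  from this[of N] have "cmod (?\<Psi> N - ?\<Psi> 0) \<le> (\<Sum>i<N. h * K i)" by simp
  moreover have "?\<Psi> N = (\<integral>x. w x * f (shift N y x) \<partial>Leb N)"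
  proof -
    have "shift N (z N) x = shift N y x" for x by (auto simp: shift_def z_def)
    then show ?thesis by simp
  qed
  moreover have "?\<Psi> 0 = (\<integral>x. w x * f x \<partial>Leb N)"
  proof (rule Bochner_Integration.integral_cong[OF refl])
    fix x assume "x \<in> space (Leb N)"
    moreover have "z 0 = (\<lambda>_. 0)" by (auto simp: z_def)
    ultimately show "w x * f (shift N (z 0) x) = w x * f x"
      unfolding space_Leb using shift_zero by metis
  qed
  ultimately show ?thesis unfolding K_def by simp
qed

lemma mul_sq_le: "t > 0 \<Longrightarrow> (cmod (a - b))\<^sup>2 \<le> (1 + t) * (cmod a)\<^sup>2 + (1 + 1 / t) * (cmod b)\<^sup>2" for t :: real
proof -
  assume t: "t > 0"
  have "(cmod (a - b))\<^sup>2 \<le> (cmod a + cmod b)\<^sup>2"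
    by (intro power_mono norm_triangle_ineq4) simp
  also have "\<dots> = (cmod a)\<^sup>2 + (cmod b)\<^sup>2 + 2 * (cmod a * cmod b)"
    by (simp add: power2_sum)
  also have "\<dots> \<le> (cmod a)\<^sup>2 + (cmod b)\<^sup>2 + 2 * (t / 2 * (cmod a)\<^sup>2 + 1 / (2 * t) * (cmod b)\<^sup>2)"
    by (intro add_left_mono mult_left_mono young_ineq t) simp
  also have "\<dots> = (1 + t) * (cmod a)\<^sup>2 + (1 + 1 / t) * (cmod b)\<^sup>2"
    using t by (simp add: field_simps)
  finally show ?thesis .
qed

lemma sqint_shift:
  assumes "sqint (Leb N) v"
  shows "sqint (Leb N) (\<lambda>x. v (shift N y x))"
proof -
  note [measurable] = sqint_measurable[OF assms]
  have "integrable (Leb N) (\<lambda>x. (cmod (v (shift N y x)))\<^sup>2)"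
    using integrable_shift[of "\<lambda>x. (cmod (v x))\<^sup>2" N y] sqint_integrable[OF assms] by simp
  moreover have "(\<lambda>x. v (shift N y x)) \<in> borel_measurable (Leb N)" by measurable
  ultimately show ?thesis unfolding sqint_def by blast
qed

text \<open>The choice of the complex conjugate of \<open>w\<close> as a test function turns the translation estimate into
  a lower bound of an autocorrelation.  Since \<open>w\<close> need not be smooth, a test function \<open>f\<close> approximates
  it up to \<open>e\<close> in the mean, and \<open>e\<close> tends to zero in the end.\<close>

lemma weak_translation_self:
  assumes w: "integrable (Leb N) w" "sqint (Leb N) w" and g: "\<forall>i<N. sqint (Leb N) (g i)"
    and weak: "\<forall>i<N. \<forall>f\<in>Cc_inf N (Rspace N).
      (\<integral>x. w x * pderiv_at i f x \<partial>Leb N) = - (\<integral>x. g i x * f x \<partial>Leb N)"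
    and t: "t > 0" and h: "h > 0" and y: "\<forall>i<N. 0 \<le> y i \<and> y i \<le> h"
  shows "(\<integral>x. (cmod (w x))\<^sup>2 \<partial>Leb N) \<le> cmod (\<integral>x. w x * cnj (w (shift N y x)) \<partial>Leb N) +
    (\<Sum>i<N. h * (t / 2 * (\<integral>x. (cmod (g i x))\<^sup>2 \<partial>Leb N) + 1 / (2 * t) * (\<integral>x. (cmod (w x))\<^sup>2 \<partial>Leb N)))"
proof -
  define W where "W = (\<integral>x. (cmod (w x))\<^sup>2 \<partial>Leb N)"
  define G where "G i = (\<integral>x. (cmod (g i x))\<^sup>2 \<partial>Leb N)" for i
  define A where "A = cmod (\<integral>x. w x * cnj (w (shift N y x)) \<partial>Leb N)"
  note [measurable] = sqint_measurable[OF w(2)]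
  have W0: "W \<ge> 0" unfolding W_def by simp
  have wc: "sqint (Leb N) (\<lambda>x. cnj (w x))" using sqint_cnj[OF w(2)] .
  define B where "B e = A + e * (W + 1) + (\<Sum>i<N. h * (t / 2 * G i + 1 / (2 * t) * ((1 + e) * W + (e\<^sup>2 + e))))" for e :: real
  have le: "W \<le> B e" if e: "e > 0" for e
  proof -
    obtain f where f: "f \<in> Cc_inf N (Rspace N)" "(\<integral>x. (cmod (cnj (w x) - f x))\<^sup>2 \<partial>Leb N) < e\<^sup>2"
      using Cc_inf_dense[OF wc, of "e\<^sup>2"] e by auto
    note [measurable] = Cc_inf_measurable[OF f(1)]
    let ?r = "\<lambda>x. cnj (w x) - f x"
    have r: "sqint (Leb N) ?r" using sqint_diff[OF wc Cc_inf_sqint(1)[OF f(1)]] by simp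
    have re: "(\<integral>x. (cmod (?r x))\<^sup>2 \<partial>Leb N) \<le> e\<^sup>2" using f(2) by simp
    have pair: "cmod (\<integral>x. w x * v x \<partial>Leb N) \<le> e / 2 * (W + 1)"
      if v: "sqint (Leb N) v" "(\<integral>x. (cmod (v x))\<^sup>2 \<partial>Leb N) \<le> e\<^sup>2" for v
    proof -
      have "cmod (\<integral>x. w x * v x \<partial>Leb N) \<le> e / 2 * W + 1 / (2 * e) * (\<integral>x. (cmod (v x))\<^sup>2 \<partial>Leb N)"
        unfolding W_def by (rule young_integral[OF w(2) v(1) e])
      also have "\<dots> \<le> e / 2 * W + 1 / (2 * e) * e\<^sup>2"
        using e by (intro add_left_mono mult_left_mono v(2)) simp
      also have "\<dots> = e / 2 * (W + 1)" using e by (simp add: field_simps power2_eq_square)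
      finally show ?thesis .
    qed
    have F: "(\<integral>x. (cmod (f x))\<^sup>2 \<partial>Leb N) \<le> (1 + e) * W + (e\<^sup>2 + e)"
    proof -
      have "(\<integral>x. (cmod (f x))\<^sup>2 \<partial>Leb N) \<le> (\<integral>x. (1 + e) * (cmod (w x))\<^sup>2 + (1 + 1 / e) * (cmod (?r x))\<^sup>2 \<partial>Leb N)"
      proof (rule integral_mono)
        show "integrable (Leb N) (\<lambda>x. (cmod (f x))\<^sup>2)" by (rule sqint_integrable[OF Cc_inf_sqint(1)[OF f(1)]])
        show "integrable (Leb N) (\<lambda>x. (1 + e) * (cmod (w x))\<^sup>2 + (1 + 1 / e) * (cmod (?r x))\<^sup>2)"
          using sqint_integrable[OF w(2)] sqint_integrable[OF r] by simp
        show "(cmod (f x))\<^sup>2 \<le> (1 + e) * (cmod (w x))\<^sup>2 + (1 + 1 / e) * (cmod (?r x))\<^sup>2" for x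
          using mul_sq_le[OF e, of "cnj (w x)" "?r x"] by simp
      qed
      also have "\<dots> = (1 + e) * W + (1 + 1 / e) * (\<integral>x. (cmod (?r x))\<^sup>2 \<partial>Leb N)"
        unfolding W_def using sqint_integrable[OF w(2)] sqint_integrable[OF r] by simp
      also have "\<dots> \<le> (1 + e) * W + (1 + 1 / e) * e\<^sup>2"
        using e by (intro add_left_mono mult_left_mono re) simp
      also have "(1 + 1 / e) * e\<^sup>2 = e\<^sup>2 + e" using e by (simp add: field_simps power2_eq_square)
      finally show ?thesis .
    qed
    have 1: "W \<le> cmod (\<integral>x. w x * f x \<partial>Leb N) + e / 2 * (W + 1)"
    proof -
      have "complex_of_real W = (\<integral>x. w x * cnj (w x) \<partial>Leb N)"
        unfolding W_def complex_norm_square[symmetric] by (rule integral_complex_of_real[symmetric])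
      also have "\<dots> = (\<integral>x. w x * f x + w x * ?r x \<partial>Leb N)" by (simp add: algebra_simps)
      also have "\<dots> = (\<integral>x. w x * f x \<partial>Leb N) + (\<integral>x. w x * ?r x \<partial>Leb N)"
        by (intro Bochner_Integration.integral_add sqint_mult_integrable w(2) Cc_inf_sqint(1)[OF f(1)] r)
      finally have "W = cmod ((\<integral>x. w x * f x \<partial>Leb N) + (\<integral>x. w x * ?r x \<partial>Leb N))"
        using W0 by (metis abs_of_nonneg norm_of_real)
      then show ?thesis
        using norm_triangle_ineq[of "\<integral>x. w x * f x \<partial>Leb N" "\<integral>x. w x * ?r x \<partial>Leb N"] pair[OF r re] by linarith
    qed
    have 2: "cmod (\<integral>x. w x * f (shift N y x) \<partial>Leb N) \<le> A + e / 2 * (W + 1)"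
    proof -
      have rs: "sqint (Leb N) (\<lambda>x. ?r (shift N y x))" using sqint_shift[OF r] .
      have "(\<integral>x. (cmod (?r (shift N y x)))\<^sup>2 \<partial>Leb N) = (\<integral>x. (cmod (?r x))\<^sup>2 \<partial>Leb N)"
        by (rule integral_shift[of "\<lambda>x. (cmod (?r x))\<^sup>2"]) measurable
      then have rse: "(\<integral>x. (cmod (?r (shift N y x)))\<^sup>2 \<partial>Leb N) \<le> e\<^sup>2" using re by simp
      have "(\<integral>x. w x * f (shift N y x) \<partial>Leb N) =
          (\<integral>x. w x * cnj (w (shift N y x)) - w x * ?r (shift N y x) \<partial>Leb N)" by (simp add: algebra_simps)
      also have "\<dots> = (\<integral>x. w x * cnj (w (shift N y x)) \<partial>Leb N) - (\<integral>x. w x * ?r (shift N y x) \<partial>Leb N)"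
        by (intro Bochner_Integration.integral_diff sqint_mult_integrable w(2) rs sqint_shift[OF wc])
      finally have eq: "(\<integral>x. w x * f (shift N y x) \<partial>Leb N) =
        (\<integral>x. w x * cnj (w (shift N y x)) \<partial>Leb N) - (\<integral>x. w x * ?r (shift N y x) \<partial>Leb N)" .
      show ?thesis unfolding A_def eq
        by (rule order_trans[OF norm_triangle_ineq4 add_left_mono[OF pair[OF rs rse]]])
    qed
    have 3: "cmod ((\<integral>x. w x * f (shift N y x) \<partial>Leb N) - (\<integral>x. w x * f x \<partial>Leb N)) \<le>
      (\<Sum>i<N. h * (t / 2 * G i + 1 / (2 * t) * ((1 + e) * W + (e\<^sup>2 + e))))"
    proof (rule order_trans[OF weak_translation[OF w(1) g weak f(1) t y]])
      show "(\<Sum>i<N. h * (t / 2 * (\<integral>x. (cmod (g i x))\<^sup>2 \<partial>Leb N) + 1 / (2 * t) * (\<integral>x. (cmod (f x))\<^sup>2 \<partial>Leb N)))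
        \<le> (\<Sum>i<N. h * (t / 2 * G i + 1 / (2 * t) * ((1 + e) * W + (e\<^sup>2 + e))))"
        unfolding G_def using h t by (intro sum_mono mult_left_mono add_left_mono F) auto
    qed
    have "cmod (\<integral>x. w x * f x \<partial>Leb N) \<le> cmod (\<integral>x. w x * f (shift N y x) \<partial>Leb N) +
        cmod ((\<integral>x. w x * f (shift N y x) \<partial>Leb N) - (\<integral>x. w x * f x \<partial>Leb N))"
      using norm_triangle_sub[of "\<integral>x. w x * f x \<partial>Leb N" "\<integral>x. w x * f (shift N y x) \<partial>Leb N"]
      unfolding norm_minus_commute[of "\<integral>x. w x * f x \<partial>Leb N"] .
    then show "W \<le> B e" using 1 2 3 unfolding B_def by linarith
  qed
  have "(B \<longlongrightarrow> B 0) (at_right 0)"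
    unfolding B_def by (intro tendsto_intros)
  moreover have "eventually (\<lambda>e. W \<le> B e) (at_right 0)"
    using eventually_at_right_less[of "0::real"] by eventually_elim (rule le)
  ultimately have "W \<le> B 0"
    by (rule tendsto_lowerbound) simp
  then show ?thesis unfolding B_def W_def G_def A_def by simp
qed

text \<open>The averages of \<open>\<integral>|w(x)| |w(x + y)| dx\<close> over the translations \<open>y\<close> in the cube of side \<open>h\<close> are at
  most \<open>\<parallel>w\<parallel>\<^sub>1\<^sup>2\<close> divided by the volume of the cube, by Tonelli; the translation estimate compares
  them with \<open>\<parallel>w\<parallel>\<^sub>2\<^sup>2\<close>.  The choice of the best \<open>h\<close> would give the classical inequality of Nash; the
  form with a free \<open>h\<close> is the one that an iteration can use.\<close>

lemma nash_inequality:
  assumes w: "integrable (Leb N) w" "sqint (Leb N) w" and g: "\<forall>i<N. sqint (Leb N) (g i)"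
    and weak: "\<forall>i<N. \<forall>f\<in>Cc_inf N (Rspace N).
      (\<integral>x. w x * pderiv_at i f x \<partial>Leb N) = - (\<integral>x. g i x * f x \<partial>Leb N)"
    and h: "h > 0" and N: "N \<ge> 1"
  shows "(\<integral>x. (cmod (w x))\<^sup>2 \<partial>Leb N) \<le> 2 / h ^ N * (\<integral>x. cmod (w x) \<partial>Leb N)\<^sup>2 +
    real N * h\<^sup>2 * (\<Sum>i<N. \<integral>x. (cmod (g i x))\<^sup>2 \<partial>Leb N)"
proof -
  define W where "W = (\<integral>x. (cmod (w x))\<^sup>2 \<partial>Leb N)"
  define L where "L = (\<integral>x. cmod (w x) \<partial>Leb N)"
  define S where "S = (\<Sum>i<N. \<integral>x. (cmod (g i x))\<^sup>2 \<partial>Leb N)"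
  \<comment> \<open>A lower bound of the autocorrelation; it may be negative, in which case the claim is trivial.\<close>
  define c where "c = W / 2 - real N * h\<^sup>2 / 2 * S"
  note [measurable] = sqint_measurable[OF w(2)]
  let ?k = "\<lambda>(y, x). ennreal (cmod (w x)) * ennreal (cmod (w (shift N y x)))"
  let ?Q = "obox N (\<lambda>_. 0) (\<lambda>_. h)"
  have km: "?k \<in> borel_measurable (Leb N \<Otimes>\<^sub>M Leb N)" by measurable
  have pt: "ennreal c \<le> (\<integral>\<^sup>+x. ?k (y, x) \<partial>Leb N)" if y: "y \<in> ?Q" for y
  proof -
    \<comment> \<open>With the weight N * h the N terms with W add up to W / 2.\<close>
    have "W \<le> cmod (\<integral>x. w x * cnj (w (shift N y x)) \<partial>Leb N) +
      (\<Sum>i<N. h * (real N * h / 2 * (\<integral>x. (cmod (g i x))\<^sup>2 \<partial>Leb N) + 1 / (2 * (real N * h)) * W))"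
      unfolding W_def using y N h unfolding mem_obox
      by (intro weak_translation_self[OF w g weak]) (auto intro: less_imp_le)
    also have "(\<Sum>i<N. h * (real N * h / 2 * (\<integral>x. (cmod (g i x))\<^sup>2 \<partial>Leb N) + 1 / (2 * (real N * h)) * W)) =
        real N * h\<^sup>2 / 2 * S + W / 2"
      unfolding S_def using h N
      by (simp add: distrib_left sum.distrib sum_distrib_left power2_eq_square mult_ac)
    finally have "c \<le> cmod (\<integral>x. w x * cnj (w (shift N y x)) \<partial>Leb N)" unfolding c_def by simp
    then have "ennreal c \<le> ennreal (cmod (\<integral>x. w x * cnj (w (shift N y x)) \<partial>Leb N))" by (rule ennreal_leI)
    also have "\<dots> \<le> (\<integral>\<^sup>+x. ennreal (cmod (w x * cnj (w (shift N y x)))) \<partial>Leb N)"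
    proof (rule integral_norm_bound_ennreal)
      have "sqint (Leb N) (\<lambda>x. cnj (w (shift N y x)))"
        by (rule sqint_cnj[OF sqint_shift[OF w(2)]])
      then show "integrable (Leb N) (\<lambda>x. w x * cnj (w (shift N y x)))" by (rule sqint_mult_integrable[OF w(2)])
    qed
    finally show ?thesis by (simp add: norm_mult ennreal_mult)
  qed
  have vol: "emeasure (Leb N) ?Q = ennreal (h ^ N)"
    unfolding emeasure_obox using h by (simp add: ennreal_power)
  have "ennreal c * ennreal (h ^ N) = (\<integral>\<^sup>+y. ennreal c * indicator ?Q y \<partial>Leb N)"
    using nn_integral_cmult_indicator[OF sets_obox[of N "\<lambda>_. 0" "\<lambda>_. h"], of "ennreal c"] unfolding vol by simp
  also have "\<dots> \<le> (\<integral>\<^sup>+y. \<integral>\<^sup>+x. ?k (y, x) \<partial>Leb N \<partial>Leb N)"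
  proof (rule nn_integral_mono)
    fix y
    show "ennreal c * indicator ?Q y \<le> (\<integral>\<^sup>+x. ?k (y, x) \<partial>Leb N)"
      by (cases "y \<in> ?Q") (use pt in simp_all)
  qed
  also have "\<dots> = (\<integral>\<^sup>+x. \<integral>\<^sup>+y. ?k (y, x) \<partial>Leb N \<partial>Leb N)"
  proof -
    interpret P: pair_sigma_finite "Leb N" "Leb N"
      by (intro pair_sigma_finite.intro lborel_product.sigma_finite finite_lessThan)
    show ?thesis by (rule P.Fubini[OF km, symmetric])
  qed
  also have "\<dots> = (\<integral>\<^sup>+x. ennreal (cmod (w x)) * ennreal L \<partial>Leb N)"
  proof (rule nn_integral_cong)
    fix x
    have "(\<integral>\<^sup>+y. ?k (y, x) \<partial>Leb N) = ennreal (cmod (w x)) * (\<integral>\<^sup>+y. ennreal (cmod (w (shift N x y))) \<partial>Leb N)"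
      by (simp add: nn_integral_cmult shift_commute[of N _ x])
    also have "(\<integral>\<^sup>+y. ennreal (cmod (w (shift N x y))) \<partial>Leb N) = (\<integral>\<^sup>+y. ennreal (cmod (w y)) \<partial>Leb N)"
      by (rule nn_integral_shift[of "\<lambda>y. ennreal (cmod (w y))"]) measurable
    also have "\<dots> = ennreal L"
      unfolding L_def using w(1) by (intro nn_integral_eq_integral) auto
    finally show "(\<integral>\<^sup>+y. ?k (y, x) \<partial>Leb N) = ennreal (cmod (w x)) * ennreal L" .
  qed
  also have "\<dots> = (\<integral>\<^sup>+x. ennreal (cmod (w x)) \<partial>Leb N) * ennreal L"
    by (simp add: nn_integral_multc)
  also have "(\<integral>\<^sup>+x. ennreal (cmod (w x)) \<partial>Leb N) = ennreal L"
    unfolding L_def using w(1) by (intro nn_integral_eq_integral) auto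
  finally have *: "ennreal c * ennreal (h ^ N) \<le> ennreal L * ennreal L" .
  have L: "L \<ge> 0" unfolding L_def by simp
  have "c * h ^ N \<le> L\<^sup>2"
  proof (cases "c \<ge> 0")
    case True
    then show ?thesis using * L h by (simp add: power2_eq_square flip: ennreal_mult)
  next
    case False
    then have "c * h ^ N \<le> 0" using h by (simp add: mult_nonpos_nonneg)
    then show ?thesis using zero_le_power2[of L] by linarith
  qed
  then have "c \<le> L\<^sup>2 / h ^ N" using h by (simp add: field_simps)
  then have "W \<le> 2 / h ^ N * L\<^sup>2 + real N * h\<^sup>2 * S" unfolding c_def by (simp add: field_simps)
  then show ?thesis unfolding W_def L_def S_def .
qed

section \<open>Weak derivatives on an open set\<close>

text \<open>By density, \<open>D\<close> is almost orthogonal to itself.\<close>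

lemma L2_eq_zero:
  assumes D: "sqint (Leb N) D" and orth: "\<forall>f\<in>Cc_inf N (Rspace N). (\<integral>x. D x * f x \<partial>Leb N) = 0"
  shows "AE x in Leb N. D x = 0"
proof -
  define W where "W = (\<integral>x. (cmod (D x))\<^sup>2 \<partial>Leb N)"
  have Dc: "sqint (Leb N) (\<lambda>x. cnj (D x))" by (rule sqint_cnj[OF D])
  have W0: "W \<ge> 0" unfolding W_def by simp
  have le: "W \<le> e / 2 * (W + 1)" if e: "e > 0" for e :: real
  proof -
    obtain f where f: "f \<in> Cc_inf N (Rspace N)" "(\<integral>x. (cmod (cnj (D x) - f x))\<^sup>2 \<partial>Leb N) < e\<^sup>2"
      using Cc_inf_dense[OF Dc, of "e\<^sup>2"] e by auto
    let ?r = "\<lambda>x. cnj (D x) - f x"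
    have r: "sqint (Leb N) ?r" by (rule sqint_diff(1)[OF Dc Cc_inf_sqint(1)[OF f(1)]])
    have "complex_of_real W = (\<integral>x. D x * cnj (D x) \<partial>Leb N)"
      unfolding W_def complex_norm_square[symmetric] by (rule integral_complex_of_real[symmetric])
    also have "\<dots> = (\<integral>x. D x * f x + D x * ?r x \<partial>Leb N)" by (simp add: algebra_simps)
    also have "\<dots> = (\<integral>x. D x * f x \<partial>Leb N) + (\<integral>x. D x * ?r x \<partial>Leb N)"
      by (intro Bochner_Integration.integral_add sqint_mult_integrable D Cc_inf_sqint(1)[OF f(1)] r)
    also have "\<dots> = (\<integral>x. D x * ?r x \<partial>Leb N)" using bspec[OF orth f(1)] by simp
    finally have "W = cmod (\<integral>x. D x * ?r x \<partial>Leb N)" using W0 by (metis abs_of_nonneg norm_of_real)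
    also have "\<dots> \<le> e / 2 * W + 1 / (2 * e) * (\<integral>x. (cmod (?r x))\<^sup>2 \<partial>Leb N)"
      unfolding W_def by (rule young_integral[OF D r e])
    also have "\<dots> \<le> e / 2 * W + 1 / (2 * e) * e\<^sup>2"
      using e f(2) by (intro add_left_mono mult_left_mono) auto
    also have "\<dots> = e / 2 * (W + 1)" using e by (simp add: field_simps power2_eq_square)
    finally show ?thesis .
  qed
  have "((\<lambda>e. e / 2 * (W + 1)) \<longlongrightarrow> 0 / 2 * (W + 1)) (at_right 0)" by (intro tendsto_intros) simp
  moreover have "eventually (\<lambda>e. W \<le> e / 2 * (W + 1)) (at_right 0)"
    using eventually_at_right_less[of "0::real"] by eventually_elim (rule le)
  ultimately have "W \<le> 0 / 2 * (W + 1)" by (rule tendsto_lowerbound) simp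
  then have "W = 0" using W0 by simp
  then have "AE x in Leb N. (cmod (D x))\<^sup>2 = 0"
    unfolding W_def using sqint_integrable[OF D] by (subst (asm) integral_nonneg_eq_0_iff_AE) auto
  then show ?thesis by simp
qed

lemma local_bump:
  assumes "openin (Rtop N) \<Omega>" "x \<in> \<Omega>"
  shows "\<exists>r>0. \<exists>\<eta>. rsmooth N \<eta> \<and> (\<forall>y\<in>Rspace N. 0 \<le> \<eta> y \<and> \<eta> y \<le> 1) \<and>
    (\<lambda>y. complex_of_real (\<eta> y)) \<in> Cc_inf N \<Omega> \<and> (\<forall>y\<in>cube N x r. \<eta> y = 1)"
proof -
  obtain C where C: "bump_constant C" using ex_bump_constant by blast
  obtain R where R: "R > 0" "cube N x R \<subseteq> \<Omega>" using openin_contains_cube[OF assms] by blast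
  define r where "r = R / 3"
  have r: "r > 0" using R by (simp add: r_def)
  obtain \<eta> where \<eta>: "rsmooth N \<eta>" "\<forall>x\<in>Rspace N. 0 \<le> \<eta> x \<and> \<eta> x \<le> 1"
    "\<forall>y\<in>Rspace N. (\<forall>i<N. x i - r \<le> y i \<and> y i \<le> x i + r) \<longrightarrow> \<eta> y = 1"
    "\<forall>y\<in>Rspace N. y \<notin> obox N (\<lambda>i. x i - r - r) (\<lambda>i. x i + r + r) \<longrightarrow> \<eta> y = 0"
    using bump_constantD[OF C r, of N "\<lambda>i. x i - r" "\<lambda>i. x i + r"] by blast
  let ?C = "PiE {..<N} (\<lambda>i. {x i - r - r..x i + r + r})"
  have "(\<lambda>y. complex_of_real (\<eta> y)) \<in> Cc_inf N \<Omega>"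
  proof (rule Cc_infI)
    show "smooth N (\<lambda>y. complex_of_real (\<eta> y))" using \<eta>(1) unfolding rsmooth_def .
    show "compactin (Rtop N) ?C" unfolding compactin_PiE by simp
    show "?C \<subseteq> \<Omega>"
    proof
      fix y assume y: "y \<in> ?C"
      have "\<bar>y i - x i\<bar> < R" if "i < N" for i
      proof -
        have "x i - r - r \<le> y i" "y i \<le> x i + r + r" using y that by (auto simp: PiE_iff)
        then show ?thesis using R(1) unfolding r_def by (simp add: abs_less_iff)
      qed
      moreover have "y \<in> Rspace N" using y by (simp add: PiE_iff)
      ultimately show "y \<in> \<Omega>" using R(2) mem_cube by blast
    qed
    show "\<forall>y\<in>Rspace N - ?C. complex_of_real (\<eta> y) = 0"
    proof
      fix y assume y: "y \<in> Rspace N - ?C"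
      have "obox N (\<lambda>i. x i - r - r) (\<lambda>i. x i + r + r) \<subseteq> ?C"
        unfolding obox_def by (intro PiE_mono) auto
      then have "y \<notin> obox N (\<lambda>i. x i - r - r) (\<lambda>i. x i + r + r)" using y by blast
      then show "complex_of_real (\<eta> y) = 0" using \<eta>(4) y by simp
    qed
  qed
  moreover have "\<forall>y\<in>cube N x r. \<eta> y = 1"
  proof
    fix y assume "y \<in> cube N x r"
    then have "y \<in> Rspace N" "\<forall>i<N. x i - r \<le> y i \<and> y i \<le> x i + r"
      unfolding mem_obox by (blast, auto intro: less_imp_le)
    then show "\<eta> y = 1" using \<eta>(3) by blast
  qed
  ultimately show ?thesis using r \<eta>(1,2) by blast
qed

lemma space_leb: "space (leb N \<Omega>) = \<Omega> \<inter> Rspace N"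
  unfolding leb_def space_restrict_space space_Leb ..

lemma sets_Leb_Int: "openin (Rtop N) \<Omega> \<Longrightarrow> \<Omega> \<inter> space (Leb N) \<in> sets (Leb N)"
  using openin_sets_Leb sets.Int sets.top by blast

lemma measurable_leb: "f \<in> borel_measurable (Leb N) \<Longrightarrow> f \<in> borel_measurable (leb N \<Omega>)"
  unfolding leb_def by (rule measurable_restrict_space1)

lemma sqint_leb:
  assumes \<Omega>: "openin (Rtop N) \<Omega>"
  shows "sqint (leb N \<Omega>) f \<longleftrightarrow> sqint (Leb N) (\<lambda>x. indicator \<Omega> x * f x)"
proof -
  have 1: "f \<in> borel_measurable (leb N \<Omega>) \<longleftrightarrow> (\<lambda>x. indicator \<Omega> x * f x) \<in> borel_measurable (Leb N)"
    unfolding leb_def borel_measurable_restrict_space_iff[OF sets_Leb_Int[OF \<Omega>]]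
    by (intro measurable_cong) (simp add: indicator_def)
  have 2: "integrable (leb N \<Omega>) (\<lambda>x. (cmod (f x))\<^sup>2) \<longleftrightarrow> integrable (Leb N) (\<lambda>x. (cmod (indicator \<Omega> x * f x))\<^sup>2)"
    unfolding leb_def integrable_restrict_space[OF sets_Leb_Int[OF \<Omega>]]
    by (intro Bochner_Integration.integrable_cong) (auto simp: indicator_def)
  show ?thesis unfolding sqint_def 1 2 ..
qed

lemma integral_leb:
  fixes f :: "pt \<Rightarrow> complex"
  assumes \<Omega>: "openin (Rtop N) \<Omega>"
  shows "(\<integral>x. f x \<partial>leb N \<Omega>) = (\<integral>x. indicator \<Omega> x * f x \<partial>Leb N)"
  unfolding leb_def integral_restrict_space[OF sets_Leb_Int[OF \<Omega>]]
  by (intro Bochner_Integration.integral_cong) (auto simp: indicator_def)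

lemma AE_leb:
  assumes \<Omega>: "openin (Rtop N) \<Omega>"
  shows "(AE x in leb N \<Omega>. P x) \<longleftrightarrow> (AE x in Leb N. x \<in> \<Omega> \<longrightarrow> P x)"
  unfolding leb_def AE_restrict_space_iff[OF sets_Leb_Int[OF \<Omega>]] ..

lemma Cc_inf_sqint_leb:
  assumes f: "f \<in> Cc_inf N \<Omega>'" and \<Omega>: "openin (Rtop N) \<Omega>"
  shows "sqint (leb N \<Omega>) f"
  unfolding sqint_leb[OF \<Omega>]
proof (rule sqint_bound[OF Cc_inf_sqint(1)[OF f], of _ 1])
  show "(\<lambda>x. indicator \<Omega> x * f x) \<in> borel_measurable (Leb N)"
    using Cc_inf_measurable[OF f] openin_sets_Leb[OF \<Omega>] by measurable
qed (auto simp: indicator_def)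

lemma Lp2_iff: "f \<in> Lp N \<Omega> 2 \<longleftrightarrow> sqint (leb N \<Omega>) f"
  unfolding Lp_def sqint_def by simp

text \<open>The constant \<^const>\<open>weak_deriv\<close> is a choice, so every computation with it rests on this
  uniqueness.  The density of test functions is known on the whole space; a cutoff of \<open>g - g'\<close> near
  a point transfers it to \<open>\<Omega>\<close>.\<close>

lemma weak_deriv_AE_unique:
  assumes \<Omega>: "openin (Rtop N) \<Omega>" and g: "sqint (leb N \<Omega>) g" "is_weak_deriv N \<Omega> i u g"
    and g': "sqint (leb N \<Omega>) g'" "is_weak_deriv N \<Omega> i u g'"
  shows "AE x in leb N \<Omega>. g x = g' x"
proof -
  define d where "d x = g x - g' x" for x
  have d: "sqint (leb N \<Omega>) d" unfolding d_def by (rule sqint_diff(1)[OF g(1) g'(1)])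
  have orth: "(\<integral>x. d x * \<psi> x \<partial>leb N \<Omega>) = 0" if \<psi>: "\<psi> \<in> Cc_inf N \<Omega>" for \<psi>
  proof -
    note s = Cc_inf_sqint_leb[OF \<psi> \<Omega>]
    have "(\<integral>x. d x * \<psi> x \<partial>leb N \<Omega>) = (\<integral>x. g x * \<psi> x - g' x * \<psi> x \<partial>leb N \<Omega>)"
      unfolding d_def by (simp add: algebra_simps)
    also have "\<dots> = (\<integral>x. g x * \<psi> x \<partial>leb N \<Omega>) - (\<integral>x. g' x * \<psi> x \<partial>leb N \<Omega>)"
      by (intro Bochner_Integration.integral_diff sqint_mult_integrable g(1) g'(1) s)
    also have "\<dots> = 0"
      using g(2) g'(2) \<psi> unfolding is_weak_deriv_def by (metis neg_equal_iff_equal right_minus_eq)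
    finally show ?thesis .
  qed
  have "AE y in Leb N. y \<in> \<Omega> \<longrightarrow> d y = 0"
  proof (rule AE_locally)
    fix x assume x: "x \<in> \<Omega>"
    obtain r \<eta> where r: "r > 0" and \<eta>: "rsmooth N \<eta>" "\<forall>y\<in>Rspace N. 0 \<le> \<eta> y \<and> \<eta> y \<le> 1"
      "(\<lambda>y. complex_of_real (\<eta> y)) \<in> Cc_inf N \<Omega>" "\<forall>y\<in>cube N x r. \<eta> y = 1"
      using local_bump[OF \<Omega> x] by blast
    let ?D = "\<lambda>y. indicator \<Omega> y * d y * complex_of_real (\<eta> y)"
    have "AE y in Leb N. ?D y = 0"
    proof (rule L2_eq_zero)
      have "sqint (Leb N) (\<lambda>x. indicator \<Omega> x * d x)" using d unfolding sqint_leb[OF \<Omega>] .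
      then show "sqint (Leb N) ?D"
      proof (rule sqint_bound[where B = 1])
        show "?D \<in> borel_measurable (Leb N)"
          using sqint_measurable[OF d[unfolded sqint_leb[OF \<Omega>]]] Cc_inf_measurable[OF \<eta>(3)] by measurable
        show "AE y in Leb N. cmod (?D y) \<le> 1 * cmod (indicator \<Omega> y * d y)"
        proof (rule AE_I2)
          fix y assume "y \<in> space (Leb N)"
          then have "\<bar>\<eta> y\<bar> \<le> 1" using \<eta>(2) unfolding space_Leb by (simp add: abs_le_iff)
          from mult_left_mono[OF this norm_ge_zero[of "indicator \<Omega> y * d y"]]
          show "cmod (?D y) \<le> 1 * cmod (indicator \<Omega> y * d y)" unfolding norm_mult[of _ "of_real _"] norm_of_real by simp
        qed
      qed
      show "\<forall>f\<in>Cc_inf N (Rspace N). (\<integral>y. ?D y * f y \<partial>Leb N) = 0"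
      proof
        fix f assume f: "f \<in> Cc_inf N (Rspace N)"
        have "(\<lambda>y. f y * complex_of_real (\<eta> y)) \<in> Cc_inf N \<Omega>" by (rule Cc_inf_mult[OF Cc_inf_smooth[OF f] \<eta>(3)])
        from orth[OF this] show "(\<integral>y. ?D y * f y \<partial>Leb N) = 0"
          unfolding integral_leb[OF \<Omega>] by (simp add: mult_ac)
      qed
    qed
    then have "AE y in Leb N. y \<in> cube N x r \<inter> \<Omega> \<longrightarrow> d y = 0"
      by eventually_elim (use \<eta>(4) in auto)
    moreover have "openin (Rtop N) (cube N x r \<inter> \<Omega>)" by (intro openin_Int openin_obox \<Omega>)
    moreover have "x \<in> cube N x r \<inter> \<Omega>" using x r openin_subset[OF \<Omega>] unfolding mem_obox Int_iff by auto
    ultimately show "\<exists>V. openin (Rtop N) V \<and> x \<in> V \<and> (AE y in Leb N. y \<in> V \<longrightarrow> d y = 0)" by blast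
  qed
  then show ?thesis unfolding AE_leb[OF \<Omega>] d_def by simp
qed

text \<open>Only the product \<open>\<zeta> \<psi>\<close> has to be a test function on \<open>\<Omega>\<close>.  This covers both a smooth \<open>\<zeta>\<close> with
  a test function \<open>\<psi>\<close> on \<open>\<Omega>\<close>, and a \<open>\<zeta>\<close> with compact support in \<open>\<Omega>\<close> with a test function \<open>\<psi>\<close> on
  the whole space; the latter extends \<open>\<zeta> u\<close> by zero.\<close>

lemma weak_product_rule:
  assumes \<Omega>: "openin (Rtop N) \<Omega>" and u: "sqint (leb N \<Omega>) u" and g: "sqint (leb N \<Omega>) g" "is_weak_deriv N \<Omega> i u g"
    and \<zeta>: "smooth N \<zeta>" and \<psi>: "smooth N \<psi>" and i: "i < N"
    and 1: "(\<lambda>x. \<zeta> x * \<psi> x) \<in> Cc_inf N \<Omega>" and 2: "(\<lambda>x. pderiv_at i \<zeta> x * \<psi> x) \<in> Cc_inf N \<Omega>"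
  shows "(\<integral>x. \<zeta> x * u x * pderiv_at i \<psi> x \<partial>leb N \<Omega>) =
    - (\<integral>x. (\<zeta> x * g x + pderiv_at i \<zeta> x * u x) * \<psi> x \<partial>leb N \<Omega>)"
proof -
  let ?\<zeta>' = "pderiv_at i \<zeta>"
  note s = Cc_inf_sqint_leb[OF 1 \<Omega>] Cc_inf_sqint_leb[OF 2 \<Omega>] Cc_inf_sqint_leb[OF Cc_inf_pderiv[OF 1 i] \<Omega>]
  have "(\<integral>x. \<zeta> x * u x * pderiv_at i \<psi> x \<partial>leb N \<Omega>) =
      (\<integral>x. u x * pderiv_at i (\<lambda>x. \<zeta> x * \<psi> x) x - u x * (?\<zeta>' x * \<psi> x) \<partial>leb N \<Omega>)"
  proof (rule Bochner_Integration.integral_cong[OF refl])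
    fix x assume "x \<in> space (leb N \<Omega>)"
    then have x: "x \<in> Rspace N" unfolding space_leb by blast
    show "\<zeta> x * u x * pderiv_at i \<psi> x = u x * pderiv_at i (\<lambda>x. \<zeta> x * \<psi> x) x - u x * (?\<zeta>' x * \<psi> x)"
      unfolding pderiv_mult[OF \<zeta> \<psi> x i] by (simp add: algebra_simps)
  qed
  also have "\<dots> = (\<integral>x. u x * pderiv_at i (\<lambda>x. \<zeta> x * \<psi> x) x \<partial>leb N \<Omega>) - (\<integral>x. u x * (?\<zeta>' x * \<psi> x) \<partial>leb N \<Omega>)"
    by (intro Bochner_Integration.integral_diff sqint_mult_integrable u s)
  also have "(\<integral>x. u x * pderiv_at i (\<lambda>x. \<zeta> x * \<psi> x) x \<partial>leb N \<Omega>) = - (\<integral>x. g x * (\<zeta> x * \<psi> x) \<partial>leb N \<Omega>)"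
    using g(2) 1 unfolding is_weak_deriv_def by blast
  also have "- (\<integral>x. g x * (\<zeta> x * \<psi> x) \<partial>leb N \<Omega>) - (\<integral>x. u x * (?\<zeta>' x * \<psi> x) \<partial>leb N \<Omega>) =
      - ((\<integral>x. g x * (\<zeta> x * \<psi> x) \<partial>leb N \<Omega>) + (\<integral>x. u x * (?\<zeta>' x * \<psi> x) \<partial>leb N \<Omega>))" by simp
  also have "(\<integral>x. g x * (\<zeta> x * \<psi> x) \<partial>leb N \<Omega>) + (\<integral>x. u x * (?\<zeta>' x * \<psi> x) \<partial>leb N \<Omega>) =
      (\<integral>x. g x * (\<zeta> x * \<psi> x) + u x * (?\<zeta>' x * \<psi> x) \<partial>leb N \<Omega>)"
    by (intro Bochner_Integration.integral_add[symmetric] sqint_mult_integrable u g(1) s)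
  also have "\<dots> = (\<integral>x. (\<zeta> x * g x + ?\<zeta>' x * u x) * \<psi> x \<partial>leb N \<Omega>)" by (simp add: algebra_simps)
  finally show ?thesis .
qed

lemma is_weak_deriv_mult:
  assumes \<Omega>: "openin (Rtop N) \<Omega>" and u: "sqint (leb N \<Omega>) u" and g: "sqint (leb N \<Omega>) g" "is_weak_deriv N \<Omega> i u g"
    and \<zeta>: "smooth N \<zeta>" and i: "i < N"
  shows "is_weak_deriv N \<Omega> i (\<lambda>x. \<zeta> x * u x) (\<lambda>x. \<zeta> x * g x + pderiv_at i \<zeta> x * u x)"
  unfolding is_weak_deriv_def
proof
  fix \<psi> assume \<psi>: "\<psi> \<in> Cc_inf N \<Omega>"
  show "(\<integral>x. \<zeta> x * u x * pderiv_at i \<psi> x \<partial>leb N \<Omega>) = - (\<integral>x. (\<zeta> x * g x + pderiv_at i \<zeta> x * u x) * \<psi> x \<partial>leb N \<Omega>)"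
    by (rule weak_product_rule[OF \<Omega> u g \<zeta> Cc_inf_smooth[OF \<psi>] i Cc_inf_mult[OF \<zeta> \<psi>]
        Cc_inf_mult[OF smooth_pderiv[OF \<zeta> i] \<psi>]])
qed

lemma bounded_mult_sqint:
  assumes f: "sqint (leb N \<Omega>) f" and k: "k \<in> borel_measurable (Leb N)" "\<forall>x\<in>Rspace N. cmod (k x) \<le> B"
  shows "sqint (leb N \<Omega>) (\<lambda>x. k x * f x)"
proof (rule sqint_bound[OF f])
  show "(\<lambda>x. k x * f x) \<in> borel_measurable (leb N \<Omega>)"
    by (intro borel_measurable_times measurable_leb k(1) sqint_measurable[OF f])
  show "AE x in leb N \<Omega>. cmod (k x * f x) \<le> B * cmod (f x)"
  proof (rule AE_I2)
    fix x assume "x \<in> space (leb N \<Omega>)"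
    then have "cmod (k x) \<le> B" using k(2) unfolding space_leb by blast
    then show "cmod (k x * f x) \<le> B * cmod (f x)" unfolding norm_mult by (rule mult_right_mono) simp
  qed
qed

lemma is_weak_deriv_diff:
  assumes \<Omega>: "openin (Rtop N) \<Omega>" and i: "i < N"
    and "sqint (leb N \<Omega>) u" "sqint (leb N \<Omega>) g" "is_weak_deriv N \<Omega> i u g"
    and "sqint (leb N \<Omega>) v" "sqint (leb N \<Omega>) h" "is_weak_deriv N \<Omega> i v h"
  shows "is_weak_deriv N \<Omega> i (\<lambda>x. u x - v x) (\<lambda>x. g x - h x)"
  unfolding is_weak_deriv_def
proof
  fix \<psi> assume \<psi>: "\<psi> \<in> Cc_inf N \<Omega>"
  note s = Cc_inf_sqint_leb[OF \<psi> \<Omega>] Cc_inf_sqint_leb[OF Cc_inf_pderiv[OF \<psi> i] \<Omega>]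
  have "(\<integral>x. (u x - v x) * pderiv_at i \<psi> x \<partial>leb N \<Omega>) =
      (\<integral>x. u x * pderiv_at i \<psi> x \<partial>leb N \<Omega>) - (\<integral>x. v x * pderiv_at i \<psi> x \<partial>leb N \<Omega>)"
    unfolding left_diff_distrib by (intro Bochner_Integration.integral_diff sqint_mult_integrable assms s)
  also have "\<dots> = - ((\<integral>x. g x * \<psi> x \<partial>leb N \<Omega>) - (\<integral>x. h x * \<psi> x \<partial>leb N \<Omega>))"
    using assms(5,8) \<psi> unfolding is_weak_deriv_def by simp
  also have "(\<integral>x. g x * \<psi> x \<partial>leb N \<Omega>) - (\<integral>x. h x * \<psi> x \<partial>leb N \<Omega>) = (\<integral>x. (g x - h x) * \<psi> x \<partial>leb N \<Omega>)"
    unfolding left_diff_distrib by (intro Bochner_Integration.integral_diff[symmetric] sqint_mult_integrable assms s)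
  finally show "(\<integral>x. (u x - v x) * pderiv_at i \<psi> x \<partial>leb N \<Omega>) = - (\<integral>x. (g x - h x) * \<psi> x \<partial>leb N \<Omega>)" .
qed

lemma sqint_integral_cong:
  assumes "sqint M f" "sqint M g" "AE x in M. f x = g x"
  shows "(\<integral>x. (cmod (f x))\<^sup>2 \<partial>M) = (\<integral>x. (cmod (g x))\<^sup>2 \<partial>M)"
  using assms(3) by (intro integral_cong_AE borel_measurable_integrable sqint_integrable assms(1,2)) auto

lemma H1_D:
  assumes "u \<in> H1 N \<Omega>"
  shows "sqint (leb N \<Omega>) u"
    and "i < N \<Longrightarrow> sqint (leb N \<Omega>) (weak_deriv N \<Omega> i u)"
    and "i < N \<Longrightarrow> is_weak_deriv N \<Omega> i u (weak_deriv N \<Omega> i u)"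
proof -
  show "sqint (leb N \<Omega>) u" using assms unfolding H1_def Lp2_iff by blast
  assume "i < N"
  then have "\<exists>g. g \<in> Lp N \<Omega> 2 \<and> is_weak_deriv N \<Omega> i u g" using assms unfolding H1_def by blast
  from someI_ex[OF this] show "sqint (leb N \<Omega>) (weak_deriv N \<Omega> i u)" "is_weak_deriv N \<Omega> i u (weak_deriv N \<Omega> i u)"
    unfolding weak_deriv_def Lp2_iff by blast+
qed

lemma H1_I:
  assumes "sqint (leb N \<Omega>) u" "\<forall>i<N. sqint (leb N \<Omega>) (g i) \<and> is_weak_deriv N \<Omega> i u (g i)"
  shows "u \<in> H1 N \<Omega>"
  unfolding H1_def Lp2_iff
proof (intro CollectI conjI allI impI)
  fix i assume "i < N"
  then show "\<exists>g\<in>Lp N \<Omega> 2. is_weak_deriv N \<Omega> i u g"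
    using assms(2) by (intro bexI[of _ "g i"]) (simp_all add: Lp2_iff)
qed (rule assms(1))

lemma weak_deriv_eq_AE:
  assumes \<Omega>: "openin (Rtop N) \<Omega>" and u: "u \<in> H1 N \<Omega>" and i: "i < N"
    and g: "sqint (leb N \<Omega>) g" "is_weak_deriv N \<Omega> i u g"
  shows "AE x in leb N \<Omega>. weak_deriv N \<Omega> i u x = g x"
  by (rule weak_deriv_AE_unique[OF \<Omega> H1_D(2,3)[OF u i] g])

lemma H1_diff:
  assumes \<Omega>: "openin (Rtop N) \<Omega>" and "u \<in> H1 N \<Omega>" "v \<in> H1 N \<Omega>"
  shows "(\<lambda>x. u x - v x) \<in> H1 N \<Omega>"
proof (rule H1_I[where g = "\<lambda>i x. weak_deriv N \<Omega> i u x - weak_deriv N \<Omega> i v x"], intro sqint_diff(1) H1_D(1) assms,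
    intro allI impI conjI)
  fix i assume i: "i < N"
  note d = H1_D[OF assms(2)] H1_D[OF assms(3)]
  show "sqint (leb N \<Omega>) (\<lambda>x. weak_deriv N \<Omega> i u x - weak_deriv N \<Omega> i v x)"
    by (rule sqint_diff(1)[OF d(2)[OF i] d(5)[OF i]])
  show "is_weak_deriv N \<Omega> i (\<lambda>x. u x - v x) (\<lambda>x. weak_deriv N \<Omega> i u x - weak_deriv N \<Omega> i v x)"
    by (rule is_weak_deriv_diff[OF \<Omega> i d(1) d(2)[OF i] d(3)[OF i] d(4) d(5)[OF i] d(6)[OF i]])
qed

text \<open>Integration by parts: the partial derivative of a product of test functions has integral
  zero.\<close>

lemma Cc_inf_H1:
  assumes \<Omega>: "openin (Rtop N) \<Omega>" and \<psi>: "\<psi> \<in> Cc_inf N \<Omega>"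
  shows "\<psi> \<in> H1 N \<Omega>"
proof (rule H1_I[where g = "\<lambda>i. pderiv_at i \<psi>"], safe)
  show "sqint (leb N \<Omega>) \<psi>" by (rule Cc_inf_sqint_leb[OF \<psi> \<Omega>])
  fix i assume i: "i < N"
  note \<psi>' = Cc_inf_pderiv[OF \<psi> i]
  show "sqint (leb N \<Omega>) (pderiv_at i \<psi>)" by (rule Cc_inf_sqint_leb[OF \<psi>' \<Omega>])
  show "is_weak_deriv N \<Omega> i \<psi> (pderiv_at i \<psi>)"
    unfolding is_weak_deriv_def
  proof
    fix f assume f: "f \<in> Cc_inf N \<Omega>"
    note f' = Cc_inf_pderiv[OF f i]
    have m: "(\<lambda>x. \<psi> x * f x) \<in> Cc_inf N \<Omega>" by (rule Cc_inf_mult[OF Cc_inf_smooth[OF \<psi>] f])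
    have sub: "\<Omega> \<subseteq> Rspace N" using openin_subset[OF \<Omega>] .
    have "(\<integral>x. \<psi> x * pderiv_at i f x \<partial>leb N \<Omega>) + (\<integral>x. pderiv_at i \<psi> x * f x \<partial>leb N \<Omega>) =
        (\<integral>x. \<psi> x * pderiv_at i f x + pderiv_at i \<psi> x * f x \<partial>leb N \<Omega>)"
      by (intro Bochner_Integration.integral_add[symmetric] sqint_mult_integrable Cc_inf_sqint_leb[OF \<psi> \<Omega>]
        Cc_inf_sqint_leb[OF \<psi>' \<Omega>] Cc_inf_sqint_leb[OF f \<Omega>] Cc_inf_sqint_leb[OF f' \<Omega>])
    also have "\<dots> = (\<integral>x. pderiv_at i (\<lambda>x. \<psi> x * f x) x \<partial>leb N \<Omega>)"
    proof (rule Bochner_Integration.integral_cong[OF refl])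
      fix x assume "x \<in> space (leb N \<Omega>)"
      then have x: "x \<in> Rspace N" unfolding space_leb by blast
      show "\<psi> x * pderiv_at i f x + pderiv_at i \<psi> x * f x = pderiv_at i (\<lambda>x. \<psi> x * f x) x"
        by (rule pderiv_mult[OF Cc_inf_smooth[OF \<psi>] Cc_inf_smooth[OF f] x i, symmetric])
    qed
    also have "\<dots> = (\<integral>x. pderiv_at i (\<lambda>x. \<psi> x * f x) x \<partial>Leb N)"
      unfolding integral_leb[OF \<Omega>]
    proof (rule Bochner_Integration.integral_cong[OF refl])
      fix x assume "x \<in> space (Leb N)"
      moreover obtain C where "C \<subseteq> \<Omega>" "\<forall>x\<in>Rspace N - C. pderiv_at i (\<lambda>x. \<psi> x * f x) x = 0"
        using Cc_infE[OF Cc_inf_pderiv[OF m i]] by blast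
      ultimately show "indicator \<Omega> x * pderiv_at i (\<lambda>x. \<psi> x * f x) x = pderiv_at i (\<lambda>x. \<psi> x * f x) x"
        unfolding space_Leb by (cases "x \<in> \<Omega>") auto
    qed
    also have "\<dots> = 0" by (rule integral_pderiv_zero[OF Cc_inf_mono[OF m sub] i])
    finally show "(\<integral>x. \<psi> x * pderiv_at i f x \<partial>leb N \<Omega>) = - (\<integral>x. pderiv_at i \<psi> x * f x \<partial>leb N \<Omega>)"
      by (rule add_eq_0_iff2[THEN iffD1])
  qed
qed

text \<open>The last claim is the continuity of the multiplication by a fixed cutoff, which carries
  approximations of \<open>u\<close> over to approximations of \<open>\<zeta> u\<close>.\<close>

lemma H1_mult:
  assumes \<Omega>: "openin (Rtop N) \<Omega>" and u: "u \<in> H1 N \<Omega>" and \<zeta>: "smooth N \<zeta>"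
    and B: "\<forall>x\<in>Rspace N. cmod (\<zeta> x) \<le> B \<and> (\<forall>i<N. cmod (pderiv_at i \<zeta> x) \<le> B)"
  shows "(\<lambda>x. \<zeta> x * u x) \<in> H1 N \<Omega>"
    and "i < N \<Longrightarrow> AE x in leb N \<Omega>. weak_deriv N \<Omega> i (\<lambda>x. \<zeta> x * u x) x = \<zeta> x * weak_deriv N \<Omega> i u x + pderiv_at i \<zeta> x * u x"
    and "i < N \<Longrightarrow> sqint (leb N \<Omega>) (\<lambda>x. \<zeta> x * weak_deriv N \<Omega> i u x + pderiv_at i \<zeta> x * u x)"
    and "(H1_norm N \<Omega> (\<lambda>x. \<zeta> x * u x))\<^sup>2 \<le> (2 * real N + 2) * B\<^sup>2 * (H1_norm N \<Omega> u)\<^sup>2"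
proof -
  note us = H1_D(1)[OF u]
  have b: "sqint (leb N \<Omega>) (\<lambda>x. \<zeta> x * f x)" if f: "sqint (leb N \<Omega>) f" for f
    by (rule bounded_mult_sqint[OF f smooth_measurable[OF \<zeta>]]) (use B in blast)
  have b': "sqint (leb N \<Omega>) (\<lambda>x. pderiv_at i \<zeta> x * f x)" if f: "sqint (leb N \<Omega>) f" and i: "i < N" for f i
    by (rule bounded_mult_sqint[OF f smooth_measurable[OF smooth_pderiv[OF \<zeta> i]]]) (use B i in blast)
  show s: "sqint (leb N \<Omega>) (\<lambda>x. \<zeta> x * weak_deriv N \<Omega> i u x + pderiv_at i \<zeta> x * u x)" if i: "i < N" for i
    by (intro sqint_add(1) b b' H1_D(2)[OF u] us i)
  have w: "is_weak_deriv N \<Omega> i (\<lambda>x. \<zeta> x * u x) (\<lambda>x. \<zeta> x * weak_deriv N \<Omega> i u x + pderiv_at i \<zeta> x * u x)" if i: "i < N" for i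
    by (rule is_weak_deriv_mult[OF \<Omega> us H1_D(2,3)[OF u i] \<zeta> i])
  show H: "(\<lambda>x. \<zeta> x * u x) \<in> H1 N \<Omega>"
    by (rule H1_I[where g = "\<lambda>i x. \<zeta> x * weak_deriv N \<Omega> i u x + pderiv_at i \<zeta> x * u x"]) (use b us s w in blast)+
  show AE: "AE x in leb N \<Omega>. weak_deriv N \<Omega> i (\<lambda>x. \<zeta> x * u x) x = \<zeta> x * weak_deriv N \<Omega> i u x + pderiv_at i \<zeta> x * u x"
    if i: "i < N" for i
    by (rule weak_deriv_eq_AE[OF \<Omega> H i s[OF i] w[OF i]])
  define W where "W = (\<integral>x. (cmod (u x))\<^sup>2 \<partial>leb N \<Omega>)"
  define G where "G i = (\<integral>x. (cmod (weak_deriv N \<Omega> i u x))\<^sup>2 \<partial>leb N \<Omega>)" for i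
  have nn: "W \<ge> 0" "\<And>i. G i \<ge> 0" unfolding W_def G_def by auto
  have bd: "(\<integral>x. (cmod (k x * f x))\<^sup>2 \<partial>leb N \<Omega>) \<le> B\<^sup>2 * (\<integral>x. (cmod (f x))\<^sup>2 \<partial>leb N \<Omega>)"
    if f: "sqint (leb N \<Omega>) f" "sqint (leb N \<Omega>) (\<lambda>x. k x * f x)" and k: "\<forall>x\<in>Rspace N. cmod (k x) \<le> B" for k f
  proof -
    have "(\<integral>x. (cmod (k x * f x))\<^sup>2 \<partial>leb N \<Omega>) \<le> (\<integral>x. B\<^sup>2 * (cmod (f x))\<^sup>2 \<partial>leb N \<Omega>)"
    proof (rule integral_mono)
      show "integrable (leb N \<Omega>) (\<lambda>x. B\<^sup>2 * (cmod (f x))\<^sup>2)" using sqint_integrable[OF f(1)] by simp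
      fix x assume "x \<in> space (leb N \<Omega>)"
      then have "cmod (k x) \<le> B" using k unfolding space_leb by blast
      then show "(cmod (k x * f x))\<^sup>2 \<le> B\<^sup>2 * (cmod (f x))\<^sup>2"
        unfolding norm_mult power_mult_distrib by (intro mult_right_mono power_mono) auto
    qed (rule sqint_integrable[OF f(2)])
    then show ?thesis by simp
  qed
  have 1: "(\<integral>x. (cmod (\<zeta> x * u x))\<^sup>2 \<partial>leb N \<Omega>) \<le> B\<^sup>2 * W"
    unfolding W_def using bd[OF us b[OF us]] B by blast
  have 2: "(\<integral>x. (cmod (weak_deriv N \<Omega> i (\<lambda>x. \<zeta> x * u x) x))\<^sup>2 \<partial>leb N \<Omega>) \<le> 2 * B\<^sup>2 * G i + 2 * B\<^sup>2 * W" if i: "i < N" for i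
  proof -
    note gs = H1_D(2)[OF u i]
    have "(\<integral>x. (cmod (weak_deriv N \<Omega> i (\<lambda>x. \<zeta> x * u x) x))\<^sup>2 \<partial>leb N \<Omega>) =
        (\<integral>x. (cmod (\<zeta> x * weak_deriv N \<Omega> i u x + pderiv_at i \<zeta> x * u x))\<^sup>2 \<partial>leb N \<Omega>)"
      by (rule sqint_integral_cong[OF H1_D(2)[OF H i] s[OF i] AE[OF i]])
    also have "\<dots> \<le> 2 * (\<integral>x. (cmod (\<zeta> x * weak_deriv N \<Omega> i u x))\<^sup>2 \<partial>leb N \<Omega>) + 2 * (\<integral>x. (cmod (pderiv_at i \<zeta> x * u x))\<^sup>2 \<partial>leb N \<Omega>)"
      by (intro sqint_add(2) b b' gs us i)
    also have "\<dots> \<le> 2 * (B\<^sup>2 * G i) + 2 * (B\<^sup>2 * W)"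
      unfolding G_def W_def using bd[OF gs b[OF gs]] bd[OF us b'[OF us i]] B i
      by (intro add_mono mult_left_mono) auto
    finally show ?thesis by simp
  qed
  have "(H1_norm N \<Omega> (\<lambda>x. \<zeta> x * u x))\<^sup>2 \<le> B\<^sup>2 * W + (\<Sum>i<N. 2 * B\<^sup>2 * G i + 2 * B\<^sup>2 * W)"
    unfolding H1_norm_def using add_mono[OF 1 sum_mono[of "{..<N}", OF 2]]
    by (subst real_sqrt_pow2) (auto intro!: add_nonneg_nonneg sum_nonneg)
  also have "\<dots> = (2 * real N + 1) * B\<^sup>2 * W + 2 * B\<^sup>2 * (\<Sum>i<N. G i)"
    unfolding sum.distrib sum_distrib_left[symmetric] by (simp add: algebra_simps)
  also have "\<dots> \<le> (2 * real N + 2) * B\<^sup>2 * W + (2 * real N + 2) * B\<^sup>2 * (\<Sum>i<N. G i)"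
    using nn by (intro add_mono mult_right_mono) (auto intro: sum_nonneg)
  also have "\<dots> = (2 * real N + 2) * B\<^sup>2 * (W + (\<Sum>i<N. G i))" by (simp add: algebra_simps)
  also have "W + (\<Sum>i<N. G i) = (H1_norm N \<Omega> u)\<^sup>2"
    unfolding H1_norm_def W_def G_def by (subst real_sqrt_pow2) (auto intro!: add_nonneg_nonneg sum_nonneg)
  finally show "(H1_norm N \<Omega> (\<lambda>x. \<zeta> x * u x))\<^sup>2 \<le> (2 * real N + 2) * B\<^sup>2 * (H1_norm N \<Omega> u)\<^sup>2" .
qed

section \<open>Functions that vanish at the boundary\<close>

lemma H1_norm_nonneg: "H1_norm N \<Omega> u \<ge> 0"
  unfolding H1_norm_def by (auto intro!: add_nonneg_nonneg sum_nonneg)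

lemma H1_norm_sq:
  "(H1_norm N \<Omega> u)\<^sup>2 = (\<integral>x. (cmod (u x))\<^sup>2 \<partial>leb N \<Omega>) + (\<Sum>i<N. \<integral>x. (cmod (weak_deriv N \<Omega> i u x))\<^sup>2 \<partial>leb N \<Omega>)"
  unfolding H1_norm_def by (subst real_sqrt_pow2) (auto intro!: add_nonneg_nonneg sum_nonneg)

lemma L2_le_H1_norm: "(\<integral>x. (cmod (u x))\<^sup>2 \<partial>leb N \<Omega>) \<le> (H1_norm N \<Omega> u)\<^sup>2"
  unfolding H1_norm_sq by (auto intro!: sum_nonneg)

lemma H10_D: "u \<in> H10 N \<Omega> \<Longrightarrow> u \<in> H1 N \<Omega>"
  unfolding H10_def by blast

lemma H10_approx: "u \<in> H10 N \<Omega> \<Longrightarrow> e > 0 \<Longrightarrow> \<exists>\<psi>\<in>Cc_inf N \<Omega>. H1_norm N \<Omega> (\<lambda>x. u x - \<psi> x) < e"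
  unfolding H10_def by blast

lemma H1_norm_zero:
  assumes \<Omega>: "openin (Rtop N) \<Omega>"
  shows "H1_norm N \<Omega> (\<lambda>x. 0) = 0"
proof -
  have "(\<integral>x. (cmod (weak_deriv N \<Omega> i (\<lambda>x. 0) x))\<^sup>2 \<partial>leb N \<Omega>) = 0" if i: "i < N" for i
  proof -
    have H: "(\<lambda>x. 0) \<in> H1 N \<Omega>" by (rule Cc_inf_H1[OF \<Omega> zero_Cc_inf])
    have s: "sqint (leb N \<Omega>) (\<lambda>x. 0)" by (rule Cc_inf_sqint_leb[OF zero_Cc_inf \<Omega>])
    have "is_weak_deriv N \<Omega> i (\<lambda>x. 0) (\<lambda>x. 0)" unfolding is_weak_deriv_def by simp
    from sqint_integral_cong[OF H1_D(2)[OF H i] s weak_deriv_eq_AE[OF \<Omega> H i s this]]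
    show ?thesis by simp
  qed
  then show ?thesis unfolding H1_norm_def by simp
qed

lemma H10_diff_Cc_inf:
  assumes \<Omega>: "openin (Rtop N) \<Omega>" and u: "u \<in> H10 N \<Omega>" and \<psi>: "\<psi> \<in> Cc_inf N \<Omega>"
  shows "(\<lambda>x. u x - \<psi> x) \<in> H10 N \<Omega>"
  unfolding H10_def
proof (intro CollectI conjI allI impI)
  show "(\<lambda>x. u x - \<psi> x) \<in> H1 N \<Omega>" by (rule H1_diff[OF \<Omega> H10_D[OF u] Cc_inf_H1[OF \<Omega> \<psi>]])
  fix e :: real assume "e > 0"
  then obtain f where f: "f \<in> Cc_inf N \<Omega>" "H1_norm N \<Omega> (\<lambda>x. u x - f x) < e" using H10_approx[OF u] by blast
  have "(\<lambda>x. u x - \<psi> x - (f x - \<psi> x)) = (\<lambda>x. u x - f x)" by simp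
  then show "\<exists>f\<in>Cc_inf N \<Omega>. H1_norm N \<Omega> (\<lambda>x. u x - \<psi> x - f x) < e"
    using f(2) by (intro bexI[OF _ Cc_inf_diff[OF f(1) \<psi>]]) (simp only:)
qed

lemma Cc_inf_H10:
  assumes \<Omega>: "openin (Rtop N) \<Omega>" and \<psi>: "\<psi> \<in> Cc_inf N \<Omega>"
  shows "\<psi> \<in> H10 N \<Omega>"
  unfolding H10_def
proof (intro CollectI conjI allI impI)
  show "\<psi> \<in> H1 N \<Omega>" by (rule Cc_inf_H1[OF \<Omega> \<psi>])
  fix e :: real assume "e > 0"
  then show "\<exists>f\<in>Cc_inf N \<Omega>. H1_norm N \<Omega> (\<lambda>x. \<psi> x - f x) < e"
    using H1_norm_zero[OF \<Omega>] by (intro bexI[OF _ \<psi>]) simp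
qed

lemma H10_mult:
  assumes \<Omega>: "openin (Rtop N) \<Omega>" and u: "u \<in> H10 N \<Omega>" and \<zeta>: "smooth N \<zeta>"
    and B: "\<forall>x\<in>Rspace N. cmod (\<zeta> x) \<le> B \<and> (\<forall>i<N. cmod (pderiv_at i \<zeta> x) \<le> B)"
  shows "(\<lambda>x. \<zeta> x * u x) \<in> H10 N \<Omega>"
  unfolding H10_def
proof (intro CollectI conjI allI impI)
  show "(\<lambda>x. \<zeta> x * u x) \<in> H1 N \<Omega>" by (rule H1_mult(1)[OF \<Omega> H10_D[OF u] \<zeta> B])
  fix e :: real assume e: "e > 0"
  define k where "k = (2 * real N + 2) * B\<^sup>2 + 1"
  have k: "k > 0" unfolding k_def by (intro add_nonneg_pos mult_nonneg_nonneg) auto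
  obtain f where f: "f \<in> Cc_inf N \<Omega>" "H1_norm N \<Omega> (\<lambda>x. u x - f x) < e / sqrt k"
    using H10_approx[OF u, of "e / sqrt k"] e k by auto
  have "(H1_norm N \<Omega> (\<lambda>x. \<zeta> x * (u x - f x)))\<^sup>2 \<le> (2 * real N + 2) * B\<^sup>2 * (H1_norm N \<Omega> (\<lambda>x. u x - f x))\<^sup>2"
    by (rule H1_mult(4)[OF \<Omega> H1_diff[OF \<Omega> H10_D[OF u] Cc_inf_H1[OF \<Omega> f(1)]] \<zeta> B])
  also have "\<dots> \<le> k * (H1_norm N \<Omega> (\<lambda>x. u x - f x))\<^sup>2"
    unfolding k_def by (intro mult_right_mono) auto
  also have "\<dots> < k * (e / sqrt k)\<^sup>2"
    using f(2) H1_norm_nonneg k by (intro mult_strict_left_mono power_strict_mono) auto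
  also have "\<dots> = e\<^sup>2" using k by (simp add: power_divide)
  finally have "H1_norm N \<Omega> (\<lambda>x. \<zeta> x * (u x - f x)) < e"
    using e by (auto dest: power_less_imp_less_base)
  moreover have "(\<lambda>x. \<zeta> x * (u x - f x)) = (\<lambda>x. \<zeta> x * u x - \<zeta> x * f x)" by (simp add: algebra_simps)
  ultimately show "\<exists>f\<in>Cc_inf N \<Omega>. H1_norm N \<Omega> (\<lambda>x. \<zeta> x * u x - f x) < e"
    by (intro bexI[OF _ Cc_inf_mult[OF \<zeta> f(1)]]) (simp only:)
qed

lemma sqint_leb_subset:
  assumes "openin (Rtop N) \<Omega>" "openin (Rtop N) \<Omega>'" "\<Omega>' \<subseteq> \<Omega>" "sqint (leb N \<Omega>) f"
  shows "sqint (leb N \<Omega>') f"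
    and "(\<integral>x. (cmod (f x))\<^sup>2 \<partial>leb N \<Omega>') \<le> (\<integral>x. (cmod (f x))\<^sup>2 \<partial>leb N \<Omega>)"
proof -
  note s = assms(4)[unfolded sqint_leb[OF assms(1)]]
  have eq: "indicator \<Omega>' x * f x = indicator \<Omega>' x * (indicator \<Omega> x * f x)" for x
    using assms(3) by (auto simp: indicator_def)
  show s': "sqint (leb N \<Omega>') f"
    unfolding sqint_leb[OF assms(2)]
  proof (rule sqint_bound[OF s, of _ 1])
    show "(\<lambda>x. indicator \<Omega>' x * f x) \<in> borel_measurable (Leb N)"
      unfolding eq using sqint_measurable[OF s] openin_sets_Leb[OF assms(2)] by measurable
  qed (use assms(3) in \<open>auto simp: indicator_def\<close>)
  have conv: "(\<integral>x. (cmod (f x))\<^sup>2 \<partial>leb N A) = (\<integral>x. (cmod (indicator A x * f x))\<^sup>2 \<partial>Leb N)" if "openin (Rtop N) A" for A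
    unfolding leb_def integral_restrict_space[OF sets_Leb_Int[OF that]]
    by (intro Bochner_Integration.integral_cong) (auto simp: indicator_def)
  show "(\<integral>x. (cmod (f x))\<^sup>2 \<partial>leb N \<Omega>') \<le> (\<integral>x. (cmod (f x))\<^sup>2 \<partial>leb N \<Omega>)"
    unfolding conv[OF assms(1)] conv[OF assms(2)]
    using sqint_integrable[OF s] sqint_integrable[OF s'[unfolded sqint_leb[OF assms(2)]]] assms(3)
    by (intro integral_mono) (auto simp: indicator_def)
qed

lemma Cc_inf_deriv_bound:
  assumes \<zeta>: "\<zeta> \<in> Cc_inf N A"
  shows "\<exists>B>0. \<forall>x\<in>Rspace N. cmod (\<zeta> x) \<le> B \<and> (\<forall>i<N. cmod (pderiv_at i \<zeta> x) \<le> B)"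
proof -
  obtain B where B: "B > 0" "\<forall>x\<in>Rspace N. cmod (\<zeta> x) \<le> B" using Cc_inf_bounded[OF \<zeta>] by blast
  have "\<forall>i. \<exists>C. i < N \<longrightarrow> C > 0 \<and> (\<forall>x\<in>Rspace N. cmod (pderiv_at i \<zeta> x) \<le> C)"
    using Cc_inf_bounded[OF Cc_inf_pderiv[OF \<zeta>]] by blast
  then obtain C where C: "\<forall>i. i < N \<longrightarrow> C i > 0 \<and> (\<forall>x\<in>Rspace N. cmod (pderiv_at i \<zeta> x) \<le> C i)" by metis
  have le: "C i \<le> sum C {..<N}" if "i < N" for i
    using C that by (intro member_le_sum) (auto intro: less_imp_le)
  have "sum C {..<N} \<ge> 0" using C by (intro sum_nonneg) (auto intro: less_imp_le)
  then show ?thesis using B C le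
    by (intro exI[of _ "B + sum C {..<N}"] conjI ballI allI impI) (fastforce intro: order_trans add_increasing)+
qed

lemma compactin_closedin: "compactin (Rtop N) K \<Longrightarrow> closedin (Rtop N) K"
  by (rule compactin_imp_closedin) (simp_all add: Hausdorff_space_product_topology)

lemma openin_minus_compact: "openin (Rtop N) \<Omega> \<Longrightarrow> compactin (Rtop N) K \<Longrightarrow> openin (Rtop N) (\<Omega> - K)"
  by (rule openin_diff[OF _ compactin_closedin])

lemma Linf_norm_le_AE:
  assumes "G \<in> Linf N A" "Linf_norm N A G \<le> ennreal c" "c \<ge> 0"
  shows "AE x in leb N A. cmod (G x) \<le> c"
proof -
  have [measurable]: "G \<in> borel_measurable (leb N A)" using assms(1) unfolding Linf_def by auto
  have "AE x in leb N A. ennreal (cmod (G x)) \<le> Linf_norm N A G"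
    unfolding Linf_norm_def by (rule esssup_AE) measurable
  then show ?thesis
  proof eventually_elim
    case (elim x)
    then have "ennreal (cmod (G x)) \<le> ennreal c" using assms(2) order_trans by blast
    then show ?case using assms(3) by (simp add: ennreal_le_iff)
  qed
qed

lemma Linf_AE_bound:
  assumes G: "G \<in> Linf N A"
  shows "\<exists>c. AE x in leb N A. cmod (G x) \<le> c"
proof -
  have "Linf_norm N A G \<le> ennreal (enn2real (Linf_norm N A G))"
    using G unfolding Linf_def by simp
  from Linf_norm_le_AE[OF G this] show ?thesis by auto
qed

lemma Linf_mult_sqint:
  assumes G: "G \<in> Linf N A" and f: "sqint (leb N A) f"
  shows "sqint (leb N A) (\<lambda>x. G x * f x)"
proof -
  obtain c where c: "AE x in leb N A. cmod (G x) \<le> c" using Linf_AE_bound[OF G] by blast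
  show ?thesis
  proof (rule sqint_bound[OF f, of _ c])
    show "(\<lambda>x. G x * f x) \<in> borel_measurable (leb N A)"
      using G sqint_measurable[OF f] unfolding Linf_def by (intro borel_measurable_times) auto
    show "AE x in leb N A. cmod (G x * f x) \<le> c * cmod (f x)"
      using c by eventually_elim (simp add: norm_mult mult_right_mono)
  qed
qed

text \<open>The functional \<open>F\<close> is given by \<open>G\<close> on smooth test functions off \<open>K\<close> only, while \<open>\<zeta> u\<close> is not smooth.
  If \<open>f\<close> is a test function on \<open>\<Omega>\<close> close to \<open>u\<close>, then \<open>\<zeta> f\<close> is one off \<open>K\<close>, and both sides are
  continuous in \<open>f\<close>: the left one since \<open>F\<close> is bounded, the right one since \<open>G\<close> times \<open>\<zeta>\<close> is square
  integrable.\<close>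

lemma dirichlet_rep_cutoff:
  assumes \<Omega>: "openin (Rtop N) \<Omega>" and K: "compactin (Rtop N) K" and u: "u \<in> H10 N \<Omega>"
    and F: "F \<in> dual N \<Omega> (H10 N \<Omega>)" and G: "dirichlet_rep_off N \<Omega> K F G"
    and \<zeta>: "\<zeta> \<in> Cc_inf N (Rspace N)" and V: "openin (Rtop N) V" "K \<subseteq> V" "\<forall>x\<in>V. \<zeta> x = 0"
  shows "F (\<lambda>x. \<zeta> x * u x) = pairing N (\<Omega> - K) G (\<lambda>x. \<zeta> x * u x)"
proof -
  note sm = Cc_inf_smooth[OF \<zeta>]
  note \<Omega>K = openin_minus_compact[OF \<Omega> K]
  obtain B where B: "B > 0" "\<forall>x\<in>Rspace N. cmod (\<zeta> x) \<le> B \<and> (\<forall>i<N. cmod (pderiv_at i \<zeta> x) \<le> B)"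
    using Cc_inf_deriv_bound[OF \<zeta>] by blast
  obtain C where C: "\<forall>v\<in>H10 N \<Omega>. \<bar>F v\<bar> \<le> C * H1_norm N \<Omega> v"
    and add: "\<forall>v\<in>H10 N \<Omega>. \<forall>w\<in>H10 N \<Omega>. F (\<lambda>x. v x + w x) = F v + F w"
    using F unfolding dual_def by blast
  have GL: "G \<in> Linf N (\<Omega> - K)" and rep: "\<forall>v\<in>Cc_inf N (\<Omega> - K). F v = pairing N (\<Omega> - K) G v"
    using G unfolding dirichlet_rep_off_def by blast+
  let ?M = "leb N (\<Omega> - K)"
  have Gz: "sqint ?M (\<lambda>x. G x * cnj (\<zeta> x))"
    by (intro Linf_mult_sqint[OF GL] sqint_cnj Cc_inf_sqint_leb[OF \<zeta> \<Omega>K])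
  define D where "D = (\<integral>x. (cmod (G x * cnj (\<zeta> x)))\<^sup>2 \<partial>?M)"
  define E where "E = \<bar>C\<bar> * sqrt ((2 * real N + 2) * B\<^sup>2) + D / 2 + 1 / 2"
  have us: "sqint ?M u" using sqint_leb_subset(1)[OF \<Omega> \<Omega>K _ H1_D(1)[OF H10_D[OF u]]] by blast
  have le: "\<bar>F (\<lambda>x. \<zeta> x * u x) - pairing N (\<Omega> - K) G (\<lambda>x. \<zeta> x * u x)\<bar> \<le> e * E" if e: "e > 0" for e
  proof -
    obtain f where f: "f \<in> Cc_inf N \<Omega>" "H1_norm N \<Omega> (\<lambda>x. u x - f x) < e" using H10_approx[OF u e] by blast
    let ?d = "\<lambda>x. u x - f x"
    have d: "?d \<in> H10 N \<Omega>" by (rule H10_diff_Cc_inf[OF \<Omega> u f(1)])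
    have zf: "(\<lambda>x. \<zeta> x * f x) \<in> Cc_inf N (\<Omega> - K)" by (rule Cc_inf_mult_off[OF sm f(1) V(1,2)]) (use V(3) in blast)
    have zf': "(\<lambda>x. \<zeta> x * f x) \<in> H10 N \<Omega>" by (rule Cc_inf_H10[OF \<Omega> Cc_inf_mult[OF sm f(1)]])
    have zd: "(\<lambda>x. \<zeta> x * ?d x) \<in> H10 N \<Omega>" by (rule H10_mult[OF \<Omega> d sm B(2)])
    have "F (\<lambda>x. \<zeta> x * u x) = F (\<lambda>x. \<zeta> x * ?d x + \<zeta> x * f x)" by (simp add: algebra_simps)
    also have "\<dots> = F (\<lambda>x. \<zeta> x * ?d x) + F (\<lambda>x. \<zeta> x * f x)" by (rule add[rule_format, OF zd zf'])
    also have "F (\<lambda>x. \<zeta> x * f x) = pairing N (\<Omega> - K) G (\<lambda>x. \<zeta> x * f x)" using rep zf by blast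
    finally have 1: "F (\<lambda>x. \<zeta> x * u x) = F (\<lambda>x. \<zeta> x * ?d x) + pairing N (\<Omega> - K) G (\<lambda>x. \<zeta> x * f x)" .
    have ds: "sqint ?M ?d" by (rule sqint_diff(1)[OF us Cc_inf_sqint_leb[OF f(1) \<Omega>K]])
    have "pairing N (\<Omega> - K) G (\<lambda>x. \<zeta> x * u x) - pairing N (\<Omega> - K) G (\<lambda>x. \<zeta> x * f x) =
        Re ((\<integral>x. (G x * cnj (\<zeta> x)) * cnj (u x) \<partial>?M) - (\<integral>x. (G x * cnj (\<zeta> x)) * cnj (f x) \<partial>?M))"
      unfolding pairing_def by (simp add: mult_ac)
    also have "(\<integral>x. (G x * cnj (\<zeta> x)) * cnj (u x) \<partial>?M) - (\<integral>x. (G x * cnj (\<zeta> x)) * cnj (f x) \<partial>?M) =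
        (\<integral>x. (G x * cnj (\<zeta> x)) * cnj (?d x) \<partial>?M)"
      unfolding complex_cnj_diff right_diff_distrib
      by (intro Bochner_Integration.integral_diff[symmetric] sqint_mult_integrable Gz sqint_cnj us Cc_inf_sqint_leb[OF f(1) \<Omega>K])
    finally have 2: "\<bar>pairing N (\<Omega> - K) G (\<lambda>x. \<zeta> x * u x) - pairing N (\<Omega> - K) G (\<lambda>x. \<zeta> x * f x)\<bar> \<le>
        cmod (\<integral>x. (G x * cnj (\<zeta> x)) * cnj (?d x) \<partial>?M)" by (simp add: abs_Re_le_cmod)
    also have "\<dots> \<le> e / 2 * D + 1 / (2 * e) * (\<integral>x. (cmod (cnj (?d x)))\<^sup>2 \<partial>?M)"
      unfolding D_def by (rule young_integral[OF Gz sqint_cnj[OF ds] e])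
    also have "\<dots> \<le> e / 2 * D + 1 / (2 * e) * e\<^sup>2"
    proof (intro add_left_mono mult_left_mono)
      show "(\<integral>x. (cmod (cnj (?d x)))\<^sup>2 \<partial>?M) \<le> e\<^sup>2"
      proof -
        have "(\<integral>x. (cmod (cnj (?d x)))\<^sup>2 \<partial>?M) \<le> (\<integral>x. (cmod (?d x))\<^sup>2 \<partial>leb N \<Omega>)"
          unfolding complex_mod_cnj using sqint_leb_subset(2)[OF \<Omega> \<Omega>K _ H1_D(1)[OF H10_D[OF d]]] by blast
        also have "\<dots> \<le> (H1_norm N \<Omega> ?d)\<^sup>2" by (rule L2_le_H1_norm)
        also have "\<dots> \<le> e\<^sup>2" using f(2) H1_norm_nonneg by (intro power_mono) auto
        finally show ?thesis .
      qed
    qed (use e in simp)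
    finally have 3: "\<bar>pairing N (\<Omega> - K) G (\<lambda>x. \<zeta> x * u x) - pairing N (\<Omega> - K) G (\<lambda>x. \<zeta> x * f x)\<bar> \<le> e / 2 * D + e / 2"
      using e by (simp add: power2_eq_square)
    have "\<bar>F (\<lambda>x. \<zeta> x * ?d x)\<bar> \<le> \<bar>C\<bar> * H1_norm N \<Omega> (\<lambda>x. \<zeta> x * ?d x)"
      using C zd H1_norm_nonneg[of N \<Omega> "\<lambda>x. \<zeta> x * ?d x"] by (meson abs_ge_self mult_right_mono order_trans)
    also have "\<dots> \<le> \<bar>C\<bar> * (sqrt ((2 * real N + 2) * B\<^sup>2) * e)"
    proof (intro mult_left_mono)
      have "(H1_norm N \<Omega> (\<lambda>x. \<zeta> x * ?d x))\<^sup>2 \<le> (2 * real N + 2) * B\<^sup>2 * (H1_norm N \<Omega> ?d)\<^sup>2"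
        by (rule H1_mult(4)[OF \<Omega> H10_D[OF d] sm B(2)])
      also have "\<dots> \<le> (2 * real N + 2) * B\<^sup>2 * e\<^sup>2"
        using f(2) H1_norm_nonneg by (intro mult_left_mono power_mono) auto
      also have "\<dots> = (sqrt ((2 * real N + 2) * B\<^sup>2) * e)\<^sup>2" by (simp add: power_mult_distrib)
      finally show "H1_norm N \<Omega> (\<lambda>x. \<zeta> x * ?d x) \<le> sqrt ((2 * real N + 2) * B\<^sup>2) * e"
        by (rule power2_le_imp_le) (use e in auto)
    qed simp
    finally have 4: "\<bar>F (\<lambda>x. \<zeta> x * ?d x)\<bar> \<le> \<bar>C\<bar> * (sqrt ((2 * real N + 2) * B\<^sup>2) * e)" .
    have "e * E = \<bar>C\<bar> * (sqrt ((2 * real N + 2) * B\<^sup>2) * e) + (e / 2 * D + e / 2)"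
      unfolding E_def by (simp add: algebra_simps)
    then show ?thesis using 1 3 4 by linarith
  qed
  have E0: "E > 0" unfolding E_def D_def by (intro add_nonneg_pos add_nonneg_nonneg mult_nonneg_nonneg) auto
  have "\<bar>F (\<lambda>x. \<zeta> x * u x) - pairing N (\<Omega> - K) G (\<lambda>x. \<zeta> x * u x)\<bar> \<le> 0"
  proof (rule field_le_epsilon)
    fix e :: real assume "e > 0"
    then show "\<bar>F (\<lambda>x. \<zeta> x * u x) - pairing N (\<Omega> - K) G (\<lambda>x. \<zeta> x * u x)\<bar> \<le> 0 + e"
      using le[of "e / E"] E0 by simp
  qed
  then show ?thesis by simp
qed

section \<open>The direction in which the coefficients are coercive\<close>

text \<open>The distance of the origin to the triangle with vertices \<open>1\<close>, \<open>a\<close> and \<open>b\<close>, the coefficients of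
  the equation.\<close>

definition coercivity :: "complex \<Rightarrow> complex \<Rightarrow> real" where
  "coercivity a b = norm (closest_point (convex hull {1, a, b}) 0)"

lemma hull3: "closed (convex hull {1, a, b :: complex})" "convex (convex hull {1, a, b})"
  "convex hull {1, a, b} \<noteq> {}" "1 \<in> convex hull {1, a, b}" "a \<in> convex hull {1, a, b}" "b \<in> convex hull {1, a, b}"
  by (auto simp: finite_imp_compact_convex_hull compact_imp_closed intro!: hull_inc)

text \<open>A convex combination of \<open>1\<close>, \<open>a\<close> and \<open>b\<close> that is zero is excluded by its real and imaginary
  parts.  If \<open>a\<close> and \<open>b\<close> lie in the same closed half plane, only those of them that are real can
  occur, and these are positive.  If they lie on opposite sides, the segment between them crosses the real
  axis, and the condition on the pair says that it does so on the positive half line.\<close>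

lemma zero_notin_hull:
  assumes "admissible_pair a b"
  shows "0 \<notin> convex hull {1, a, b}"
proof
  assume "0 \<in> convex hull {1, a, b}"
  then obtain s t r :: real where str: "0 \<le> s" "0 \<le> t" "0 \<le> r" "s + t + r = 1" "0 = s *\<^sub>R 1 + t *\<^sub>R a + r *\<^sub>R b"
    unfolding convex_hull_3 by blast
  have re: "s + t * Re a + r * Re b = 0" and im: "t * Im a + r * Im b = 0"
    using arg_cong[OF str(5), of Re] arg_cong[OF str(5), of Im] by auto
  have a: "Im a \<noteq> 0 \<or> Re a > 0" and b: "Im b \<noteq> 0 \<or> Re b > 0"
    using assms unfolding admissible_pair_def slit_plane_def by auto
  consider "Im a * Im b \<ge> 0" | "Im a * Im b < 0" "Re b > Im b / Im a * Re a"
    using assms unfolding admissible_pair_def by blast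
  then show False
  proof cases
    case 1
    have "(t * Im a) * (r * Im b) \<ge> 0"
      using mult_nonneg_nonneg[OF mult_nonneg_nonneg[OF str(2,3)] 1] by (simp add: mult_ac)
    moreover have "r * Im b = - (t * Im a)" using im by simp
    ultimately have "(t * Im a)\<^sup>2 \<le> 0" by (simp add: power2_eq_square)
    then have z: "t * Im a = 0" "r * Im b = 0" using im by auto
    have "t * Re a \<ge> 0" using a z(1) str(2) by (cases "t = 0") auto
    moreover have "r * Re b \<ge> 0" using b z(2) str(3) by (cases "r = 0") auto
    ultimately have "s = 0" "t * Re a = 0" "r * Re b = 0" using re str(1) by linarith+
    then have "t = 0" "r = 0" using a b z by auto
    then show False using \<open>s = 0\<close> str(4) by simp
  next
    case 2
    have Ia: "Im a \<noteq> 0" using 2(1) by auto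
    \<comment> \<open>D / Im a is a positive multiple of the point where the segment from a to b meets the real axis.\<close>
    define D where "D = Re b * Im a - Im b * Re a"
    have "Im a * (s + t * Re a + r * Re b) - Re a * (t * Im a + r * Im b) = s * Im a + r * D"
      unfolding D_def by (simp add: algebra_simps)
    then have e: "s * Im a + r * D = 0" using re im by simp
    have "Im a * D > 0"
    proof -
      have "(Im a)\<^sup>2 * (Re b - Im b / Im a * Re a) > 0" using 2(2) Ia by (intro mult_pos_pos) auto
      also have "(Im a)\<^sup>2 * (Re b - Im b / Im a * Re a) = Im a * D"
        unfolding D_def using Ia by (simp add: field_simps power2_eq_square)
      finally show ?thesis .
    qed
    moreover have "s * (Im a)\<^sup>2 + r * (Im a * D) = 0"
      using arg_cong[OF e, of "\<lambda>x. Im a * x"] by (simp add: algebra_simps power2_eq_square)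
    moreover have "s * (Im a)\<^sup>2 \<ge> 0" "r * (Im a * D) \<ge> 0"
      using str \<open>Im a * D > 0\<close> by (auto intro!: mult_nonneg_nonneg)
    ultimately have "s * (Im a)\<^sup>2 = 0" "r * (Im a * D) = 0" by linarith+
    then have "s = 0" "r = 0" using Ia \<open>Im a * D > 0\<close> by auto
    then have "t = 0" using im Ia by simp
    then show False using str(4) \<open>s = 0\<close> \<open>r = 0\<close> by simp
  qed
qed

lemma coercivity_pos: "admissible_pair a b \<Longrightarrow> coercivity a b > 0"
  unfolding coercivity_def using closest_point_in_set[OF hull3(1,3)] zero_notin_hull by (metis zero_less_norm_iff)

lemma coercivity_le_1: "coercivity a b \<le> 1"
proof -
  have "dist 0 (closest_point (convex hull {1, a, b}) 0) \<le> dist 0 (1 :: complex)"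
    using hull3(1,4) by (rule closest_point_le)
  then show ?thesis unfolding coercivity_def by simp
qed

text \<open>The direction \<open>l\<close> points to the point of the triangle that is closest to the origin: the
  triangle lies in the half plane beyond the perpendicular through that point.\<close>

lemma coercive_direction:
  assumes "admissible_pair a b"
  shows "\<exists>l. cmod l = 1 \<and> (\<forall>z\<in>{1, a, b}. coercivity a b \<le> Re (z * cnj l))"
proof -
  define z where "z = closest_point (convex hull {1, a, b}) 0"
  have pos: "cmod z > 0" using coercivity_pos[OF assms] unfolding coercivity_def z_def .
  have "cmod z \<le> Re (x * cnj (z /\<^sub>R cmod z))" if "x \<in> convex hull {1, a, b}" for x
  proof -
    have "inner (0 - z) (x - z) \<le> 0"
      unfolding z_def by (rule closest_point_dot[OF hull3(2,1) that])
    then have "inner z z \<le> inner z x" by (simp add: inner_diff_right)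
    then have "(cmod z)\<^sup>2 \<le> Re (x * cnj z)"
      by (simp add: inner_complex_def power2_norm_eq_inner mult.commute)
    then have "cmod z \<le> Re (x * cnj z) / cmod z" using pos by (simp add: field_simps power2_eq_square)
    then show ?thesis by (simp add: field_simps scaleR_conv_of_real)
  qed
  moreover have "cmod (z /\<^sub>R cmod z) = 1" using pos by simp
  ultimately show ?thesis
    using hull3(4-6) unfolding coercivity_def z_def[symmetric] by (intro exI[of _ "z /\<^sub>R cmod z"]) blast
qed

text \<open>The convex combination that is closest to the origin for one pair is a competitor for the
  other one.\<close>

lemma coercivity_Lipschitz: "coercivity a' b' \<le> coercivity a b + (cmod (a - a') + cmod (b - b'))"
proof -
  let ?z = "closest_point (convex hull {1, a, b}) 0"
  have "?z \<in> convex hull {1, a, b}" by (rule closest_point_in_set[OF hull3(1,3)])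
  then obtain s t r :: real where str: "0 \<le> s" "0 \<le> t" "0 \<le> r" "s + t + r = 1" "?z = s *\<^sub>R 1 + t *\<^sub>R a + r *\<^sub>R b"
    unfolding convex_hull_3 by blast
  let ?w = "s *\<^sub>R 1 + t *\<^sub>R a' + r *\<^sub>R b'"
  have "?w \<in> convex hull {1, a', b'}" unfolding convex_hull_3 using str(1-4) by blast
  then have "dist 0 (closest_point (convex hull {1, a', b'}) 0) \<le> dist 0 ?w" by (rule closest_point_le[OF hull3(1)])
  then have "coercivity a' b' \<le> cmod ?w" unfolding coercivity_def by simp
  also have "?w = ?z - (t *\<^sub>R (a - a') + r *\<^sub>R (b - b'))" unfolding str(5) by (simp add: algebra_simps)
  also have "cmod \<dots> \<le> cmod ?z + cmod (t *\<^sub>R (a - a') + r *\<^sub>R (b - b'))" by (rule norm_triangle_ineq4)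
  also have "cmod (t *\<^sub>R (a - a') + r *\<^sub>R (b - b')) \<le> t * cmod (a - a') + r * cmod (b - b')"
    using norm_triangle_ineq[of "t *\<^sub>R (a - a')" "r *\<^sub>R (b - b')"] str(2,3) by simp
  also have "\<dots> \<le> 1 * cmod (a - a') + 1 * cmod (b - b')"
    using str(1-4) by (intro add_mono mult_right_mono) auto
  finally show ?thesis unfolding coercivity_def by simp
qed

lemma continuous_on_coercivity: "continuous_on A (\<lambda>(a, b). coercivity a b)"
proof (rule continuous_on_subset[of UNIV])
  show "continuous_on UNIV (\<lambda>(a, b). coercivity a b)"
    unfolding continuous_on_def
  proof
    fix p :: "complex \<times> complex"
    obtain a b where p: "p = (a, b)" by (cases p)
    have "((\<lambda>q. cmod (fst q - a) + cmod (snd q - b)) \<longlongrightarrow> cmod (a - a) + cmod (b - b)) (at p)"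
      unfolding p by (intro tendsto_intros tendsto_fst tendsto_snd) (auto intro!: tendsto_eq_intros)
    then have lim: "((\<lambda>q. cmod (fst q - a) + cmod (snd q - b)) \<longlongrightarrow> 0) (at p)" by simp
    have "((\<lambda>q. (case q of (a, b) \<Rightarrow> coercivity a b) - coercivity a b) \<longlongrightarrow> 0) (at p)"
    proof (rule Lim_null_comparison[OF always_eventually lim], rule allI)
      fix q :: "complex \<times> complex"
      show "norm ((case q of (a, b) \<Rightarrow> coercivity a b) - coercivity a b) \<le> cmod (fst q - a) + cmod (snd q - b)"
        using coercivity_Lipschitz[of "fst q" "snd q" a b] coercivity_Lipschitz[of a b "fst q" "snd q"]
        by (auto simp: case_prod_beta norm_minus_commute abs_le_iff)
    qed
    then show "((\<lambda>(a, b). coercivity a b) \<longlongrightarrow> (case p of (a, b) \<Rightarrow> coercivity a b)) (at p within UNIV)"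
      using LIM_zero_cancel unfolding p by fastforce
  qed
qed simp

section \<open>The energy inequality on cutoffs\<close>

lemma leb_subset_integral:
  fixes f :: "pt \<Rightarrow> real"
  assumes "openin (Rtop N) \<Omega>" "openin (Rtop N) \<Omega>'" "\<Omega>' \<subseteq> \<Omega>" "integrable (leb N \<Omega>) f" "\<And>x. f x \<ge> 0"
  shows "integrable (leb N \<Omega>') f" and "(\<integral>x. f x \<partial>leb N \<Omega>') \<le> (\<integral>x. f x \<partial>leb N \<Omega>)"
proof -
  have i: "integrable (Leb N) (\<lambda>x. indicator \<Omega> x *\<^sub>R f x)"
    using assms(4) unfolding leb_def integrable_restrict_space[OF sets_Leb_Int[OF assms(1)]] .
  have eq: "indicator \<Omega>' x *\<^sub>R f x = indicator \<Omega>' x *\<^sub>R (indicator \<Omega> x *\<^sub>R f x)" for x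
    using assms(3) by (auto simp: indicator_def)
  have i': "integrable (Leb N) (\<lambda>x. indicator \<Omega>' x *\<^sub>R f x)"
    unfolding eq by (rule integrable_mult_indicator[OF openin_sets_Leb[OF assms(2)] i])
  then show "integrable (leb N \<Omega>') f"
    unfolding leb_def integrable_restrict_space[OF sets_Leb_Int[OF assms(2)]] .
  show "(\<integral>x. f x \<partial>leb N \<Omega>') \<le> (\<integral>x. f x \<partial>leb N \<Omega>)"
    unfolding leb_def integral_restrict_space[OF sets_Leb_Int[OF assms(1)]] integral_restrict_space[OF sets_Leb_Int[OF assms(2)]]
    by (rule integral_mono[OF i' i]) (use assms(3,5) in \<open>auto simp: indicator_def\<close>)
qed

text \<open>The product rule for the gradient of \<open>l \<eta>\<^sup>2 u\<close> at a point, where \<open>\<eta>\<close> has the value \<open>e\<close> and the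
  partial derivative \<open>r\<close>, and \<open>g\<close> is the partial derivative of \<open>u\<close>.  The mixed term is absorbed by half
  of the coercive one.\<close>

lemma energy_pointwise:
  fixes g u l :: complex and e r m :: real
  assumes m: "m > 0" and l: "cmod l = 1" "m \<le> Re (cnj l)"
  shows "m / 2 * (e\<^sup>2 * (cmod g)\<^sup>2) - 2 / m * (r\<^sup>2 * (cmod u)\<^sup>2)
    \<le> Re (g * cnj (l * complex_of_real (e\<^sup>2) * g + l * complex_of_real (2 * e * r) * u))"
proof -
  have gg: "g * cnj g = complex_of_real ((cmod g)\<^sup>2)" by (rule complex_norm_square[symmetric])
  have "g * cnj (l * complex_of_real (e\<^sup>2) * g + l * complex_of_real (2 * e * r) * u) =
      cnj l * complex_of_real (e\<^sup>2) * (g * cnj g) + complex_of_real (2 * e * r) * (cnj l * g * cnj u)"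
    by (simp add: algebra_simps)
  also have "\<dots> = complex_of_real (e\<^sup>2 * (cmod g)\<^sup>2) * cnj l + complex_of_real (2 * e * r) * (cnj l * g * cnj u)"
    unfolding gg by (simp add: algebra_simps)
  finally have "Re (g * cnj (l * complex_of_real (e\<^sup>2) * g + l * complex_of_real (2 * e * r) * u)) =
      (e\<^sup>2 * (cmod g)\<^sup>2) * Re (cnj l) + 2 * e * r * Re (cnj l * g * cnj u)" by simp
  moreover have "(e\<^sup>2 * (cmod g)\<^sup>2) * Re (cnj l) \<ge> (e\<^sup>2 * (cmod g)\<^sup>2) * m" using l(2) by (intro mult_left_mono) auto
  moreover have "\<bar>2 * e * r * Re (cnj l * g * cnj u)\<bar> \<le> m / 2 * (e\<^sup>2 * (cmod g)\<^sup>2) + 2 / m * (r\<^sup>2 * (cmod u)\<^sup>2)"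
  proof -
    have "\<bar>Re (cnj l * g * cnj u)\<bar> \<le> cmod g * cmod u"
      using abs_Re_le_cmod[of "cnj l * g * cnj u"] l(1) by (simp add: norm_mult)
    then have "\<bar>2 * e * r * Re (cnj l * g * cnj u)\<bar> \<le> 2 * \<bar>e\<bar> * \<bar>r\<bar> * (cmod g * cmod u)"
      unfolding abs_mult abs_numeral by (intro mult_left_mono) auto
    also have "\<dots> = 2 * ((\<bar>e\<bar> * cmod g) * (\<bar>r\<bar> * cmod u))" by simp
    also have "\<dots> \<le> 2 * ((m / 2) / 2 * (\<bar>e\<bar> * cmod g)\<^sup>2 + 1 / (2 * (m / 2)) * (\<bar>r\<bar> * cmod u)\<^sup>2)"
      using m by (intro mult_left_mono young_ineq) auto
    also have "\<dots> = m / 2 * (e\<^sup>2 * (cmod g)\<^sup>2) + 2 / m * (r\<^sup>2 * (cmod u)\<^sup>2)"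
      by (simp add: power_mult_distrib)
    finally show ?thesis .
  qed
  ultimately show ?thesis by (simp add: algebra_simps abs_le_iff)
qed

text \<open>The extension of \<open>\<zeta> u\<close> by zero has the weak derivatives on the whole space that the Nash type
  inequality asks for.\<close>

lemma weak_deriv_extend:
  assumes \<Omega>: "openin (Rtop N) \<Omega>" and u: "u \<in> H1 N \<Omega>" and \<zeta>: "\<zeta> \<in> Cc_inf N \<Omega>" and i: "i < N"
    and f: "f \<in> Cc_inf N (Rspace N)"
  shows "(\<integral>x. indicator \<Omega> x * (\<zeta> x * u x) * pderiv_at i f x \<partial>Leb N) =
    - (\<integral>x. indicator \<Omega> x * (\<zeta> x * weak_deriv N \<Omega> i u x + pderiv_at i \<zeta> x * u x) * f x \<partial>Leb N)"
proof -
  note fs = Cc_inf_smooth[OF f]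
  have 1: "(\<lambda>x. \<zeta> x * f x) \<in> Cc_inf N \<Omega>" and 2: "(\<lambda>x. pderiv_at i \<zeta> x * f x) \<in> Cc_inf N \<Omega>"
    using Cc_inf_mult[OF fs \<zeta>] Cc_inf_mult[OF fs Cc_inf_pderiv[OF \<zeta> i]] by (simp_all only: mult.commute)
  show ?thesis
    using weak_product_rule[OF \<Omega> H1_D(1)[OF u] H1_D(2,3)[OF u i] Cc_inf_smooth[OF \<zeta>] fs i 1 2]
    unfolding integral_leb[OF \<Omega>] by (simp only: mult.assoc)
qed

lemma leb_extend:
  fixes f :: "pt \<Rightarrow> complex"
  assumes \<Omega>: "openin (Rtop N) \<Omega>"
  shows "(\<integral>x. (cmod (indicator \<Omega> x * f x))\<^sup>2 \<partial>Leb N) = (\<integral>x. (cmod (f x))\<^sup>2 \<partial>leb N \<Omega>)"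
    and "(\<integral>x. cmod (indicator \<Omega> x * f x) \<partial>Leb N) = (\<integral>x. cmod (f x) \<partial>leb N \<Omega>)"
    and "integrable (leb N \<Omega>) f \<Longrightarrow> integrable (Leb N) (\<lambda>x. indicator \<Omega> x * f x)"
proof -
  show "(\<integral>x. (cmod (indicator \<Omega> x * f x))\<^sup>2 \<partial>Leb N) = (\<integral>x. (cmod (f x))\<^sup>2 \<partial>leb N \<Omega>)"
    unfolding leb_def integral_restrict_space[OF sets_Leb_Int[OF \<Omega>]]
    by (intro Bochner_Integration.integral_cong) (auto simp: indicator_def)
  show "(\<integral>x. cmod (indicator \<Omega> x * f x) \<partial>Leb N) = (\<integral>x. cmod (f x) \<partial>leb N \<Omega>)"
    unfolding leb_def integral_restrict_space[OF sets_Leb_Int[OF \<Omega>]]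
    by (intro Bochner_Integration.integral_cong) (auto simp: indicator_def)
  assume "integrable (leb N \<Omega>) f"
  then have "integrable (Leb N) (\<lambda>x. indicator \<Omega> x *\<^sub>R f x)"
    unfolding leb_def integrable_restrict_space[OF sets_Leb_Int[OF \<Omega>]] .
  then show "integrable (Leb N) (\<lambda>x. indicator \<Omega> x * f x)"
    by (rule Bochner_Integration.integrable_cong[THEN iffD1, rotated -1]) (auto simp: indicator_def)
qed

lemma cube_cutoff:
  assumes C: "bump_constant C" and r: "0 < r'" "r' < r" "r < \<rho>" and cube: "cube N x \<rho> \<subseteq> \<Omega> - K"
  shows "\<exists>\<eta>. (\<lambda>y. complex_of_real (\<eta> y)) \<in> Cc_inf N \<Omega> \<and> (\<forall>y\<in>Rspace N. 0 \<le> \<eta> y \<and> \<eta> y \<le> 1) \<and>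
    (\<forall>y\<in>Rspace N. \<forall>i<N. \<bar>rpd i \<eta> y\<bar> \<le> C / (r - r')) \<and> (\<forall>y\<in>cube N x r'. \<eta> y = 1) \<and>
    (\<forall>y\<in>Rspace N - cube N x r. \<eta> y = 0) \<and> (K \<subseteq> Rspace N \<longrightarrow> (\<exists>V. openin (Rtop N) V \<and> K \<subseteq> V \<and> (\<forall>y\<in>V. \<eta> y = 0)))"
proof -
  have "r - r' > 0" using r by simp
  then obtain \<eta> where \<eta>: "rsmooth N \<eta>" "\<forall>x\<in>Rspace N. 0 \<le> \<eta> x \<and> \<eta> x \<le> 1"
    "\<forall>y\<in>Rspace N. (\<forall>i<N. x i - r' \<le> y i \<and> y i \<le> x i + r') \<longrightarrow> \<eta> y = 1"
    "\<forall>y\<in>Rspace N. y \<notin> obox N (\<lambda>i. x i - r' - (r - r')) (\<lambda>i. x i + r' + (r - r')) \<longrightarrow> \<eta> y = 0"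
    "\<forall>x\<in>Rspace N. \<forall>i<N. \<bar>rpd i \<eta> x\<bar> \<le> C / (r - r')"
    using bump_constantD[OF C, of "r - r'" N "\<lambda>i. x i - r'" "\<lambda>i. x i + r'"] by blast
  have eq: "obox N (\<lambda>i. x i - r' - (r - r')) (\<lambda>i. x i + r' + (r - r')) = cube N x r"
    by (simp add: algebra_simps)
  have 0: "\<forall>y\<in>Rspace N - cube N x r. \<eta> y = 0" using \<eta>(4) unfolding eq by blast
  let ?C = "PiE {..<N} (\<lambda>i. {x i - r..x i + r})"
  have sub: "cube N x r \<subseteq> ?C" unfolding obox_def by (intro PiE_mono) auto
  have cp: "compactin (Rtop N) ?C" unfolding compactin_PiE by simp
  have C\<rho>: "?C \<subseteq> cube N x \<rho>" unfolding obox_def using r(3) by (intro PiE_mono) auto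
  have "(\<lambda>y. complex_of_real (\<eta> y)) \<in> Cc_inf N \<Omega>"
    by (rule Cc_infI[OF \<eta>(1)[unfolded rsmooth_def] cp]) (use C\<rho> cube 0 sub in auto)
  moreover have "\<forall>y\<in>cube N x r'. \<eta> y = 1"
  proof
    fix y assume "y \<in> cube N x r'"
    then have "y \<in> Rspace N" "\<forall>i<N. x i - r' \<le> y i \<and> y i \<le> x i + r'"
      unfolding mem_obox by (blast, auto intro: less_imp_le)
    then show "\<eta> y = 1" using \<eta>(3) by blast
  qed
  moreover have "\<exists>V. openin (Rtop N) V \<and> K \<subseteq> V \<and> (\<forall>y\<in>V. \<eta> y = 0)" if "K \<subseteq> Rspace N"
  proof (intro exI[of _ "Rspace N - ?C"] conjI)
    show "openin (Rtop N) (Rspace N - ?C)" by (rule openin_diff[OF openin_topspace compactin_closedin[OF cp]])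
    show "K \<subseteq> Rspace N - ?C" using that C\<rho> cube by blast
    show "\<forall>y\<in>Rspace N - ?C. \<eta> y = 0" using 0 sub by blast
  qed
  ultimately show ?thesis using \<eta>(2,5) 0 by blast
qed

text \<open>With the side \<open>h\<^sub>0 2\<^sup>-\<^sup>k\<close> in the Nash inequality, the linear part contracts by \<open>\<theta> / 2\<close> in spite of the
  growth \<open>4\<^sup>k\<close> of the squared gradients, and the quadratic part by the smallness of \<open>Y\<close>.  The value of \<open>\<theta>\<close> is
  chosen so that \<open>\<theta>\<^sup>k\<close> offsets the growth of \<open>h\<^sup>-\<^sup>N\<close> and of the square of \<open>4\<^sup>k\<close> in the quadratic part.\<close>

lemma iteration_arithmetic:
  fixes m P h0 \<theta> y Y :: real
  assumes pos: "m > 0" "P > 0" "h0 > 0" "N \<ge> 1" and \<theta>: "\<theta> = 1 / 2 ^ (N + 4)"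
    and h0: "h0\<^sup>2 = \<theta> * m\<^sup>2 / (32 * real N * P)" and y: "y = \<theta> * m ^ 4 * h0 ^ N / (64 * P\<^sup>2)"
    and Y: "0 \<le> Y" "Y \<le> y * \<theta> ^ k"
  shows "2 / (h0 * (1 / 2) ^ k) ^ N * (4 / m\<^sup>2 * (P * 4 ^ k * Y))\<^sup>2 +
    real N * (h0 * (1 / 2) ^ k)\<^sup>2 * (16 / m\<^sup>2 * (P * 4 ^ k * Y)) \<le> \<theta> * Y"
proof -
  have Np: "real N > 0" using pos(4) by simp
  have \<theta>p: "\<theta> > 0" unfolding \<theta> by simp
  have four: "(4::real) ^ k = 2 ^ k * 2 ^ k" by (simp flip: power_mult_distrib)
  have half: "(1 / 2 :: real) ^ k = 1 / 2 ^ k" by (simp add: power_divide)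
  have "real N * (h0 * (1 / 2) ^ k)\<^sup>2 * (16 / m\<^sup>2 * (P * 4 ^ k * Y)) = real N * h0\<^sup>2 * (16 / m\<^sup>2 * P) * Y"
    unfolding four half power_mult_distrib by (simp add: power2_eq_square)
  also have "real N * h0\<^sup>2 * (16 / m\<^sup>2 * P) = \<theta> / 2"
    unfolding h0 using pos Np by (simp add: field_simps)
  finally have 2: "real N * (h0 * (1 / 2) ^ k)\<^sup>2 * (16 / m\<^sup>2 * (P * 4 ^ k * Y)) = \<theta> / 2 * Y" .
  have t1: "\<theta> ^ k * (2 ^ k) ^ N * (4 ^ k)\<^sup>2 = 1"
  proof -
    have "((2::real) ^ k) ^ N * (4 ^ k)\<^sup>2 = (2 ^ (N + 4)) ^ k"
      unfolding four by (simp add: power2_eq_square power_add power_mult_distrib mult.commute flip: power_mult)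
        (simp flip: power_mult_distrib)
    then show ?thesis unfolding \<theta> by (simp add: power_divide)
  qed
  have "2 / (h0 * (1 / 2) ^ k) ^ N * (4 / m\<^sup>2 * (P * 4 ^ k * Y))\<^sup>2 =
      (32 * P\<^sup>2 / (m ^ 4 * h0 ^ N) * (2 ^ k) ^ N * (4 ^ k)\<^sup>2 * Y) * Y"
    unfolding half using pos by (simp add: power_mult_distrib power_divide field_simps power2_eq_square power4_eq_xxxx)
  also have "\<dots> \<le> (32 * P\<^sup>2 / (m ^ 4 * h0 ^ N) * (2 ^ k) ^ N * (4 ^ k)\<^sup>2 * (y * \<theta> ^ k)) * Y"
    using pos Y by (intro mult_right_mono mult_left_mono) auto
  also have "32 * P\<^sup>2 / (m ^ 4 * h0 ^ N) * (2 ^ k) ^ N * (4 ^ k)\<^sup>2 * (y * \<theta> ^ k) =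
      32 * P\<^sup>2 / (m ^ 4 * h0 ^ N) * y * (\<theta> ^ k * (2 ^ k) ^ N * (4 ^ k)\<^sup>2)" by (simp add: mult_ac)
  also have "\<dots> = \<theta> / 2" unfolding t1 unfolding y using pos by (simp add: field_simps)
  finally have 1: "2 / (h0 * (1 / 2) ^ k) ^ N * (4 / m\<^sup>2 * (P * 4 ^ k * Y))\<^sup>2 \<le> \<theta> / 2 * Y" .
  have "\<theta> / 2 * Y + \<theta> / 2 * Y = \<theta> * Y" by (simp add: field_simps)
  then show ?thesis using add_mono[OF 1 eq_refl[OF 2]] by (simp only:)
qed

text \<open>Since \<open>U\<close> is \<open>u / |u|\<close> where \<open>u\<close> does not vanish, the saturated term sees the first power of \<open>|u|\<close>
  and the others the second one.\<close>

lemma zero_order_pairings: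
  fixes u U :: "pt \<Rightarrow> complex" and w \<phi> :: "pt \<Rightarrow> real" and l :: complex
  defines "v \<equiv> \<lambda>x. l * complex_of_real (w x) * u x"
  assumes u: "u \<in> borel_measurable (leb N \<Omega>)" and w: "w \<in> borel_measurable (leb N \<Omega>)"
  shows "saturated_section N \<Omega> u U \<Longrightarrow> pairing N \<Omega> (\<lambda>x. a * U x) v = Re (a * cnj l) * (\<integral>x. w x * cmod (u x) \<partial>leb N \<Omega>)"
    and "pairing N \<Omega> (\<lambda>x. b * u x) v = Re (b * cnj l) * (\<integral>x. w x * (cmod (u x))\<^sup>2 \<partial>leb N \<Omega>)"
    and "pairing N \<Omega> (\<lambda>x. complex_of_real (\<phi> x) * u x) v = Re (cnj l) * (\<integral>x. \<phi> x * (w x * (cmod (u x))\<^sup>2) \<partial>leb N \<Omega>)"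
proof -
  let ?M = "leb N \<Omega>"
  note [measurable] = u w
  have of_real_integral: "Re (\<integral>x. c * complex_of_real (f x) \<partial>?M) = Re c * (\<integral>x. f x \<partial>?M)" for c f
    by (simp add: integral_complex_of_real)
  have uu: "u x * cnj (v x) = cnj l * complex_of_real (w x * (cmod (u x))\<^sup>2)" for x
    unfolding v_def of_real_mult complex_norm_square by simp
  have "b * u x * cnj (v x) = (b * cnj l) * complex_of_real (w x * (cmod (u x))\<^sup>2)" for x
    unfolding mult.assoc uu ..
  then show "pairing N \<Omega> (\<lambda>x. b * u x) v = Re (b * cnj l) * (\<integral>x. w x * (cmod (u x))\<^sup>2 \<partial>?M)"
    unfolding pairing_def by (simp only: of_real_integral)
  have "complex_of_real (\<phi> x) * u x * cnj (v x) = cnj l * complex_of_real (\<phi> x * (w x * (cmod (u x))\<^sup>2))" for x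
    unfolding mult.assoc uu of_real_mult by (simp only: mult.left_commute)
  then show "pairing N \<Omega> (\<lambda>x. complex_of_real (\<phi> x) * u x) v = Re (cnj l) * (\<integral>x. \<phi> x * (w x * (cmod (u x))\<^sup>2) \<partial>?M)"
    unfolding pairing_def by (simp only: of_real_integral)
  assume U: "saturated_section N \<Omega> u U"
  then have [measurable]: "U \<in> borel_measurable ?M" unfolding saturated_section_def Linf_def by blast
  have "(\<integral>x. a * U x * cnj (v x) \<partial>?M) = (\<integral>x. (a * cnj l) * complex_of_real (w x * cmod (u x)) \<partial>?M)"
  proof (rule integral_cong_AE)
    show "(\<lambda>x. a * U x * cnj (v x)) \<in> borel_measurable ?M" unfolding v_def by measurable
    show "(\<lambda>x. (a * cnj l) * complex_of_real (w x * cmod (u x))) \<in> borel_measurable ?M" by measurable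
    have "AE x in ?M. u x \<noteq> 0 \<longrightarrow> U x = u x / complex_of_real (cmod (u x))"
      using U unfolding saturated_section_def by blast
    then show "AE x in ?M. a * U x * cnj (v x) = (a * cnj l) * complex_of_real (w x * cmod (u x))"
    proof eventually_elim
      case (elim x)
      show ?case
      proof (cases "u x = 0")
        case False
        then have "U x * cnj (u x) = complex_of_real ((cmod (u x))\<^sup>2) / complex_of_real (cmod (u x))"
          using elim unfolding complex_norm_square by simp
        also have "\<dots> = complex_of_real (cmod (u x))" using False by (simp add: power2_eq_square)
        finally have "U x * cnj (u x) = complex_of_real (cmod (u x))" .
        moreover have "a * U x * cnj (v x) = a * cnj l * complex_of_real (w x) * (U x * cnj (u x))"
          unfolding v_def by simp
        ultimately show ?thesis by simp
      qed (simp add: v_def)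
    qed
  qed
  then show "pairing N \<Omega> (\<lambda>x. a * U x) v = Re (a * cnj l) * (\<integral>x. w x * cmod (u x) \<partial>?M)"
    unfolding pairing_def by (simp only: of_real_integral)
qed

text \<open>What the weak equation says when it is tested with \<open>l \<eta>\<^sup>2 u\<close>, where the cutoff \<open>\<eta>\<close> vanishes near \<open>K\<close>
  but not necessarily at the boundary of \<open>\<Omega>\<close>.  Both boundary conditions lead to this equation.\<close>

locale cutoff_equation =
  fixes N :: nat and \<Omega> K :: "pt set" and u U G :: "pt \<Rightarrow> complex" and \<phi> :: "pt \<Rightarrow> real"
    and a b l :: complex and m :: real
  assumes N: "N \<ge> 1" and \<Omega>: "openin (Rtop N) \<Omega>" and K: "compactin (Rtop N) K"
    and m: "m > 0" "m \<le> 1" and l: "cmod l = 1" "\<forall>z\<in>{1, a, b}. m \<le> Re (z * cnj l)"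
    and u: "u \<in> H1 N \<Omega>" and U: "saturated_section N \<Omega> u U"
    and \<phi>: "AE x in leb N \<Omega>. \<phi> x \<ge> 0"
    and G: "AE x in leb N (\<Omega> - K). cmod (G x) \<le> m / 2"
    and eq: "\<And>\<eta>. (\<lambda>x. complex_of_real (\<eta> x)) \<in> Cc_inf N (Rspace N) \<Longrightarrow>
      \<exists>V. openin (Rtop N) V \<and> K \<subseteq> V \<and> (\<forall>x\<in>V. \<eta> x = 0) \<Longrightarrow>
      (\<Sum>i<N. pairing N \<Omega> (weak_deriv N \<Omega> i u) (weak_deriv N \<Omega> i (\<lambda>x. l * complex_of_real ((\<eta> x)\<^sup>2) * u x)))
        + pairing N \<Omega> (\<lambda>x. a * U x) (\<lambda>x. l * complex_of_real ((\<eta> x)\<^sup>2) * u x)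
        + pairing N \<Omega> (\<lambda>x. b * u x) (\<lambda>x. l * complex_of_real ((\<eta> x)\<^sup>2) * u x)
        + pairing N \<Omega> (\<lambda>x. complex_of_real (\<phi> x) * u x) (\<lambda>x. l * complex_of_real ((\<eta> x)\<^sup>2) * u x)
      = pairing N (\<Omega> - K) G (\<lambda>x. l * complex_of_real ((\<eta> x)\<^sup>2) * u x)"
begin

lemma us: "sqint (leb N \<Omega>) u"
  by (rule H1_D(1)[OF u])

lemma gs: "i < N \<Longrightarrow> sqint (leb N \<Omega>) (weak_deriv N \<Omega> i u)"
  by (rule H1_D(2)[OF u])

lemma cutoff_facts:
  assumes \<eta>: "(\<lambda>x. complex_of_real (\<eta> x)) \<in> Cc_inf N (Rspace N)"
  shows "rsmooth N \<eta>"
    and "sqint (leb N \<Omega>) f \<Longrightarrow> sqint (leb N \<Omega>) (\<lambda>x. complex_of_real (\<eta> x) * f x)"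
    and "sqint (leb N \<Omega>) f \<Longrightarrow> i < N \<Longrightarrow> sqint (leb N \<Omega>) (\<lambda>x. complex_of_real (rpd i \<eta> x) * f x)"
    and "sqint (leb N \<Omega>) f \<Longrightarrow> integrable (leb N \<Omega>) (\<lambda>x. (\<eta> x)\<^sup>2 * cmod (f x))"
    and "sqint (leb N \<Omega>) f \<Longrightarrow> integrable (leb N \<Omega>) (\<lambda>x. (\<eta> x)\<^sup>2 * (cmod (f x))\<^sup>2)"
    and "sqint (leb N \<Omega>) f \<Longrightarrow> i < N \<Longrightarrow> integrable (leb N \<Omega>) (\<lambda>x. (rpd i \<eta> x)\<^sup>2 * (cmod (f x))\<^sup>2)"
proof -
  show sm: "rsmooth N \<eta>" using Cc_inf_smooth[OF \<eta>] unfolding rsmooth_def .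
  obtain B where B: "\<forall>x\<in>Rspace N. cmod (complex_of_real (\<eta> x)) \<le> B \<and>
      (\<forall>i<N. cmod (pderiv_at i (\<lambda>x. complex_of_real (\<eta> x)) x) \<le> B)"
    using Cc_inf_deriv_bound[OF \<eta>] by blast
  show 1: "sqint (leb N \<Omega>) (\<lambda>x. complex_of_real (\<eta> x) * f x)" if "sqint (leb N \<Omega>) f" for f
    by (rule bounded_mult_sqint[OF that Cc_inf_measurable[OF \<eta>]]) (use B in blast)
  show 2: "sqint (leb N \<Omega>) (\<lambda>x. complex_of_real (rpd i \<eta> x) * f x)" if f: "sqint (leb N \<Omega>) f" and i: "i < N" for f i
  proof (rule bounded_mult_sqint[OF f])
    have e: "pderiv_at i (\<lambda>x. complex_of_real (\<eta> x)) x = complex_of_real (rpd i \<eta> x)" if "x \<in> Rspace N" for x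
      by (rule rsmooth_has_rpd(2)[OF sm that i])
    show "(\<lambda>x. complex_of_real (rpd i \<eta> x)) \<in> borel_measurable (Leb N)"
      using measurable_cong[of "Leb N" "pderiv_at i (\<lambda>x. complex_of_real (\<eta> x))" "\<lambda>x. complex_of_real (rpd i \<eta> x)" borel]
        Cc_inf_measurable[OF Cc_inf_pderiv[OF \<eta> i]] e unfolding space_Leb by blast
    show "\<forall>x\<in>Rspace N. cmod (complex_of_real (rpd i \<eta> x)) \<le> B" using B e i by metis
  qed
  show "integrable (leb N \<Omega>) (\<lambda>x. (\<eta> x)\<^sup>2 * cmod (f x))" if "sqint (leb N \<Omega>) f" for f
    using integrable_norm[OF sqint_mult_integrable[OF Cc_inf_sqint_leb[OF \<eta> \<Omega>] 1[OF that]]]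
    by (simp add: norm_mult power2_eq_square mult.assoc[symmetric])
  show "integrable (leb N \<Omega>) (\<lambda>x. (\<eta> x)\<^sup>2 * (cmod (f x))\<^sup>2)" if "sqint (leb N \<Omega>) f" for f
    using sqint_integrable[OF 1[OF that]] by (simp add: norm_mult power_mult_distrib)
  show "integrable (leb N \<Omega>) (\<lambda>x. (rpd i \<eta> x)\<^sup>2 * (cmod (f x))\<^sup>2)" if "sqint (leb N \<Omega>) f" "i < N" for f i
    using sqint_integrable[OF 2[OF that]] by (simp add: norm_mult power_mult_distrib)
qed

text \<open>The equation tested with \<open>l \<eta>\<^sup>2 u\<close>.  All coefficients have real part at least \<open>m\<close> in the direction
  \<open>l\<close>, so the left-hand side controls the gradient and \<open>\<eta>\<^sup>2 |u|\<close>; half of the latter absorbs \<open>G\<close>.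
  What remains on the right is supported where \<open>\<eta>\<close> is not constant.\<close>

lemma caccioppoli:
  assumes \<eta>: "(\<lambda>x. complex_of_real (\<eta> x)) \<in> Cc_inf N (Rspace N)"
    and V: "\<exists>V. openin (Rtop N) V \<and> K \<subseteq> V \<and> (\<forall>x\<in>V. \<eta> x = 0)"
  shows "(\<Sum>i<N. \<integral>x. (\<eta> x)\<^sup>2 * (cmod (weak_deriv N \<Omega> i u x))\<^sup>2 \<partial>leb N \<Omega>) + (\<integral>x. (\<eta> x)\<^sup>2 * cmod (u x) \<partial>leb N \<Omega>)
    \<le> 4 / m\<^sup>2 * (\<Sum>i<N. \<integral>x. (rpd i \<eta> x)\<^sup>2 * (cmod (u x))\<^sup>2 \<partial>leb N \<Omega>)"
proof -
  note cf = cutoff_facts[OF \<eta>]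
  note sm = cf(1)
  let ?M = "leb N \<Omega>"
  let ?g = "\<lambda>i. weak_deriv N \<Omega> i u"
  define \<zeta> where "\<zeta> x = l * complex_of_real ((\<eta> x)\<^sup>2)" for x
  define v where "v x = \<zeta> x * u x" for x
  have lm: "m \<le> Re (cnj l)" "m \<le> Re (a * cnj l)" "m \<le> Re (b * cnj l)" using l(2) by auto
  have \<zeta>C: "\<zeta> \<in> Cc_inf N (Rspace N)"
  proof -
    have "(\<lambda>x. l * (complex_of_real (\<eta> x) * complex_of_real (\<eta> x))) \<in> Cc_inf N (Rspace N)"
      by (rule Cc_inf_mult[OF smooth_const Cc_inf_mult[OF Cc_inf_smooth[OF \<eta>] \<eta>]])
    then show ?thesis unfolding \<zeta>_def by (simp add: power2_eq_square)
  qed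
  note \<zeta>s = Cc_inf_smooth[OF \<zeta>C]
  have \<zeta>': "pderiv_at i \<zeta> x = l * complex_of_real (2 * \<eta> x * rpd i \<eta> x)" if x: "x \<in> Rspace N" and i: "i < N" for x i
  proof -
    have sq: "rsmooth N (\<lambda>x. \<eta> x * \<eta> x)" by (rule rsmooth_mult[OF sm sm])
    have "pderiv_at i (\<lambda>x. l * complex_of_real (\<eta> x * \<eta> x)) x =
        l * pderiv_at i (\<lambda>x. complex_of_real (\<eta> x * \<eta> x)) x + pderiv_at i (\<lambda>x. l) x * complex_of_real (\<eta> x * \<eta> x)"
      by (rule pderiv_mult[OF smooth_const sq[unfolded rsmooth_def] x i])
    also have "\<dots> = l * complex_of_real (rpd i (\<lambda>x. \<eta> x * \<eta> x) x)"
      unfolding rsmooth_has_rpd(2)[OF sq x i] by simp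
    also have "rpd i (\<lambda>x. \<eta> x * \<eta> x) x = 2 * \<eta> x * rpd i \<eta> x"
      unfolding rpd_mult[OF sm sm x i] by simp
    finally show ?thesis unfolding \<zeta>_def power2_eq_square .
  qed
  obtain B where B: "\<forall>x\<in>Rspace N. cmod (\<zeta> x) \<le> B \<and> (\<forall>i<N. cmod (pderiv_at i \<zeta> x) \<le> B)"
    using Cc_inf_deriv_bound[OF \<zeta>C] by blast
  have vH: "v \<in> H1 N \<Omega>" unfolding v_def by (rule H1_mult(1)[OF \<Omega> u \<zeta>s B])
  have grad: "m / 2 * (\<integral>x. (\<eta> x)\<^sup>2 * (cmod (?g i x))\<^sup>2 \<partial>?M) - 2 / m * (\<integral>x. (rpd i \<eta> x)\<^sup>2 * (cmod (u x))\<^sup>2 \<partial>?M)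
      \<le> pairing N \<Omega> (?g i) (weak_deriv N \<Omega> i v)" if i: "i < N" for i
  proof -
    note int = sqint_mult_integrable[OF gs[OF i] sqint_cnj[OF H1_D(2)[OF vH i]]]
    have "m / 2 * (\<integral>x. (\<eta> x)\<^sup>2 * (cmod (?g i x))\<^sup>2 \<partial>?M) - 2 / m * (\<integral>x. (rpd i \<eta> x)\<^sup>2 * (cmod (u x))\<^sup>2 \<partial>?M) =
        (\<integral>x. m / 2 * ((\<eta> x)\<^sup>2 * (cmod (?g i x))\<^sup>2) - 2 / m * ((rpd i \<eta> x)\<^sup>2 * (cmod (u x))\<^sup>2) \<partial>?M)"
      using cf(5)[OF gs[OF i]] cf(6)[OF us i] by simp
    also have "\<dots> \<le> (\<integral>x. Re (?g i x * cnj (weak_deriv N \<Omega> i v x)) \<partial>?M)"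
    proof (rule integral_mono_AE)
      show "integrable ?M (\<lambda>x. m / 2 * ((\<eta> x)\<^sup>2 * (cmod (?g i x))\<^sup>2) - 2 / m * ((rpd i \<eta> x)\<^sup>2 * (cmod (u x))\<^sup>2))"
        using cf(5)[OF gs[OF i]] cf(6)[OF us i] by simp
      show "integrable ?M (\<lambda>x. Re (?g i x * cnj (weak_deriv N \<Omega> i v x)))"
        using int by (rule integrable_Re)
      show "AE x in ?M. m / 2 * ((\<eta> x)\<^sup>2 * (cmod (?g i x))\<^sup>2) - 2 / m * ((rpd i \<eta> x)\<^sup>2 * (cmod (u x))\<^sup>2)
          \<le> Re (?g i x * cnj (weak_deriv N \<Omega> i v x))"
        using H1_mult(2)[OF \<Omega> u \<zeta>s B i] AE_space[of ?M]
      proof eventually_elim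
        case (elim x)
        then have x: "x \<in> Rspace N" unfolding space_leb by blast
        show ?case unfolding v_def elim(1) \<zeta>'[OF x i] unfolding \<zeta>_def
          by (rule energy_pointwise[OF m(1) l(1) lm(1)])
      qed
    qed
    also have "\<dots> = pairing N \<Omega> (?g i) (weak_deriv N \<Omega> i v)"
      unfolding pairing_def using int by (rule integral_Re)
    finally show ?thesis .
  qed
  have wm: "(\<lambda>x. (\<eta> x)\<^sup>2) \<in> borel_measurable ?M"
  proof -
    have "(\<lambda>x. (cmod (complex_of_real (\<eta> x)))\<^sup>2) \<in> borel_measurable ?M"
      using measurable_leb[OF Cc_inf_measurable[OF \<eta>]] by measurable
    then show ?thesis by simp
  qed
  note zero_order = zero_order_pairings[OF sqint_measurable[OF us] wm, where l = l, folded \<zeta>_def, folded v_def]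
  have aU: "m * (\<integral>x. (\<eta> x)\<^sup>2 * cmod (u x) \<partial>?M) \<le> pairing N \<Omega> (\<lambda>x. a * U x) v"
    unfolding zero_order(1)[OF U] using lm(2) by (intro mult_right_mono Bochner_Integration.integral_nonneg) auto
  have bu: "0 \<le> pairing N \<Omega> (\<lambda>x. b * u x) v"
    unfolding zero_order(2) using lm(3) m(1) by (intro mult_nonneg_nonneg Bochner_Integration.integral_nonneg) auto
  have pu: "0 \<le> pairing N \<Omega> (\<lambda>x. complex_of_real (\<phi> x) * u x) v"
    unfolding zero_order(3) using lm(1) m(1) \<phi>
    by (intro mult_nonneg_nonneg integral_nonneg_AE) (auto elim!: eventually_mono)
  have Gv: "pairing N (\<Omega> - K) G v \<le> m / 2 * (\<integral>x. (\<eta> x)\<^sup>2 * cmod (u x) \<partial>?M)"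
  proof -
    note \<Omega>K = openin_minus_compact[OF \<Omega> K]
    note sub = leb_subset_integral[OF \<Omega> \<Omega>K _ cf(4)[OF us]]
    have "pairing N (\<Omega> - K) G v \<le> cmod (\<integral>x. G x * cnj (v x) \<partial>leb N (\<Omega> - K))"
      unfolding pairing_def by (rule complex_Re_le_cmod)
    also have "\<dots> \<le> (\<integral>x. cmod (G x * cnj (v x)) \<partial>leb N (\<Omega> - K))"
      by (rule Bochner_Integration.integral_norm_bound)
    also have "\<dots> \<le> (\<integral>x. m / 2 * ((\<eta> x)\<^sup>2 * cmod (u x)) \<partial>leb N (\<Omega> - K))"
    proof (rule integral_mono_AE')
      show "integrable (leb N (\<Omega> - K)) (\<lambda>x. m / 2 * ((\<eta> x)\<^sup>2 * cmod (u x)))" using sub(1) by simp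
      show "AE x in leb N (\<Omega> - K). cmod (G x * cnj (v x)) \<le> m / 2 * ((\<eta> x)\<^sup>2 * cmod (u x))"
        using G
      proof eventually_elim
        case (elim x)
        have "cmod (G x * cnj (v x)) = cmod (G x) * ((\<eta> x)\<^sup>2 * cmod (u x))"
          unfolding v_def \<zeta>_def using l(1) by (simp add: norm_mult norm_power)
        also have "\<dots> \<le> m / 2 * ((\<eta> x)\<^sup>2 * cmod (u x))" by (intro mult_right_mono elim) simp
        finally show ?case .
      qed
    qed (use m(1) in simp)
    also have "\<dots> = m / 2 * (\<integral>x. (\<eta> x)\<^sup>2 * cmod (u x) \<partial>leb N (\<Omega> - K))" by simp
    also have "\<dots> \<le> m / 2 * (\<integral>x. (\<eta> x)\<^sup>2 * cmod (u x) \<partial>?M)"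
      using m(1) by (intro mult_left_mono sub(2)) auto
    finally show ?thesis .
  qed
  define S where "S = (\<Sum>i<N. \<integral>x. (\<eta> x)\<^sup>2 * (cmod (?g i x))\<^sup>2 \<partial>?M)"
  define R where "R = (\<Sum>i<N. \<integral>x. (rpd i \<eta> x)\<^sup>2 * (cmod (u x))\<^sup>2 \<partial>?M)"
  define T where "T = (\<integral>x. (\<eta> x)\<^sup>2 * cmod (u x) \<partial>?M)"
  have "m / 2 * S - 2 / m * R \<le> (\<Sum>i<N. pairing N \<Omega> (?g i) (weak_deriv N \<Omega> i v))"
    unfolding S_def R_def sum_distrib_left sum_subtractf[symmetric] by (intro sum_mono grad) simp
  moreover have "(\<Sum>i<N. pairing N \<Omega> (?g i) (weak_deriv N \<Omega> i v)) + pairing N \<Omega> (\<lambda>x. a * U x) v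
      + pairing N \<Omega> (\<lambda>x. b * u x) v + pairing N \<Omega> (\<lambda>x. complex_of_real (\<phi> x) * u x) v = pairing N (\<Omega> - K) G v"
    using eq[OF \<eta> V] unfolding v_def \<zeta>_def .
  ultimately have "m / 2 * S - 2 / m * R + m * T \<le> m / 2 * T"
    using aU bu pu Gv unfolding T_def by linarith
  then have "m / 2 * (S + T) \<le> 2 / m * R" by (simp add: algebra_simps)
  then have "S + T \<le> 2 / m * (2 / m * R)" using m(1) by (simp add: field_simps)
  then show ?thesis unfolding S_def R_def T_def by (simp add: power2_eq_square)
qed

lemma sqint_indicator: "A \<in> sets (Leb N) \<Longrightarrow> sqint (leb N \<Omega>) (\<lambda>x. indicator A x * u x)"
  by (rule bounded_mult_sqint[OF us, where B = 1]) (auto simp: indicator_def)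

lemma indicator_integrable: "A \<in> sets (Leb N) \<Longrightarrow> integrable (leb N \<Omega>) (\<lambda>x. indicator A x * (cmod (u x))\<^sup>2)"
  using sqint_integrable[OF sqint_indicator]
  by (rule Bochner_Integration.integrable_cong[THEN iffD1, rotated -1]) (auto simp: indicator_def)

text \<open>The Nash type inequality for \<open>w = \<eta>\<^sup>2 u\<close>: its \<open>L\<^sup>1\<close> norm and its gradient are controlled by
  the same energy \<open>E\<close>, which enters the first term with the power two.  This gain comes
  from the saturated term and would be absent for a linear equation.\<close>

lemma energy_step:
  assumes \<eta>: "(\<lambda>x. complex_of_real (\<eta> x)) \<in> Cc_inf N \<Omega>"
    and V: "\<exists>V. openin (Rtop N) V \<and> K \<subseteq> V \<and> (\<forall>x\<in>V. \<eta> x = 0)"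
    and bd: "\<forall>x\<in>Rspace N. 0 \<le> \<eta> x \<and> \<eta> x \<le> 1" "\<forall>x\<in>Rspace N. \<forall>i<N. \<bar>rpd i \<eta> x\<bar> \<le> D"
    and A: "A \<in> sets (Leb N)" "\<forall>x\<in>Rspace N - A. \<eta> x = 0" and h: "h > 0"
    and E: "E = real N * D\<^sup>2 * (\<integral>x. indicator A x * (cmod (u x))\<^sup>2 \<partial>leb N \<Omega>)"
  shows "(\<integral>x. ((\<eta> x)\<^sup>2 * cmod (u x))\<^sup>2 \<partial>leb N \<Omega>) \<le> 2 / h ^ N * (4 / m\<^sup>2 * E)\<^sup>2 + real N * h\<^sup>2 * (16 / m\<^sup>2 * E)"
proof -
  let ?M = "leb N \<Omega>"
  let ?g = "\<lambda>i. weak_deriv N \<Omega> i u"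
  have sub: "\<Omega> \<subseteq> Rspace N" by (rule openin_subset[OF \<Omega>])
  have \<eta>R: "(\<lambda>x. complex_of_real (\<eta> x)) \<in> Cc_inf N (Rspace N)" by (rule Cc_inf_mono[OF \<eta> sub])
  note cf = cutoff_facts[OF \<eta>R]
  note sm = cf(1)
  define S where "S = (\<Sum>i<N. \<integral>x. (\<eta> x)\<^sup>2 * (cmod (?g i x))\<^sup>2 \<partial>?M)"
  define R where "R = (\<Sum>i<N. \<integral>x. (rpd i \<eta> x)\<^sup>2 * (cmod (u x))\<^sup>2 \<partial>?M)"
  define T where "T = (\<integral>x. (\<eta> x)\<^sup>2 * cmod (u x) \<partial>?M)"
  have nn: "S \<ge> 0" "R \<ge> 0" "T \<ge> 0" unfolding S_def R_def T_def by (auto intro!: sum_nonneg Bochner_Integration.integral_nonneg)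
  have c: "S + T \<le> 4 / m\<^sup>2 * R" unfolding S_def R_def T_def by (rule caccioppoli[OF \<eta>R V])
  have R: "R \<le> E"
  proof -
    have "R \<le> (\<Sum>i<N. D\<^sup>2 * (\<integral>x. indicator A x * (cmod (u x))\<^sup>2 \<partial>?M))"
      unfolding R_def
    proof (rule sum_mono)
      fix i assume "i \<in> {..<N}"
      then have i: "i < N" by simp
      have "(\<integral>x. (rpd i \<eta> x)\<^sup>2 * (cmod (u x))\<^sup>2 \<partial>?M) \<le> (\<integral>x. D\<^sup>2 * (indicator A x * (cmod (u x))\<^sup>2) \<partial>?M)"
      proof (rule integral_mono[OF cf(6)[OF us i]])
        show "integrable ?M (\<lambda>x. D\<^sup>2 * (indicator A x * (cmod (u x))\<^sup>2))" using indicator_integrable[OF A(1)] by simp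
        fix x assume "x \<in> space ?M"
        then have x: "x \<in> Rspace N" unfolding space_leb by blast
        show "(rpd i \<eta> x)\<^sup>2 * (cmod (u x))\<^sup>2 \<le> D\<^sup>2 * (indicator A x * (cmod (u x))\<^sup>2)"
        proof (cases "x \<in> A")
          case True
          have "\<bar>rpd i \<eta> x\<bar> \<le> D" using bd(2) x i by blast
          then have "(rpd i \<eta> x)\<^sup>2 \<le> D\<^sup>2" using power_mono[of "\<bar>rpd i \<eta> x\<bar>" D 2] by simp
          then show ?thesis using True by (simp add: mult_right_mono)
        next
          case False
          then have "\<eta> x = 0" using A(2) x by blast
          \<comment> \<open>Off A the cutoff takes its minimum.\<close>
          then have "rpd i \<eta> x = 0" using bd(1) x i by (intro rpd_extremum[OF sm]) auto
          then show ?thesis using False by simp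
        qed
      qed
      then show "(\<integral>x. (rpd i \<eta> x)\<^sup>2 * (cmod (u x))\<^sup>2 \<partial>?M) \<le> D\<^sup>2 * (\<integral>x. indicator A x * (cmod (u x))\<^sup>2 \<partial>?M)" by simp
    qed
    then show ?thesis unfolding E by simp
  qed
  have m2: "4 / m\<^sup>2 \<ge> 0" by simp
  have T: "T \<le> 4 / m\<^sup>2 * E" using c nn mult_left_mono[OF R m2] by linarith
  define \<zeta> where "\<zeta> x = complex_of_real (\<eta> x) * complex_of_real (\<eta> x)" for x
  have \<zeta>C: "\<zeta> \<in> Cc_inf N \<Omega>" unfolding \<zeta>_def by (rule Cc_inf_mult[OF Cc_inf_smooth[OF \<eta>] \<eta>])
  obtain B where B: "\<forall>x\<in>Rspace N. cmod (\<zeta> x) \<le> B \<and> (\<forall>i<N. cmod (pderiv_at i \<zeta> x) \<le> B)"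
    using Cc_inf_deriv_bound[OF \<zeta>C] by blast
  note \<zeta>s = Cc_inf_smooth[OF \<zeta>C]
  define w where "w x = indicator \<Omega> x * (\<zeta> x * u x)" for x
  define k where "k i x = \<zeta> x * ?g i x + pderiv_at i \<zeta> x * u x" for i x
  have ks: "sqint ?M (k i)" if "i < N" for i unfolding k_def by (rule H1_mult(3)[OF \<Omega> u \<zeta>s B that])
  have ki: "(\<integral>x. (cmod (k i x))\<^sup>2 \<partial>?M) \<le> 2 * (\<integral>x. (\<eta> x)\<^sup>2 * (cmod (?g i x))\<^sup>2 \<partial>?M) + 8 * (\<integral>x. (rpd i \<eta> x)\<^sup>2 * (cmod (u x))\<^sup>2 \<partial>?M)"
    if i: "i < N" for i
  proof -
    have "(\<integral>x. (cmod (k i x))\<^sup>2 \<partial>?M) \<le> (\<integral>x. 2 * ((\<eta> x)\<^sup>2 * (cmod (?g i x))\<^sup>2) + 8 * ((rpd i \<eta> x)\<^sup>2 * (cmod (u x))\<^sup>2) \<partial>?M)"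
    proof (rule integral_mono[OF sqint_integrable[OF ks[OF i]]])
      show "integrable ?M (\<lambda>x. 2 * ((\<eta> x)\<^sup>2 * (cmod (?g i x))\<^sup>2) + 8 * ((rpd i \<eta> x)\<^sup>2 * (cmod (u x))\<^sup>2))"
        using cf(5)[OF gs[OF i]] cf(6)[OF us i] by simp
      fix x assume "x \<in> space ?M"
      then have x: "x \<in> Rspace N" unfolding space_leb by blast
      have e: "(\<eta> x)\<^sup>2 \<le> 1" using bd(1) x by (simp add: power_le_one del: topspace_product_topology)
      have d: "pderiv_at i \<zeta> x = complex_of_real (2 * \<eta> x * rpd i \<eta> x)"
        unfolding \<zeta>_def pderiv_mult[OF cf(1)[unfolded rsmooth_def] cf(1)[unfolded rsmooth_def] x i] rsmooth_has_rpd(2)[OF sm x i]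
        by simp
      have "(cmod (k i x))\<^sup>2 \<le> 2 * (cmod (\<zeta> x * ?g i x))\<^sup>2 + 2 * (cmod (pderiv_at i \<zeta> x * u x))\<^sup>2"
        unfolding k_def by (rule cmod_add_sq_le)
      also have "(cmod (\<zeta> x * ?g i x))\<^sup>2 = (\<eta> x)\<^sup>2 * ((\<eta> x)\<^sup>2 * (cmod (?g i x))\<^sup>2)"
        unfolding \<zeta>_def norm_mult power_mult_distrib norm_of_real power2_abs by (simp only: mult.assoc)
      also have "\<dots> \<le> 1 * ((\<eta> x)\<^sup>2 * (cmod (?g i x))\<^sup>2)" by (intro mult_right_mono e) simp
      also have "(cmod (pderiv_at i \<zeta> x * u x))\<^sup>2 = (\<eta> x)\<^sup>2 * (4 * ((rpd i \<eta> x)\<^sup>2 * (cmod (u x))\<^sup>2))"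
        unfolding d norm_mult power_mult_distrib norm_of_real power2_abs by simp
      also have "\<dots> \<le> 1 * (4 * ((rpd i \<eta> x)\<^sup>2 * (cmod (u x))\<^sup>2))" by (intro mult_right_mono e) simp
      finally show "(cmod (k i x))\<^sup>2 \<le> 2 * ((\<eta> x)\<^sup>2 * (cmod (?g i x))\<^sup>2) + 8 * ((rpd i \<eta> x)\<^sup>2 * (cmod (u x))\<^sup>2)" by simp
    qed
    also have "\<dots> = 2 * (\<integral>x. (\<eta> x)\<^sup>2 * (cmod (?g i x))\<^sup>2 \<partial>?M) + 8 * (\<integral>x. (rpd i \<eta> x)\<^sup>2 * (cmod (u x))\<^sup>2 \<partial>?M)"
      using cf(5)[OF gs[OF i]] cf(6)[OF us i] by simp
    finally show ?thesis .
  qed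
  have K1: "(\<Sum>i<N. \<integral>x. (cmod (k i x))\<^sup>2 \<partial>?M) \<le> 16 / m\<^sup>2 * E"
  proof -
    have "(\<Sum>i<N. \<integral>x. (cmod (k i x))\<^sup>2 \<partial>?M) \<le> 2 * S + 8 * R"
      unfolding S_def R_def sum_distrib_left sum.distrib[symmetric] by (intro sum_mono ki) simp
    also have "\<dots> \<le> 2 * (4 / m\<^sup>2 * E) + 8 * E" using c nn R mult_left_mono[OF R m2] by linarith
    also have "8 * E \<le> 8 / m\<^sup>2 * E"
    proof (intro mult_right_mono)
      have "m\<^sup>2 \<le> 1" using m by (simp add: power_le_one)
      then show "8 \<le> 8 / m\<^sup>2" using m by (simp add: field_simps)
    qed (use nn R in linarith)
    finally show ?thesis by (simp add: field_simps)
  qed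
  have "(\<integral>x. (cmod (w x))\<^sup>2 \<partial>Leb N) \<le> 2 / h ^ N * (\<integral>x. cmod (w x) \<partial>Leb N)\<^sup>2 +
      real N * h\<^sup>2 * (\<Sum>i<N. \<integral>x. (cmod (indicator \<Omega> x * k i x))\<^sup>2 \<partial>Leb N)"
  proof (rule nash_inequality[OF _ _ _ _ h N])
    have "integrable ?M (\<lambda>x. \<zeta> x * u x)"
      unfolding \<zeta>_def mult.assoc by (rule sqint_mult_integrable[OF Cc_inf_sqint_leb[OF \<eta> \<Omega>] cf(2)[OF us]])
    then show "integrable (Leb N) w" unfolding w_def by (rule leb_extend(3)[OF \<Omega>])
    show "sqint (Leb N) w" unfolding w_def using H1_D(1)[OF H1_mult(1)[OF \<Omega> u \<zeta>s B]] unfolding sqint_leb[OF \<Omega>] .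
    show "\<forall>i<N. sqint (Leb N) (\<lambda>x. indicator \<Omega> x * k i x)" using ks unfolding sqint_leb[OF \<Omega>] by blast
    show "\<forall>i<N. \<forall>f\<in>Cc_inf N (Rspace N). (\<integral>x. w x * pderiv_at i f x \<partial>Leb N) = - (\<integral>x. indicator \<Omega> x * k i x * f x \<partial>Leb N)"
      unfolding w_def k_def using weak_deriv_extend[OF \<Omega> u \<zeta>C] by blast
  qed
  also have "\<dots> = 2 / h ^ N * (\<integral>x. cmod (\<zeta> x * u x) \<partial>?M)\<^sup>2 + real N * h\<^sup>2 * (\<Sum>i<N. \<integral>x. (cmod (k i x))\<^sup>2 \<partial>?M)"
    unfolding w_def leb_extend(1,2)[OF \<Omega>] ..
  also have "(\<integral>x. cmod (\<zeta> x * u x) \<partial>?M) = T" unfolding T_def \<zeta>_def by (simp add: norm_mult power2_eq_square mult.assoc[symmetric])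
  also have "2 / h ^ N * T\<^sup>2 + real N * h\<^sup>2 * (\<Sum>i<N. \<integral>x. (cmod (k i x))\<^sup>2 \<partial>?M) \<le>
      2 / h ^ N * (4 / m\<^sup>2 * E)\<^sup>2 + real N * h\<^sup>2 * (16 / m\<^sup>2 * E)"
    using h nn T K1 by (intro add_mono mult_left_mono power_mono) auto
  also have "(\<integral>x. (cmod (w x))\<^sup>2 \<partial>Leb N) = (\<integral>x. ((\<eta> x)\<^sup>2 * cmod (u x))\<^sup>2 \<partial>?M)"
    unfolding w_def leb_extend(1)[OF \<Omega>] \<zeta>_def by (simp add: norm_mult power2_eq_square mult_ac)
  finally show ?thesis .
qed

text \<open>An iteration of De Giorgi type.  On the concentric cubes with half sides \<open>r k\<close>, decreasing to
  \<open>\<rho> / 2\<close>, the integral of \<open>|u|\<^sup>2\<close> is at most \<open>y \<theta>\<^sup>k\<close> and therefore zero in the limit.\<close>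

lemma vanish_on_half_cube:
  assumes C: "bump_constant C" and \<rho>: "\<rho> > 0" and cube: "cube N x \<rho> \<subseteq> \<Omega> - K"
    and P: "P = 64 * real N * C\<^sup>2 / \<rho>\<^sup>2" and \<theta>: "\<theta> = 1 / 2 ^ (N + 4)"
    and h0: "h0 = sqrt (\<theta> * m\<^sup>2 / (32 * real N * P))" and y: "y = \<theta> * m ^ 4 * h0 ^ N / (64 * P\<^sup>2)"
    and small: "(\<integral>x. (cmod (u x))\<^sup>2 \<partial>leb N \<Omega>) \<le> y"
  shows "AE z in leb N \<Omega>. z \<in> cube N x (\<rho> / 2) \<longrightarrow> u z = 0"
proof -
  let ?M = "leb N \<Omega>"
  have C0: "C > 0" using C unfolding bump_constant_def by blast
  have Np: "real N > 0" using N by simp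
  have Pp: "P > 0" unfolding P using Np C0 \<rho> by simp
  have "(1::real) < 2 ^ (N + 4)" by (rule one_less_power) auto
  then have \<theta>p: "\<theta> > 0" "\<theta> < 1" unfolding \<theta> by (simp_all add: divide_less_eq del: power_add)
  have h0p: "h0 > 0" unfolding h0 using \<theta>p m Np Pp by simp
  have h0sq: "h0\<^sup>2 = \<theta> * m\<^sup>2 / (32 * real N * P)" unfolding h0 using \<theta>p Np Pp by simp
  \<comment> \<open>The gaps are halved at each step, so the squared gradients of the cutoffs grow like P * 4 ^ k.
    The radii start at 3 / 4 of the half side, which leaves a compact margin within the cube.\<close>
  define r where "r k = \<rho> / 2 * (1 + (1 / 2) ^ (k + 1))" for k :: nat
  have r: "\<rho> / 2 < r k" "r k < \<rho>" "r k - r (Suc k) = \<rho> / 8 * (1 / 2) ^ k" for k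
  proof -
    define s where "s = (1 / 2 :: real) ^ (k + 1)"
    have "(1 / 2 :: real) ^ k \<le> 1" by (rule power_le_one) auto
    then have s: "0 < s" "s < 1" unfolding s_def by simp_all
    have rk: "r k = \<rho> / 2 + \<rho> / 2 * s" unfolding r_def s_def by (simp only: distrib_left mult_1_right)
    show "\<rho> / 2 < r k" "r k < \<rho>"
      unfolding rk using mult_pos_pos[of "\<rho> / 2" s] mult_strict_left_mono[OF s(2), of "\<rho> / 2"] s(1) \<rho> by linarith+
    show "r k - r (Suc k) = \<rho> / 8 * (1 / 2) ^ k" unfolding r_def by (simp add: field_simps)
  qed
  define Y where "Y k = (\<integral>z. indicator (cube N x (r k)) z * (cmod (u z))\<^sup>2 \<partial>?M)" for k
  have Y0: "Y k \<ge> 0" for k unfolding Y_def by (intro Bochner_Integration.integral_nonneg) auto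
  have Yk: "Y k \<le> y * \<theta> ^ k" for k
  proof (induction k)
    case 0
    have "Y 0 \<le> (\<integral>z. (cmod (u z))\<^sup>2 \<partial>?M)"
      unfolding Y_def by (rule integral_mono[OF indicator_integrable[OF sets_obox] sqint_integrable[OF us]]) (auto simp: indicator_def)
    then show ?case using small by simp
  next
    case (Suc k)
    define d where "d = r k - r (Suc k)"
    have d: "d > 0" "d = \<rho> / 8 * (1 / 2) ^ k" unfolding d_def r(3) using \<rho> by simp_all
    have "0 < r (Suc k)" "r (Suc k) < r k" using r(1)[of "Suc k"] \<rho> d unfolding d_def by linarith+
    from cube_cutoff[OF C this r(2) cube]
    obtain \<eta> where \<eta>: "(\<lambda>y. complex_of_real (\<eta> y)) \<in> Cc_inf N \<Omega>" "\<forall>y\<in>Rspace N. 0 \<le> \<eta> y \<and> \<eta> y \<le> 1"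
      "\<forall>y\<in>Rspace N. \<forall>i<N. \<bar>rpd i \<eta> y\<bar> \<le> C / d" "\<forall>y\<in>cube N x (r (Suc k)). \<eta> y = 1"
      "\<forall>y\<in>Rspace N - cube N x (r k). \<eta> y = 0" "\<exists>V. openin (Rtop N) V \<and> K \<subseteq> V \<and> (\<forall>y\<in>V. \<eta> y = 0)"
      unfolding d_def using compactin_subset_topspace[OF K] by blast
    \<comment> \<open>The side h is halved along with the gaps, so that the linear term of the step is Y k with a
      factor independent of k.\<close>
    define h where "h = h0 * (1 / 2) ^ k"
    have h: "h > 0" unfolding h_def using h0p by simp
    have ED: "real N * (C / d)\<^sup>2 * Y k = P * 4 ^ k * Y k"
    proof -
      have "(4::real) ^ k = 2 ^ k * 2 ^ k" by (simp flip: power_mult_distrib)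
      then have "real N * (C / d)\<^sup>2 = P * 4 ^ k"
        unfolding d(2) P using \<rho> by (simp add: power_divide power2_eq_square field_simps)
      then show ?thesis by simp
    qed
    have "Y (Suc k) \<le> (\<integral>z. ((\<eta> z)\<^sup>2 * cmod (u z))\<^sup>2 \<partial>?M)"
      unfolding Y_def
    proof (rule integral_mono[OF indicator_integrable[OF sets_obox]])
      have R: "(\<lambda>x. complex_of_real (\<eta> x)) \<in> Cc_inf N (Rspace N)" by (rule Cc_inf_mono[OF \<eta>(1) openin_subset[OF \<Omega>]])
      have "((\<eta> z)\<^sup>2 * cmod (u z))\<^sup>2 = (\<eta> z)\<^sup>2 * (cmod (complex_of_real (\<eta> z) * u z))\<^sup>2" for z
        by (simp only: norm_mult norm_of_real power_mult_distrib power2_abs power2_eq_square[of "(\<eta> z)\<^sup>2"] mult.assoc)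
      then show "integrable ?M (\<lambda>z. ((\<eta> z)\<^sup>2 * cmod (u z))\<^sup>2)"
        using cutoff_facts(5)[OF R cutoff_facts(2)[OF R us]] by (simp only:)
      show "indicator (cube N x (r (Suc k))) z * (cmod (u z))\<^sup>2 \<le> ((\<eta> z)\<^sup>2 * cmod (u z))\<^sup>2" for z
        using \<eta>(4) by (cases "z \<in> cube N x (r (Suc k))") auto
    qed
    also have "\<dots> \<le> 2 / h ^ N * (4 / m\<^sup>2 * (P * 4 ^ k * Y k))\<^sup>2 + real N * h\<^sup>2 * (16 / m\<^sup>2 * (P * 4 ^ k * Y k))"
      by (rule energy_step[OF \<eta>(1,6,2,3) sets_obox \<eta>(5) h]) (use ED in \<open>simp only: Y_def\<close>)
    also have "\<dots> \<le> \<theta> * Y k"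
      unfolding h_def by (rule iteration_arithmetic[OF m(1) Pp h0p N \<theta> h0sq y Y0 Suc.IH])
    also have "\<dots> \<le> \<theta> * (y * \<theta> ^ k)" using Suc.IH \<theta>p by (intro mult_left_mono) auto
    finally show ?case by (simp only: power_Suc mult.left_commute)
  qed
  define Z where "Z = (\<integral>z. indicator (cube N x (\<rho> / 2)) z * (cmod (u z))\<^sup>2 \<partial>?M)"
  have "Z \<le> y * \<theta> ^ k" for k
  proof -
    have "cube N x (\<rho> / 2) \<subseteq> cube N x (r k)" using r(1)[of k] unfolding obox_def by (intro PiE_mono) auto
    then have "Z \<le> Y k" unfolding Z_def Y_def
      by (intro integral_mono indicator_integrable sets_obox mult_right_mono) (auto simp: indicator_def)
    then show ?thesis using Yk[of k] by linarith
  qed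
  moreover have "(\<lambda>k. y * \<theta> ^ k) \<longlonglongrightarrow> y * 0" using \<theta>p by (intro tendsto_intros LIMSEQ_realpow_zero) auto
  ultimately have "Z \<le> y * 0" by (intro LIMSEQ_le_const) auto
  moreover have "Z \<ge> 0" unfolding Z_def by (intro Bochner_Integration.integral_nonneg) auto
  ultimately have "Z = 0" by simp
  then have "AE z in ?M. indicator (cube N x (\<rho> / 2)) z * (cmod (u z))\<^sup>2 = 0"
    unfolding Z_def using indicator_integrable[OF sets_obox] by (subst (asm) integral_nonneg_eq_0_iff_AE) auto
  then show ?thesis by eventually_elim auto
qed

end

section \<open>From the collar to the whole domain\<close>

context cutoff_equation
begin

text \<open>The cutoff \<open>\<kappa>\<close> is zero near \<open>K\<close> and its gradient is only felt where \<open>u\<close> vanishes.  It is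
  therefore an admissible cutoff that costs nothing, except for a cutoff \<open>\<zeta>\<close> at infinity, which makes
  its support compact and whose gradient is at most \<open>C / R\<close>.  Hence the integral of \<open>\<kappa>\<^sup>2 |u|\<close> vanishes as
  \<open>R\<close> tends to infinity.\<close>

lemma vanish_beyond_collar:
  assumes \<kappa>: "rsmooth N \<kappa>" "\<forall>x\<in>Rspace N. 0 \<le> \<kappa> x \<and> \<kappa> x \<le> 1"
    and V: "openin (Rtop N) V" "K \<subseteq> V" "\<forall>x\<in>V. \<kappa> x = 0"
    and collar: "AE x in leb N \<Omega>. 0 < \<kappa> x \<and> \<kappa> x < 1 \<longrightarrow> u x = 0"
  shows "AE x in leb N \<Omega>. \<kappa> x = 1 \<longrightarrow> u x = 0"
proof -
  let ?M = "leb N \<Omega>"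
  obtain C where C: "bump_constant C" using ex_bump_constant by blast
  then have C0: "C > 0" unfolding bump_constant_def by blast
  define c where "c = 4 / m\<^sup>2 * (\<Sum>i<N. C\<^sup>2 * (\<integral>x. (cmod (u x))\<^sup>2 \<partial>?M))"
  \<comment> \<open>The truncation to a cube makes these functions integrable, which the product of the squared
    cutoff with the modulus of u is not known to be in advance.\<close>
  define f where "f n x = indicator (cube N (\<lambda>_. 0) (real n)) x * (cmod (complex_of_real (\<kappa> x)))\<^sup>2 * cmod (u x)" for n :: nat and x
  have f0: "f n x \<ge> 0" for n x unfolding f_def by simp
  have fm: "f n \<in> borel_measurable ?M" for n
  proof -
    have "(\<lambda>x. complex_of_real (\<kappa> x)) \<in> borel_measurable ?M"
      using measurable_leb[OF smooth_measurable[OF \<kappa>(1)[unfolded rsmooth_def]]] .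
    moreover have "(indicator (cube N (\<lambda>_. 0) (real n)) :: pt \<Rightarrow> real) \<in> borel_measurable ?M"
      by (intro measurable_leb borel_measurable_indicator sets_obox)
    ultimately show ?thesis unfolding f_def using sqint_measurable[OF us] by measurable
  qed
  have est: "integrable ?M (f n) \<and> (\<integral>x. f n x \<partial>?M) \<le> c / R\<^sup>2" if R: "R > 0" "R \<ge> real n" for n R
  proof -
    obtain \<zeta> where \<zeta>: "rsmooth N \<zeta>" "\<forall>x\<in>Rspace N. 0 \<le> \<zeta> x \<and> \<zeta> x \<le> 1"
      "\<forall>x\<in>Rspace N. (\<forall>i<N. - R \<le> x i \<and> x i \<le> R) \<longrightarrow> \<zeta> x = 1"
      "\<forall>x\<in>Rspace N. x \<notin> obox N (\<lambda>i. - R - R) (\<lambda>i. R + R) \<longrightarrow> \<zeta> x = 0"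
      "\<forall>x\<in>Rspace N. \<forall>i<N. \<bar>rpd i \<zeta> x\<bar> \<le> C / R"
      using bump_constantD[OF C R(1), of N "\<lambda>_. - R" "\<lambda>_. R"] by (elim exE conjE) (rule that)
    define \<eta> where "\<eta> x = \<kappa> x * \<zeta> x" for x
    have \<eta>s: "rsmooth N \<eta>" unfolding \<eta>_def by (rule rsmooth_mult[OF \<kappa>(1) \<zeta>(1)])
    have \<eta>C: "(\<lambda>x. complex_of_real (\<eta> x)) \<in> Cc_inf N (Rspace N)"
    proof (rule Cc_inf_Rspace[OF \<eta>s[unfolded rsmooth_def]])
      have "cube N (\<lambda>_. 0) (R + R) = obox N (\<lambda>i. - R - R) (\<lambda>i. R + R)" by simp
      then show "\<forall>x\<in>Rspace N - cube N (\<lambda>_. 0) (R + R). complex_of_real (\<eta> x) = 0"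
        unfolding \<eta>_def using \<zeta>(4) by auto
    qed
    note cf = cutoff_facts[OF \<eta>C]
    have V\<eta>: "\<exists>V. openin (Rtop N) V \<and> K \<subseteq> V \<and> (\<forall>x\<in>V. \<eta> x = 0)"
      using V unfolding \<eta>_def by auto
    have grad: "(\<integral>x. (rpd i \<eta> x)\<^sup>2 * (cmod (u x))\<^sup>2 \<partial>?M) \<le> C\<^sup>2 * (\<integral>x. (cmod (u x))\<^sup>2 \<partial>?M) / R\<^sup>2" if i: "i < N" for i
    proof -
      have "(\<integral>x. (rpd i \<eta> x)\<^sup>2 * (cmod (u x))\<^sup>2 \<partial>?M) \<le> (\<integral>x. (C / R)\<^sup>2 * (cmod (u x))\<^sup>2 \<partial>?M)"
      proof (rule integral_mono_AE[OF cf(6)[OF us i]])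
        show "integrable ?M (\<lambda>x. (C / R)\<^sup>2 * (cmod (u x))\<^sup>2)" using sqint_integrable[OF us] by simp
        show "AE x in ?M. (rpd i \<eta> x)\<^sup>2 * (cmod (u x))\<^sup>2 \<le> (C / R)\<^sup>2 * (cmod (u x))\<^sup>2"
          using collar AE_space[of ?M]
        proof eventually_elim
          case (elim x)
          then have x: "x \<in> Rspace N" unfolding space_leb by blast
          show ?case
          proof (cases "u x = 0")
            case False
            have "0 \<le> \<kappa> x" "\<kappa> x \<le> 1" using \<kappa>(2) x by blast+
            then have k01: "\<kappa> x = 0 \<or> \<kappa> x = 1" using elim(1) False by (auto simp: less_eq_real_def)
            have "rpd i \<kappa> x = 0" by (rule rpd_extremum[OF \<kappa>(1) _ x i k01]) (use \<kappa>(2) in blast)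
            then have e: "rpd i \<eta> x = \<kappa> x * rpd i \<zeta> x" unfolding \<eta>_def rpd_mult[OF \<kappa>(1) \<zeta>(1) x i] by simp
            have "\<bar>rpd i \<zeta> x\<bar> \<le> C / R" using \<zeta>(5) x i by blast
            moreover have "\<bar>\<kappa> x\<bar> \<le> 1" using k01 by auto
            ultimately have "\<bar>rpd i \<eta> x\<bar> \<le> 1 * (C / R)" unfolding e abs_mult by (intro mult_mono) auto
            then have "(rpd i \<eta> x)\<^sup>2 \<le> (C / R)\<^sup>2" using power_mono[of "\<bar>rpd i \<eta> x\<bar>" "C / R" 2] by simp
            then show ?thesis by (rule mult_right_mono) simp
          qed simp
        qed
      qed
      then show ?thesis by (simp add: power_divide)
    qed
    have fle: "f n x \<le> (\<eta> x)\<^sup>2 * cmod (u x)" for x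
    proof (cases "x \<in> cube N (\<lambda>_. 0) (real n)")
      case True
      then have "x \<in> Rspace N" "\<forall>i<N. - R \<le> x i \<and> x i \<le> R" using R(2) unfolding mem_obox by (blast, fastforce)
      then have "\<zeta> x = 1" using \<zeta>(3) by blast
      then show ?thesis unfolding f_def \<eta>_def using True by simp
    qed (simp add: f_def)
    have "integrable ?M (f n)"
      by (rule Bochner_Integration.integrable_bound[OF cf(4)[OF us] fm]) (use fle f0 in auto)
    moreover have "(\<integral>x. f n x \<partial>?M) \<le> (\<integral>x. (\<eta> x)\<^sup>2 * cmod (u x) \<partial>?M)"
      by (rule integral_mono[OF calculation cf(4)[OF us] fle])
    moreover have "(\<integral>x. (\<eta> x)\<^sup>2 * cmod (u x) \<partial>?M) \<le> 4 / m\<^sup>2 * (\<Sum>i<N. \<integral>x. (rpd i \<eta> x)\<^sup>2 * (cmod (u x))\<^sup>2 \<partial>?M)"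
    proof -
      have "(\<Sum>i<N. \<integral>x. (\<eta> x)\<^sup>2 * (cmod (weak_deriv N \<Omega> i u x))\<^sup>2 \<partial>?M) \<ge> 0"
        by (intro sum_nonneg Bochner_Integration.integral_nonneg) auto
      then show ?thesis using caccioppoli[OF \<eta>C V\<eta>] by linarith
    qed
    moreover have "4 / m\<^sup>2 * (\<Sum>i<N. \<integral>x. (rpd i \<eta> x)\<^sup>2 * (cmod (u x))\<^sup>2 \<partial>?M) \<le>
        4 / m\<^sup>2 * (\<Sum>i<N. C\<^sup>2 * (\<integral>x. (cmod (u x))\<^sup>2 \<partial>?M) / R\<^sup>2)"
      using grad by (intro mult_left_mono sum_mono) auto
    moreover have "4 / m\<^sup>2 * (\<Sum>i<N. C\<^sup>2 * (\<integral>x. (cmod (u x))\<^sup>2 \<partial>?M) / R\<^sup>2) = c / R\<^sup>2"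
      unfolding c_def sum_divide_distrib[symmetric] by simp
    ultimately show ?thesis by linarith
  qed
  have "AE x in ?M. f n x = 0" for n
  proof -
    have i: "integrable ?M (f n)" using est[of "real n + 1" n] by simp
    have "((\<lambda>R. c * (inverse R)\<^sup>2) \<longlongrightarrow> c * 0\<^sup>2) at_top"
      by (intro tendsto_intros tendsto_inverse_0_at_top filterlim_ident)
    moreover have "eventually (\<lambda>R. (\<integral>x. f n x \<partial>?M) \<le> c * (inverse R)\<^sup>2) at_top"
      using eventually_gt_at_top[of "real n"] by eventually_elim
        (use est[of _ n] in \<open>auto simp: divide_inverse power_inverse\<close>)
    ultimately have "(\<integral>x. f n x \<partial>?M) \<le> c * 0\<^sup>2" by (rule tendsto_lowerbound) simp
    moreover have "(\<integral>x. f n x \<partial>?M) \<ge> 0" by (intro Bochner_Integration.integral_nonneg f0)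
    ultimately have "(\<integral>x. f n x \<partial>?M) = 0" by simp
    then show ?thesis using integral_nonneg_eq_0_iff_AE[OF i] f0 by simp
  qed
  then have "AE x in ?M. \<forall>n. f n x = 0" unfolding AE_all_countable by blast
  then show ?thesis using AE_space[of ?M]
  proof eventually_elim
    case (elim x)
    then have x: "x \<in> Rspace N" unfolding space_leb by blast
    obtain n :: nat where n: "(\<Sum>i<N. \<bar>x i\<bar>) < real n" using reals_Archimedean2 by blast
    have "\<bar>x i - 0\<bar> < real n" if "i < N" for i
      using member_le_sum[of i "{..<N}" "\<lambda>i. \<bar>x i\<bar>"] n that by auto
    then have mem: "x \<in> cube N (\<lambda>_. 0) (real n)" using x unfolding mem_cube by blast
    have "f n x = 0" using elim(1) by blast
    then show ?case unfolding f_def using mem by auto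
  qed
qed

end

lemma rdist_cube: "z \<in> cube N x r \<Longrightarrow> rdist N z x \<le> real N * r"
proof -
  assume z: "z \<in> cube N x r"
  have "rdist N z x \<le> (\<Sum>i<N. \<bar>z i - x i\<bar>)" unfolding rdist_def by (rule L2_set_le_sum_abs)
  also have "\<dots> \<le> (\<Sum>i<N. r)" using z unfolding mem_cube by (intro sum_mono) (auto intro: less_imp_le)
  finally show ?thesis by simp
qed

lemma cube_closed_nbhd:
  assumes "j \<in> K" "z \<in> cube N j r" "real N * r \<le> \<epsilon>"
  shows "z \<in> closed_nbhd N K \<epsilon>"
proof -
  have "pt_set_dist N z K \<le> ennreal (rdist N z j)" unfolding pt_set_dist_def by (rule INF_lower[OF assms(1)])
  also have "\<dots> \<le> ennreal \<epsilon>" using rdist_cube[OF assms(2)] assms(3) by (intro ennreal_leI) linarith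
  finally show ?thesis unfolding closed_nbhd_def using assms(2) obox_subset by blast
qed

lemma mem_cube_sym: "x \<in> Rspace N \<Longrightarrow> y \<in> cube N x r \<Longrightarrow> x \<in> cube N y r"
  unfolding mem_cube by (simp add: abs_minus_commute del: topspace_product_topology)

lemma mem_cube_trans: "x \<in> cube N y r \<Longrightarrow> y \<in> cube N z s \<Longrightarrow> x \<in> cube N z (r + s)"
  unfolding mem_cube by (intro conjI allI impI) (blast, fastforce)

text \<open>The bound of the integral of \<open>|u|\<^sup>2\<close> below which \<open>u\<close> vanishes on the concentric half of each cube
  of half side \<open>\<rho>\<close> in \<open>\<Omega> - K\<close>.\<close>

definition smallness :: "real \<Rightarrow> nat \<Rightarrow> real \<Rightarrow> real \<Rightarrow> real" where
  "smallness C N \<rho> m = (let P = 64 * real N * C\<^sup>2 / \<rho>\<^sup>2; \<theta> = 1 / 2 ^ (N + 4) in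
     \<theta> * m ^ 4 * sqrt (\<theta> * m\<^sup>2 / (32 * real N * P)) ^ N / (64 * P\<^sup>2))"

context cutoff_equation
begin

text \<open>The compact set is covered by finitely many cubes of half side \<open>\<rho>\<close> about points of \<open>K\<close>.  The cutoff
  \<open>\<kappa>\<close> vanishes on the concentric cubes of half side \<open>2 \<rho>\<close> and is one off those of half side \<open>3 \<rho>\<close>; where
  it is strictly between 0 and 1, the cube of half side \<open>\<rho>\<close> about that point is contained in \<open>\<Omega> - K\<close>,
  so \<open>u\<close> vanishes near it.\<close>

lemma support_in_neighbourhood:
  assumes C: "bump_constant C" and \<epsilon>: "\<epsilon> > 0" and sub: "closed_nbhd N K \<epsilon> \<subseteq> \<Omega>"
    and small: "(\<integral>x. (cmod (u x))\<^sup>2 \<partial>leb N \<Omega>) \<le> smallness C N (\<epsilon> / (4 * real N)) m"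
  shows "ess_support N \<Omega> u \<subseteq> closed_nbhd N K \<epsilon>"
proof -
  \<comment> \<open>The factor N compares the Euclidean distance with the maximum distance: a cube of half side
    4 * rho about a point of K is contained in the closed neighbourhood.\<close>
  define \<rho> where "\<rho> = \<epsilon> / (4 * real N)"
  have Np: "real N > 0" using N by simp
  have \<rho>: "\<rho> > 0" "real N * (4 * \<rho>) = \<epsilon>" unfolding \<rho>_def using \<epsilon> Np by auto
  have KR: "K \<subseteq> Rspace N" by (rule compactin_subset_topspace[OF K])
  have \<Omega>R: "\<Omega> \<subseteq> Rspace N" by (rule openin_subset[OF \<Omega>])
  have self: "y \<in> cube N y r" if "y \<in> Rspace N" "r > 0" for y r using that unfolding mem_cube by simp
  have "K \<subseteq> \<Union>((\<lambda>y. cube N y \<rho>) ` K)" using KR self[OF _ \<rho>(1)] by blast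
  moreover have "openin (Rtop N) A" if "A \<in> (\<lambda>y. cube N y \<rho>) ` K" for A using that openin_obox by blast
  ultimately obtain \<F> where \<F>: "finite \<F>" "\<F> \<subseteq> (\<lambda>y. cube N y \<rho>) ` K" "K \<subseteq> \<Union>\<F>"
    using compactinD[OF K, of "(\<lambda>y. cube N y \<rho>) ` K"] by blast
  obtain J where J: "finite J" "J \<subseteq> K" "\<F> = (\<lambda>y. cube N y \<rho>) ` J"
    using finite_subset_image[OF \<F>(1,2)] by blast
  have "\<forall>j::pt. \<exists>\<eta>. rsmooth N \<eta> \<and> (\<forall>x\<in>Rspace N. 0 \<le> \<eta> x \<and> \<eta> x \<le> 1) \<and>
      (\<forall>x\<in>Rspace N. (\<forall>i<N. j i - 2 * \<rho> \<le> x i \<and> x i \<le> j i + 2 * \<rho>) \<longrightarrow> \<eta> x = 1) \<and>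
      (\<forall>x\<in>Rspace N. x \<notin> obox N (\<lambda>i. j i - 2 * \<rho> - \<rho>) (\<lambda>i. j i + 2 * \<rho> + \<rho>) \<longrightarrow> \<eta> x = 0)" (is "\<forall>j. ?bump j")
  proof
    fix j :: pt
    show "?bump j"
      using bump_constantD[OF C \<rho>(1), of N "\<lambda>i. j i - 2 * \<rho>" "\<lambda>i. j i + 2 * \<rho>"]
      by (elim exE conjE) (intro exI conjI)
  qed
  from choice[OF this] obtain e where e: "\<forall>j. rsmooth N (e j)" "\<forall>j. \<forall>x\<in>Rspace N. 0 \<le> e j x \<and> e j x \<le> 1"
    "\<forall>j. \<forall>x\<in>Rspace N. (\<forall>i<N. j i - 2 * \<rho> \<le> x i \<and> x i \<le> j i + 2 * \<rho>) \<longrightarrow> e j x = 1"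
    "\<forall>j. \<forall>x\<in>Rspace N. x \<notin> obox N (\<lambda>i. j i - 2 * \<rho> - \<rho>) (\<lambda>i. j i + 2 * \<rho> + \<rho>) \<longrightarrow> e j x = 0"
    unfolding all_conj_distrib by (elim exE conjE) (rule that)
  have e1: "e j x = 1" if "x \<in> cube N j (2 * \<rho>)" for j x
  proof -
    have "x \<in> Rspace N" "\<forall>i<N. j i - 2 * \<rho> \<le> x i \<and> x i \<le> j i + 2 * \<rho>"
      using that unfolding mem_obox by (blast, auto intro: less_imp_le)
    then show ?thesis using e(3) by blast
  qed
  have e0: "x \<in> cube N j (3 * \<rho>)" if "x \<in> Rspace N" "e j x \<noteq> 0" for j x
  proof -
    have "obox N (\<lambda>i. j i - 2 * \<rho> - \<rho>) (\<lambda>i. j i + 2 * \<rho> + \<rho>) = cube N j (3 * \<rho>)"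
      by (simp add: algebra_simps)
    then show ?thesis using e(4) that by blast
  qed
  define \<kappa> where "\<kappa> x = (\<Prod>j\<in>J. 1 - e j x)" for x
  have \<kappa>s: "rsmooth N \<kappa>" unfolding \<kappa>_def using e(1) by (intro rsmooth_prod J(1) rsmooth_diff rsmooth_const) blast
  have \<kappa>01: "\<forall>x\<in>Rspace N. 0 \<le> \<kappa> x \<and> \<kappa> x \<le> 1"
  proof
    fix x assume x: "x \<in> Rspace N"
    have "0 \<le> e j x" "e j x \<le> 1" for j using e(2) x by blast+
    then show "0 \<le> \<kappa> x \<and> \<kappa> x \<le> 1" unfolding \<kappa>_def by (intro conjI prod_nonneg prod_le_1 ballI) auto
  qed
  define V where "V = (\<Union>j\<in>J. cube N j (2 * \<rho>))"
  have V: "openin (Rtop N) V" "K \<subseteq> V" "\<forall>x\<in>V. \<kappa> x = 0"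
  proof -
    show "openin (Rtop N) V" unfolding V_def by (rule openin_Union) (use openin_obox in blast)
    have "cube N j \<rho> \<subseteq> cube N j (2 * \<rho>)" for j using \<rho>(1) unfolding obox_def by (intro PiE_mono) auto
    then show "K \<subseteq> V" using \<F>(3) unfolding J(3) V_def by blast
    show "\<forall>x\<in>V. \<kappa> x = 0"
    proof
      fix x assume "x \<in> V"
      then obtain j where "j \<in> J" "x \<in> cube N j (2 * \<rho>)" unfolding V_def by blast
      then show "\<kappa> x = 0" unfolding \<kappa>_def using e1 by (intro prod_zero[OF J(1)] bexI[of _ j]) auto
    qed
  qed
  have "AE x in Leb N. x \<in> {x \<in> \<Omega>. 0 < \<kappa> x \<and> \<kappa> x < 1} \<longrightarrow> x \<in> \<Omega> \<longrightarrow> u x = 0"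
  proof (rule AE_locally)
    fix x assume "x \<in> {x \<in> \<Omega>. 0 < \<kappa> x \<and> \<kappa> x < 1}"
    then have x: "x \<in> \<Omega>" "0 < \<kappa> x" "\<kappa> x < 1" by auto
    then have xR: "x \<in> Rspace N" using \<Omega>R by blast
    have "\<exists>j\<in>J. e j x \<noteq> 0"
    proof (rule ccontr)
      assume "\<not> (\<exists>j\<in>J. e j x \<noteq> 0)"
      then have "\<kappa> x = 1" unfolding \<kappa>_def by (intro prod.neutral) auto
      then show False using x(3) by simp
    qed
    then obtain j where j: "j \<in> J" "x \<in> cube N j (3 * \<rho>)" using e0[OF xR] by blast
    have away: "x \<notin> V" using V(3) x(2) by auto
    have disj: "cube N x \<rho> \<inter> K = {}"
    proof (rule ccontr)
      assume "cube N x \<rho> \<inter> K \<noteq> {}"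
      then obtain z where z: "z \<in> cube N x \<rho>" "z \<in> K" by blast
      then obtain j' where j': "j' \<in> J" "z \<in> cube N j' \<rho>" using \<F>(3) unfolding J(3) by blast
      have "x \<in> cube N j' (\<rho> + \<rho>)" by (rule mem_cube_trans[OF mem_cube_sym[OF xR z(1)] j'(2)])
      then have "x \<in> cube N j' (2 * \<rho>)" by (simp only: mult_2)
      then show False using away j'(1) unfolding V_def by blast
    qed
    have "cube N x \<rho> \<subseteq> \<Omega>"
    proof
      fix z assume z: "z \<in> cube N x \<rho>"
      have "z \<in> cube N j (\<rho> + 3 * \<rho>)" by (rule mem_cube_trans[OF z j(2)])
      then have "z \<in> closed_nbhd N K \<epsilon>" using j(1) J(2) \<rho>(2) by (intro cube_closed_nbhd[of j]) auto
      then show "z \<in> \<Omega>" using sub by blast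
    qed
    then have "cube N x \<rho> \<subseteq> \<Omega> - K" using disj by blast
    from vanish_on_half_cube[OF C \<rho>(1) this refl refl refl refl] small
    have "AE z in leb N \<Omega>. z \<in> cube N x (\<rho> / 2) \<longrightarrow> u z = 0"
      unfolding smallness_def \<rho>_def[symmetric] Let_def by blast
    then have "AE z in Leb N. z \<in> cube N x (\<rho> / 2) \<longrightarrow> z \<in> \<Omega> \<longrightarrow> u z = 0"
      unfolding AE_leb[OF \<Omega>] by eventually_elim blast
    moreover have "x \<in> cube N x (\<rho> / 2)" using xR \<rho>(1) unfolding mem_cube by simp
    ultimately show "\<exists>V. openin (Rtop N) V \<and> x \<in> V \<and> (AE z in Leb N. z \<in> V \<longrightarrow> z \<in> \<Omega> \<longrightarrow> u z = 0)"
      using openin_obox by blast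
  qed
  then have collar: "AE x in leb N \<Omega>. 0 < \<kappa> x \<and> \<kappa> x < 1 \<longrightarrow> u x = 0"
    unfolding AE_leb[OF \<Omega>] by eventually_elim blast
  note far = vanish_beyond_collar[OF \<kappa>s \<kappa>01 V collar]
  show ?thesis
  proof
    fix x assume x: "x \<in> ess_support N \<Omega> u"
    then have x\<Omega>: "x \<in> \<Omega>" unfolding ess_support_def by blast
    then have xR: "x \<in> Rspace N" using \<Omega>R by blast
    show "x \<in> closed_nbhd N K \<epsilon>"
    proof (rule ccontr)
      assume nx: "x \<notin> closed_nbhd N K \<epsilon>"
      have "\<kappa> z = 1" if z: "z \<in> cube N x \<rho>" for z
      proof -
        have zR: "z \<in> Rspace N" using z obox_subset by blast
        have "e j z = 0" if j: "j \<in> J" for j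
        proof (rule ccontr)
          assume "e j z \<noteq> 0"
          then have "z \<in> cube N j (3 * \<rho>)" by (rule e0[OF zR])
          then have "x \<in> cube N j (\<rho> + 3 * \<rho>)" by (rule mem_cube_trans[OF mem_cube_sym[OF xR z]])
          then have "x \<in> closed_nbhd N K \<epsilon>" using j J(2) \<rho>(2) by (intro cube_closed_nbhd[of j]) auto
          then show False using nx by blast
        qed
        then show ?thesis unfolding \<kappa>_def by (intro prod.neutral) auto
      qed
      then have "AE z in Leb N. z \<in> \<Omega> \<inter> cube N x \<rho> \<longrightarrow> u z = 0"
        using far unfolding AE_leb[OF \<Omega>] by (auto elim!: eventually_mono)
      then have "AE z in leb N (\<Omega> \<inter> cube N x \<rho>). u z = 0"
        unfolding AE_leb[OF openin_Int[OF \<Omega> openin_obox]] .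
      moreover have "x \<in> cube N x \<rho>" using xR \<rho>(1) unfolding mem_cube by simp
      ultimately show False using x openin_obox unfolding ess_support_def by blast
    qed
  qed
qed

end

text \<open>The segment from a point of \<open>K\<close> to a point off \<open>\<Omega>\<close> meets the boundary of \<open>\<Omega>\<close>, so it is at
  least as long as the distance of \<open>K\<close> to the boundary.\<close>

lemma closed_nbhd_subset:
  assumes \<Omega>: "openin (Rtop N) \<Omega>" and K: "K \<subseteq> \<Omega>" and \<epsilon>: "ennreal \<epsilon> < set_set_dist N K (Rtop N frontier_of \<Omega>)"
  shows "closed_nbhd N K \<epsilon> \<subseteq> \<Omega>"
proof
  fix x assume "x \<in> closed_nbhd N K \<epsilon>"
  then have x: "x \<in> Rspace N" "pt_set_dist N x K \<le> ennreal \<epsilon>" unfolding closed_nbhd_def by auto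
  let ?d = "set_set_dist N K (Rtop N frontier_of \<Omega>)"
  have "pt_set_dist N x K < ?d" using x(2) \<epsilon> by (rule le_less_trans)
  then obtain y where y: "y \<in> K" "ennreal (rdist N x y) < ?d" unfolding pt_set_dist_def INF_less_iff by blast
  have y\<Omega>: "y \<in> \<Omega>" using y(1) K by blast
  then have yR: "y \<in> Rspace N" using openin_subset[OF \<Omega>] by blast
  show "x \<in> \<Omega>"
  proof (rule ccontr)
    assume nx: "x \<notin> \<Omega>"
    define p where "p t = (\<lambda>i\<in>{..<N}. (1 - t) * y i + t * x i)" for t :: real
    have "continuous_map (top_of_set {0..1}) (Rtop N) p"
      unfolding continuous_map_componentwise
    proof (intro conjI ballI)
      fix k assume "k \<in> {..<N}"
      then show "continuous_map (top_of_set {0..1}) euclideanreal (\<lambda>t. p t k)"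
        unfolding p_def by (simp, intro continuous_intros)
    qed (auto simp: p_def)
    moreover have "connectedin (top_of_set {0..1::real}) {0..1}" by (simp add: connectedin_subtopology)
    ultimately have con: "connectedin (Rtop N) (p ` {0..1})" by (rule connectedin_continuous_map_image)
    have "p 0 = y" "p 1 = x" using x(1) yR by (auto simp: p_def PiE_iff extensional_def)
    then have "y \<in> p ` {0..1}" "x \<in> p ` {0..1}" by (metis atLeastAtMost_iff imageI order_refl zero_le_one)+
    then have "p ` {0..1} \<inter> \<Omega> \<noteq> {}" "p ` {0..1} - \<Omega> \<noteq> {}" using y\<Omega> nx by blast+
    from connectedin_Int_frontier_of[OF con this]
    obtain t where t: "0 \<le> t" "t \<le> 1" "p t \<in> Rtop N frontier_of \<Omega>" by auto
    have "rdist N y (p t) = t * rdist N x y"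
    proof -
      have "rdist N y (p t) = L2_set (\<lambda>i. \<bar>t\<bar> * (x i - y i)) {..<N}"
        unfolding rdist_def L2_set_def p_def by (intro arg_cong[where f = sqrt] sum.cong refl)
          (simp add: power_mult_distrib power2_eq_square algebra_simps)
      also have "\<dots> = \<bar>t\<bar> * L2_set (\<lambda>i. x i - y i) {..<N}" by (rule L2_set_right_distrib[symmetric]) simp
      finally show ?thesis unfolding rdist_def using t(1) by simp
    qed
    also have "\<dots> \<le> 1 * rdist N x y"
      using t(2) by (intro mult_right_mono) (simp_all add: rdist_def)
    finally have le: "rdist N y (p t) \<le> rdist N x y" by simp
    have "?d \<le> pt_set_dist N y (Rtop N frontier_of \<Omega>)" unfolding set_set_dist_def by (rule INF_lower[OF y(1)])
    also have "\<dots> \<le> ennreal (rdist N y (p t))" unfolding pt_set_dist_def by (rule INF_lower[OF t(3)])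
    also have "\<dots> \<le> ennreal (rdist N x y)" by (rule ennreal_leI[OF le])
    finally show False using y(2) by simp
  qed
qed

section \<open>The energy of a solution\<close>

lemma H1_cmult:
  assumes \<Omega>: "openin (Rtop N) \<Omega>" and u: "u \<in> H1 N \<Omega>"
  shows "(\<lambda>x. c * u x) \<in> H1 N \<Omega>"
    and "i < N \<Longrightarrow> AE x in leb N \<Omega>. weak_deriv N \<Omega> i (\<lambda>x. c * u x) x = c * weak_deriv N \<Omega> i u x"
    and "H1_norm N \<Omega> (\<lambda>x. c * u x) = cmod c * H1_norm N \<Omega> u"
proof -
  have B: "\<forall>x\<in>Rspace N. cmod c \<le> cmod c \<and> (\<forall>i<N. cmod (pderiv_at i (\<lambda>x. c) x) \<le> cmod c)" by simp
  note h = H1_mult[OF \<Omega> u smooth_const B]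
  show H: "(\<lambda>x. c * u x) \<in> H1 N \<Omega>" by (rule h(1))
  show AE: "AE x in leb N \<Omega>. weak_deriv N \<Omega> i (\<lambda>x. c * u x) x = c * weak_deriv N \<Omega> i u x" if "i < N" for i
    using h(2)[OF that] by simp
  have "(\<integral>x. (cmod (weak_deriv N \<Omega> i (\<lambda>x. c * u x) x))\<^sup>2 \<partial>leb N \<Omega>) =
      (cmod c)\<^sup>2 * (\<integral>x. (cmod (weak_deriv N \<Omega> i u x))\<^sup>2 \<partial>leb N \<Omega>)" if i: "i < N" for i
    using sqint_integral_cong[OF H1_D(2)[OF H i] sqint_cmult[OF H1_D(2)[OF u i]] AE[OF i]]
    by (simp add: norm_mult power_mult_distrib)
  then have "(H1_norm N \<Omega> (\<lambda>x. c * u x))\<^sup>2 = (cmod c)\<^sup>2 * (H1_norm N \<Omega> u)\<^sup>2"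
    unfolding H1_norm_sq by (simp add: norm_mult power_mult_distrib distrib_left sum_distrib_left)
  then have "(H1_norm N \<Omega> (\<lambda>x. c * u x))\<^sup>2 = (cmod c * H1_norm N \<Omega> u)\<^sup>2" by (simp add: power_mult_distrib)
  then show "H1_norm N \<Omega> (\<lambda>x. c * u x) = cmod c * H1_norm N \<Omega> u"
    by (rule power2_eq_imp_eq) (simp_all add: H1_norm_nonneg)
qed

text \<open>By homogeneity; a function of norm zero is annihilated because the functional is bounded.\<close>

lemma dual_norm_bound:
  assumes \<Omega>: "openin (Rtop N) \<Omega>" and Y: "Y \<subseteq> H1 N \<Omega>" "\<And>v c. v \<in> Y \<Longrightarrow> (\<lambda>x. c * v x) \<in> Y"
    and F: "F \<in> dual N \<Omega> Y" and v: "v \<in> Y"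
  shows "\<bar>F v\<bar> \<le> dual_norm N \<Omega> Y F * H1_norm N \<Omega> v"
proof -
  obtain C where C: "\<forall>v\<in>Y. \<bar>F v\<bar> \<le> C * H1_norm N \<Omega> v" and hom: "\<forall>v\<in>Y. \<forall>c::real. F (\<lambda>x. c *\<^sub>R v x) = c * F v"
    using F unfolding dual_def by blast
  show ?thesis
  proof (cases "H1_norm N \<Omega> v = 0")
    case True
    then show ?thesis using C v by fastforce
  next
    case False
    define n where "n = H1_norm N \<Omega> v"
    have n: "n > 0" using False H1_norm_nonneg[of N \<Omega> v] unfolding n_def by simp
    let ?w = "\<lambda>x. (1 / n) *\<^sub>R v x"
    have weq: "?w = (\<lambda>x. complex_of_real (1 / n) * v x)" by (simp add: scaleR_conv_of_real)
    have wY: "?w \<in> Y" unfolding weq by (rule Y(2)[OF v])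
    have vH: "v \<in> H1 N \<Omega>" using v Y(1) by blast
    have "H1_norm N \<Omega> ?w = cmod (complex_of_real (1 / n)) * n"
      unfolding weq using H1_cmult(3)[OF \<Omega> vH, of "complex_of_real (1 / n)"] unfolding n_def[symmetric] .
    also have "\<dots> = 1" using n by (simp add: norm_divide)
    finally have wn: "H1_norm N \<Omega> ?w \<le> 1" by simp
    have bdd: "bdd_above ((\<lambda>v. \<bar>F v\<bar>) ` {v \<in> Y. H1_norm N \<Omega> v \<le> 1})"
    proof (rule bdd_aboveI2)
      fix w assume w: "w \<in> {v \<in> Y. H1_norm N \<Omega> v \<le> 1}"
      then have "\<bar>F w\<bar> \<le> C * H1_norm N \<Omega> w" using C by blast
      also have "\<dots> \<le> \<bar>C\<bar> * 1" using w H1_norm_nonneg[of N \<Omega> w] by (intro mult_mono) auto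
      finally show "\<bar>F w\<bar> \<le> \<bar>C\<bar> * 1" .
    qed
    have "\<bar>F ?w\<bar> \<le> dual_norm N \<Omega> Y F"
      unfolding dual_norm_def by (rule cSUP_upper[OF _ bdd]) (use wY wn in blast)
    moreover have "F ?w = (1 / n) * F v" using hom v by blast
    ultimately have "\<bar>F v\<bar> / n \<le> dual_norm N \<Omega> Y F" using n by (simp add: abs_mult)
    then show ?thesis using n unfolding n_def[symmetric] by (simp add: field_simps)
  qed
qed

text \<open>The equation tested with \<open>l u\<close>: the left-hand side is at least \<open>m \<parallel>u\<parallel>\<^sup>2\<close> and the right-hand side
  at most \<open>n \<parallel>u\<parallel>\<close>, in the norm of the Sobolev space.\<close>

lemma energy_estimate:
  assumes \<Omega>: "openin (Rtop N) \<Omega>" and sol: "weak_solution N \<Omega> X a b \<phi> F u U" and u: "u \<in> H1 N \<Omega>"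
    and lu: "(\<lambda>x. l * u x) \<in> X" and m: "m > 0" and l: "cmod l = 1" "\<forall>z\<in>{1, a, b}. m \<le> Re (z * cnj l)"
    and \<phi>: "AE x in leb N \<Omega>. \<phi> x \<ge> 0" and n: "\<bar>F (\<lambda>x. l * u x)\<bar> \<le> n * H1_norm N \<Omega> (\<lambda>x. l * u x)"
  shows "(\<integral>x. (cmod (u x))\<^sup>2 \<partial>leb N \<Omega>) \<le> (n / m)\<^sup>2"
proof -
  let ?M = "leb N \<Omega>" and ?v = "\<lambda>x. l * u x"
  note H = H1_cmult[OF \<Omega> u, where c = l]
  have lm: "m \<le> Re (cnj l)" "m \<le> Re (a * cnj l)" "m \<le> Re (b * cnj l)" using l(2) by auto
  have of_real_integral: "Re (\<integral>x. c * complex_of_real (f x) \<partial>?M) = Re c * (\<integral>x. f x \<partial>?M)" for c f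
    by (simp add: integral_complex_of_real)
  have grad: "m * (\<integral>x. (cmod (weak_deriv N \<Omega> i u x))\<^sup>2 \<partial>?M) \<le> pairing N \<Omega> (weak_deriv N \<Omega> i u) (weak_deriv N \<Omega> i ?v)"
    if i: "i < N" for i
  proof -
    have "(\<integral>x. weak_deriv N \<Omega> i u x * cnj (weak_deriv N \<Omega> i ?v x) \<partial>?M) =
        (\<integral>x. cnj l * complex_of_real ((cmod (weak_deriv N \<Omega> i u x))\<^sup>2) \<partial>?M)"
    proof (rule integral_cong_AE)
      show "(\<lambda>x. weak_deriv N \<Omega> i u x * cnj (weak_deriv N \<Omega> i ?v x)) \<in> borel_measurable ?M"
        using sqint_measurable[OF H1_D(2)[OF u i]] sqint_measurable[OF H1_D(2)[OF H(1) i]] by measurable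
      show "(\<lambda>x. cnj l * complex_of_real ((cmod (weak_deriv N \<Omega> i u x))\<^sup>2)) \<in> borel_measurable ?M"
        using sqint_measurable[OF H1_D(2)[OF u i]] by measurable
      show "AE x in ?M. weak_deriv N \<Omega> i u x * cnj (weak_deriv N \<Omega> i ?v x) =
          cnj l * complex_of_real ((cmod (weak_deriv N \<Omega> i u x))\<^sup>2)"
        using H(2)[OF i] unfolding complex_norm_square by eventually_elim simp
    qed
    then have "pairing N \<Omega> (weak_deriv N \<Omega> i u) (weak_deriv N \<Omega> i ?v) =
        Re (cnj l) * (\<integral>x. (cmod (weak_deriv N \<Omega> i u x))\<^sup>2 \<partial>?M)"
      unfolding pairing_def by (simp only: of_real_integral)
    then show ?thesis using lm(1) by (simp add: mult_right_mono)
  qed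
  note zero_order = zero_order_pairings[OF sqint_measurable[OF H1_D(1)[OF u]] borel_measurable_const[where c = 1],
      where l = l,
      unfolded of_real_1 mult_1_right mult_1_left]
  have aU: "0 \<le> pairing N \<Omega> (\<lambda>x. a * U x) ?v"
  proof -
    have U: "saturated_section N \<Omega> u U" using sol unfolding weak_solution_def by blast
    show ?thesis
      unfolding zero_order(1)[OF U] using lm(2) m by (intro mult_nonneg_nonneg Bochner_Integration.integral_nonneg) auto
  qed
  have bu: "m * (\<integral>x. (cmod (u x))\<^sup>2 \<partial>?M) \<le> pairing N \<Omega> (\<lambda>x. b * u x) ?v"
    unfolding zero_order(2) using lm(3) by (intro mult_right_mono Bochner_Integration.integral_nonneg) auto
  have pu: "0 \<le> pairing N \<Omega> (\<lambda>x. complex_of_real (\<phi> x) * u x) ?v"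
    unfolding zero_order(3) using lm(1) m \<phi>
    by (intro mult_nonneg_nonneg integral_nonneg_AE) (auto elim!: eventually_mono)
  define h where "h = H1_norm N \<Omega> u"
  have h: "h \<ge> 0" unfolding h_def by (rule H1_norm_nonneg)
  have "(\<Sum>i<N. pairing N \<Omega> (weak_deriv N \<Omega> i u) (weak_deriv N \<Omega> i ?v)) + pairing N \<Omega> (\<lambda>x. a * U x) ?v
      + pairing N \<Omega> (\<lambda>x. b * u x) ?v + pairing N \<Omega> (\<lambda>x. complex_of_real (\<phi> x) * u x) ?v = F ?v"
    using sol lu unfolding weak_solution_def by blast
  moreover have "(\<Sum>i<N. m * (\<integral>x. (cmod (weak_deriv N \<Omega> i u x))\<^sup>2 \<partial>?M)) \<le>
      (\<Sum>i<N. pairing N \<Omega> (weak_deriv N \<Omega> i u) (weak_deriv N \<Omega> i ?v))" by (intro sum_mono grad) simp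
  ultimately have "m * (\<integral>x. (cmod (u x))\<^sup>2 \<partial>?M) + m * (\<Sum>i<N. \<integral>x. (cmod (weak_deriv N \<Omega> i u x))\<^sup>2 \<partial>?M) \<le> F ?v"
    using aU bu pu unfolding sum_distrib_left by linarith
  then have "m * h\<^sup>2 \<le> F ?v" unfolding h_def H1_norm_sq by (simp only: distrib_left)
  also have "F ?v \<le> n * h" using n unfolding H(3) l(1) h_def by simp
  finally have e: "m * h\<^sup>2 \<le> n * h" .
  have "h\<^sup>2 \<le> (n / m)\<^sup>2"
  proof (cases "h = 0")
    case False
    then have "m * h \<le> n" using e h by (simp add: power2_eq_square)
    then have "h \<le> n / m" using m by (simp add: field_simps)
    then show ?thesis using h by (intro power_mono)
  qed simp
  then show ?thesis using L2_le_H1_norm[where u = u and N = N and \<Omega> = \<Omega>] unfolding h_def by linarith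
qed

section \<open>Solutions of both boundary value problems\<close>

text \<open>The bound of the norm of \<open>F\<close> under which the energy estimate yields the smallness for
  cubes of half side \<open>\<epsilon> / (4 N)\<close>.\<close>

definition threshold :: "real \<Rightarrow> nat \<Rightarrow> real \<Rightarrow> complex \<Rightarrow> complex \<Rightarrow> real" where
  "threshold C N \<epsilon> a b = coercivity a b * sqrt (smallness C N (\<epsilon> / (4 * real N)) (coercivity a b))"

lemma smallness_pos: "C > 0 \<Longrightarrow> N \<ge> 1 \<Longrightarrow> \<rho> > 0 \<Longrightarrow> m > 0 \<Longrightarrow> smallness C N \<rho> m > 0"
  unfolding smallness_def Let_def
  by (intro divide_pos_pos mult_pos_pos zero_less_power real_sqrt_gt_zero) auto

text \<open>The common part of both boundary conditions.  The equation is tested with functions in \<open>X\<close>, and \<open>F\<close>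
  is bounded on \<open>Y\<close>; these are different spaces for the Dirichlet condition.  The hypothesis \<open>test\<close>
  collects what depends on the boundary condition.\<close>

lemma support_of_solution:
  assumes C: "bump_constant C" and N: "N \<ge> 1" and ab: "admissible_pair a b" and \<Omega>: "openin (Rtop N) \<Omega>"
    and \<phi>: "admissible_potential N \<Omega> \<phi>" and K: "compactin (Rtop N) K" and K_subset: "K \<subseteq> \<Omega>"
    and sol: "weak_solution N \<Omega> X a b \<phi> F u U"
    and X: "X \<subseteq> Y" "\<And>v c. v \<in> X \<Longrightarrow> (\<lambda>x. c * v x) \<in> X"
    and Y: "Y \<subseteq> H1 N \<Omega>" "\<And>v c. v \<in> Y \<Longrightarrow> (\<lambda>x. c * v x) \<in> Y" and F: "F \<in> dual N \<Omega> Y"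
    and G: "G \<in> Linf N (\<Omega> - K)"
    and test: "\<And>\<zeta> V. \<zeta> \<in> Cc_inf N (Rspace N) \<Longrightarrow> openin (Rtop N) V \<Longrightarrow> K \<subseteq> V \<Longrightarrow> \<forall>x\<in>V. \<zeta> x = 0 \<Longrightarrow>
      (\<lambda>x. \<zeta> x * u x) \<in> X \<and> F (\<lambda>x. \<zeta> x * u x) = pairing N (\<Omega> - K) G (\<lambda>x. \<zeta> x * u x)"
    and \<epsilon>: "0 < \<epsilon>" "\<epsilon> < enn2real (min (set_set_dist N K (Rtop N frontier_of \<Omega>)) 1)"
    and smallF: "dual_norm N \<Omega> Y F < threshold C N \<epsilon> a b"
    and smallG: "Linf_norm N (\<Omega> - K) G \<le> ennreal (1 / (2 / coercivity a b))"
  shows "ess_support N \<Omega> u \<subseteq> closed_nbhd N K \<epsilon> \<and> closed_nbhd N K \<epsilon> \<subseteq> \<Omega>"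
proof -
  define m where "m = coercivity a b"
  have m: "m > 0" "m \<le> 1" unfolding m_def by (rule coercivity_pos[OF ab], rule coercivity_le_1)
  obtain l where l: "cmod l = 1" "\<forall>z\<in>{1, a, b}. m \<le> Re (z * cnj l)"
    using coercive_direction[OF ab] unfolding m_def by blast
  have uX: "u \<in> X" and sat: "saturated_section N \<Omega> u U" using sol unfolding weak_solution_def by blast+
  have u: "u \<in> H1 N \<Omega>" using uX X(1) Y(1) by blast
  have \<phi>0: "AE x in leb N \<Omega>. \<phi> x \<ge> 0" using \<phi> unfolding admissible_potential_def by blast
  have Gm: "AE x in leb N (\<Omega> - K). cmod (G x) \<le> m / 2"
    by (rule Linf_norm_le_AE[OF G]) (use smallG m in \<open>simp_all add: m_def\<close>)
  have eqn: "\<forall>v\<in>X. (\<Sum>i<N. pairing N \<Omega> (weak_deriv N \<Omega> i u) (weak_deriv N \<Omega> i v)) + pairing N \<Omega> (\<lambda>x. a * U x) v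
      + pairing N \<Omega> (\<lambda>x. b * u x) v + pairing N \<Omega> (\<lambda>x. complex_of_real (\<phi> x) * u x) v = F v"
    using sol unfolding weak_solution_def by blast
  interpret cutoff_equation N \<Omega> K u U G \<phi> a b l m
  proof (rule cutoff_equation.intro, goal_cases)
    case (12 \<eta>)
    from 12(2) obtain V where V: "openin (Rtop N) V" "K \<subseteq> V" "\<forall>x\<in>V. \<eta> x = 0" by blast
    have "(\<lambda>x. l * (complex_of_real (\<eta> x) * complex_of_real (\<eta> x))) \<in> Cc_inf N (Rspace N)"
      by (rule Cc_inf_mult[OF smooth_const Cc_inf_mult[OF Cc_inf_smooth[OF 12(1)] 12(1)]])
    then have "(\<lambda>x. l * complex_of_real ((\<eta> x)\<^sup>2)) \<in> Cc_inf N (Rspace N)" by (simp add: power2_eq_square)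
    from test[OF this V(1,2)] V(3)
    have t: "(\<lambda>x. l * complex_of_real ((\<eta> x)\<^sup>2) * u x) \<in> X"
      "F (\<lambda>x. l * complex_of_real ((\<eta> x)\<^sup>2) * u x) = pairing N (\<Omega> - K) G (\<lambda>x. l * complex_of_real ((\<eta> x)\<^sup>2) * u x)"
      by simp_all
    show ?case by (rule trans[OF bspec[OF eqn t(1)] t(2)])
  qed (fact N \<Omega> K m l u sat \<phi>0 Gm)+
  have lt: "ennreal \<epsilon> < set_set_dist N K (Rtop N frontier_of \<Omega>)"
  proof -
    let ?d = "min (set_set_dist N K (Rtop N frontier_of \<Omega>)) 1"
    have "?d \<le> 1" by simp
    then have "?d < top" by (rule le_less_trans) simp
    then have "ennreal (enn2real ?d) = ?d" by simp
    moreover have "ennreal \<epsilon> < ennreal (enn2real ?d)" using \<epsilon> by (simp add: ennreal_lessI)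
    ultimately show ?thesis by simp
  qed
  have sub: "closed_nbhd N K \<epsilon> \<subseteq> \<Omega>" by (rule closed_nbhd_subset[OF \<Omega> K_subset lt])
  define y where "y = smallness C N (\<epsilon> / (4 * real N)) m"
  have y: "y > 0" unfolding y_def using C N \<epsilon>(1) m(1) unfolding bump_constant_def by (intro smallness_pos) auto
  have luX: "(\<lambda>x. l * u x) \<in> X" by (rule X(2)[OF uX])
  have luY: "(\<lambda>x. l * u x) \<in> Y" using luX X(1) by blast
  note F_bound = dual_norm_bound[OF \<Omega> Y F luY]
  also have "dual_norm N \<Omega> Y F * H1_norm N \<Omega> (\<lambda>x. l * u x) \<le> (m * sqrt y) * H1_norm N \<Omega> (\<lambda>x. l * u x)"
    using smallF unfolding threshold_def y_def m_def by (intro mult_right_mono H1_norm_nonneg) simp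
  finally have "(\<integral>x. (cmod (u x))\<^sup>2 \<partial>leb N \<Omega>) \<le> (m * sqrt y / m)\<^sup>2"
    by (rule energy_estimate[OF \<Omega> sol u luX m(1) l \<phi>0])
  also have "\<dots> = y" using m y by simp
  finally have "(\<integral>x. (cmod (u x))\<^sup>2 \<partial>leb N \<Omega>) \<le> smallness C N (\<epsilon> / (4 * real N)) m" unfolding y_def .
  from support_in_neighbourhood[OF C \<epsilon>(1) sub this] sub show ?thesis by blast
qed

lemma pair_constant_coercivity: "pair_constant (\<lambda>a b. 2 / coercivity a b)"
  unfolding pair_constant_def
proof (intro conjI allI impI)
  show "2 / coercivity a b > 0" if "admissible_pair a b" for a b using coercivity_pos[OF that] by simp
  have "continuous_on {(a, b). admissible_pair a b} (\<lambda>p. 2 / (case p of (a, b) \<Rightarrow> coercivity a b))"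
    by (intro continuous_intros continuous_on_coercivity) (use coercivity_pos in force)
  then show "continuous_on {(a, b). admissible_pair a b} (\<lambda>(a, b). 2 / coercivity a b)"
    by (simp add: case_prod_beta)
qed

lemma eps_pair_constant_threshold:
  assumes C: "C > 0" and N: "N \<ge> 1"
  shows "eps_pair_constant (threshold C N)"
  unfolding eps_pair_constant_def
proof (intro conjI allI impI)
  show "threshold C N \<epsilon> a b > 0" if "\<epsilon> > 0" "admissible_pair a b" for \<epsilon> a b
    unfolding threshold_def using that(1) C N coercivity_pos[OF that(2)]
    by (intro mult_pos_pos real_sqrt_gt_zero smallness_pos) simp_all
  let ?S = "{(\<epsilon>, a, b). \<epsilon> > 0 \<and> admissible_pair a b}"
  have c: "continuous_on ?S (\<lambda>p. coercivity (fst (snd p)) (snd (snd p)))"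
  proof -
    have "continuous_on ?S (\<lambda>p. case snd p of (a, b) \<Rightarrow> coercivity a b)"
      by (rule continuous_on_compose2[OF continuous_on_coercivity[of UNIV]]) (auto intro!: continuous_intros)
    then show ?thesis by (simp add: case_prod_beta)
  qed
  have "continuous_on ?S (\<lambda>p. threshold C N (fst p) (fst (snd p)) (snd (snd p)))"
    unfolding threshold_def smallness_def Let_def
    by (intro continuous_intros c) (use C N in auto)
  then show "continuous_on ?S (\<lambda>(\<epsilon>, a, b). threshold C N \<epsilon> a b)" by (simp add: case_prod_beta)
qed

text \<open>The truncation at one matters if the boundary is empty and the distance infinite.\<close>

lemma dist_constant_min: "dist_constant (\<lambda>d. enn2real (min d 1))"
  unfolding dist_constant_def
proof (intro conjI allI impI)
  have fin: "min d (1::ennreal) < top" for d :: ennreal by (rule le_less_trans[of _ 1]) auto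
  show "enn2real (min d 1) > 0" if "d > 0" for d :: ennreal
    using that fin[of d] by (simp add: enn2real_positive_iff)
  show "continuous_on {0<..} (\<lambda>d. enn2real (min d 1))"
    unfolding continuous_on_def
  proof
    fix x :: ennreal
    have "((\<lambda>d. min d 1) \<longlongrightarrow> min x 1) (at x within {0<..})" by (intro tendsto_min tendsto_ident_at tendsto_const)
    then have "((\<lambda>d. min d 1) \<longlongrightarrow> ennreal (enn2real (min x 1))) (at x within {0<..})" using fin[of x] by simp
    then show "((\<lambda>d. enn2real (min d 1)) \<longlongrightarrow> enn2real (min x 1)) (at x within {0<..})"
      by (rule tendsto_enn2real) simp
  qed
qed

lemma Lp1_iff: "f \<in> Lp N \<Omega> 1 \<longleftrightarrow> f \<in> borel_measurable (leb N \<Omega>) \<and> integrable (leb N \<Omega>) (\<lambda>x. norm (f x))"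
  unfolding Lp_def by simp

text \<open>Cutoffs have compact support, so \<open>\<zeta> u\<close> is integrable even if \<open>\<Omega>\<close> has infinite measure.\<close>

lemma dirichlet_support:
  assumes C: "bump_constant C" and N: "N \<ge> 1" and ab: "admissible_pair a b" and \<Omega>: "openin (Rtop N) \<Omega>"
    and \<phi>: "admissible_potential N \<Omega> \<phi>" and K: "compactin (Rtop N) K" "K \<subseteq> \<Omega>"
    and F: "F \<in> dual N \<Omega> (H10 N \<Omega>)" and G: "dirichlet_rep_off N \<Omega> K F G"
    and sol: "dirichlet_weak_solution N \<Omega> a b \<phi> F u U"
    and \<epsilon>: "0 < \<epsilon>" "\<epsilon> < enn2real (min (set_set_dist N K (Rtop N frontier_of \<Omega>)) 1)"
    and small: "dual_norm N \<Omega> (H10 N \<Omega>) F < threshold C N \<epsilon> a b"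
      "Linf_norm N (\<Omega> - K) G \<le> ennreal (1 / (2 / coercivity a b))"
  shows "ess_support N \<Omega> u \<subseteq> closed_nbhd N K \<epsilon> \<and> closed_nbhd N K \<epsilon> \<subseteq> \<Omega>"
proof (rule support_of_solution[where G = G, OF C N ab \<Omega> \<phi> K sol[unfolded dirichlet_weak_solution_def] _ _ _ _ F _ _ \<epsilon> small])
  have u: "u \<in> H10 N \<Omega>" using sol unfolding dirichlet_weak_solution_def weak_solution_def by blast
  show "H10 N \<Omega> \<inter> Lp N \<Omega> 1 \<subseteq> H10 N \<Omega>" "H10 N \<Omega> \<subseteq> H1 N \<Omega>" using H10_D by blast+
  show c: "(\<lambda>x. c * v x) \<in> H10 N \<Omega>" if "v \<in> H10 N \<Omega>" for v c
    by (rule H10_mult[OF \<Omega> that smooth_const, of _ "cmod c"]) simp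
  show "(\<lambda>x. c * v x) \<in> H10 N \<Omega> \<inter> Lp N \<Omega> 1" if "v \<in> H10 N \<Omega> \<inter> Lp N \<Omega> 1" for v c
    using that c unfolding Int_iff Lp1_iff by (auto simp: norm_mult)
  show "G \<in> Linf N (\<Omega> - K)" using G unfolding dirichlet_rep_off_def by blast
  fix \<zeta> V assume \<zeta>: "\<zeta> \<in> Cc_inf N (Rspace N)" and V: "openin (Rtop N) V" "K \<subseteq> V" "\<forall>x\<in>V. \<zeta> x = 0"
  obtain B where B: "\<forall>x\<in>Rspace N. cmod (\<zeta> x) \<le> B \<and> (\<forall>i<N. cmod (pderiv_at i \<zeta> x) \<le> B)"
    using Cc_inf_deriv_bound[OF \<zeta>] by blast
  have "integrable (leb N \<Omega>) (\<lambda>x. \<zeta> x * u x)"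
    by (rule sqint_mult_integrable[OF Cc_inf_sqint_leb[OF \<zeta> \<Omega>] H1_D(1)[OF H10_D[OF u]]])
  then have "(\<lambda>x. \<zeta> x * u x) \<in> Lp N \<Omega> 1" unfolding Lp1_iff by auto
  then show "(\<lambda>x. \<zeta> x * u x) \<in> H10 N \<Omega> \<inter> Lp N \<Omega> 1 \<and> F (\<lambda>x. \<zeta> x * u x) = pairing N (\<Omega> - K) G (\<lambda>x. \<zeta> x * u x)"
    using H10_mult[OF \<Omega> u Cc_inf_smooth[OF \<zeta>] B] dirichlet_rep_cutoff[OF \<Omega> K(1) u F G \<zeta> V] by blast
qed

text \<open>Test functions in this case need not vanish at the boundary, so \<open>F\<close> is directly given by \<open>G\<close> on
  the cutoffs \<open>\<zeta> u\<close>.\<close>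

lemma neumann_support:
  assumes C: "bump_constant C" and N: "N \<ge> 1" and ab: "admissible_pair a b" and \<Omega>: "openin (Rtop N) \<Omega>"
    and \<phi>: "admissible_potential N \<Omega> \<phi>" and K: "compactin (Rtop N) K" "K \<subseteq> \<Omega>"
    and F: "F \<in> dual N \<Omega> (H1 N \<Omega>)" and G: "neumann_rep_off N \<Omega> K F G"
    and sol: "neumann_weak_solution N \<Omega> a b \<phi> F u U"
    and \<epsilon>: "0 < \<epsilon>" "\<epsilon> < enn2real (min (set_set_dist N K (Rtop N frontier_of \<Omega>)) 1)"
    and small: "dual_norm N \<Omega> (H1 N \<Omega>) F < threshold C N \<epsilon> a b"
      "Linf_norm N (\<Omega> - K) G \<le> ennreal (1 / (2 / coercivity a b))"
  shows "ess_support N \<Omega> u \<subseteq> closed_nbhd N K \<epsilon> \<and> closed_nbhd N K \<epsilon> \<subseteq> \<Omega>"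
proof (rule support_of_solution[where G = G, OF C N ab \<Omega> \<phi> K sol[unfolded neumann_weak_solution_def] _ _ _ _ F _ _ \<epsilon> small])
  have u: "u \<in> H1 N \<Omega>" using sol unfolding neumann_weak_solution_def weak_solution_def by blast
  show "H1 N \<Omega> \<subseteq> H1 N \<Omega>" "H1 N \<Omega> \<subseteq> H1 N \<Omega>" by blast+
  show "(\<lambda>x. c * v x) \<in> H1 N \<Omega>" "(\<lambda>x. c * v x) \<in> H1 N \<Omega>" if "v \<in> H1 N \<Omega>" for v c
    by (rule H1_cmult(1)[OF \<Omega> that])+
  show "G \<in> Linf N (\<Omega> - K)" using G unfolding neumann_rep_off_def by blast
  fix \<zeta> V assume \<zeta>: "\<zeta> \<in> Cc_inf N (Rspace N)" and V: "openin (Rtop N) V" "K \<subseteq> V" "\<forall>x\<in>V. \<zeta> x = 0"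
  obtain B where B: "\<forall>x\<in>Rspace N. cmod (\<zeta> x) \<le> B \<and> (\<forall>i<N. cmod (pderiv_at i \<zeta> x) \<le> B)"
    using Cc_inf_deriv_bound[OF \<zeta>] by blast
  have v: "(\<lambda>x. \<zeta> x * u x) \<in> H1 N \<Omega>" by (rule H1_mult(1)[OF \<Omega> u Cc_inf_smooth[OF \<zeta>] B])
  have "AE x in leb N (\<Omega> \<inter> V). \<zeta> x * u x = 0"
    unfolding AE_leb[OF openin_Int[OF \<Omega> V(1)]] using V(3) by auto
  then show "(\<lambda>x. \<zeta> x * u x) \<in> H1 N \<Omega> \<and> F (\<lambda>x. \<zeta> x * u x) = pairing N (\<Omega> - K) G (\<lambda>x. \<zeta> x * u x)"
  proof (intro conjI v)
    assume ae: "AE x in leb N (\<Omega> \<inter> V). \<zeta> x * u x = 0"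
    have "\<forall>v\<in>H1 N \<Omega>. (\<exists>V. openin (Rtop N) V \<and> K \<subseteq> V \<and> (AE x in leb N (\<Omega> \<inter> V). v x = 0)) \<longrightarrow>
        F v = pairing N (\<Omega> - K) G v"
      using G unfolding neumann_rep_off_def by (rule conjunct2)
    from bspec[OF this v] show "F (\<lambda>x. \<zeta> x * u x) = pairing N (\<Omega> - K) G (\<lambda>x. \<zeta> x * u x)"
      by (rule mp) (intro exI[of _ V] conjI V(1,2) ae)
  qed
qed

theorem theorem5p2:
  shows
    "(\<exists>(M :: complex \<Rightarrow> complex \<Rightarrow> real) (\<epsilon>\<^sub>0 :: ennreal \<Rightarrow> real)
        (\<delta> :: nat \<Rightarrow> real \<Rightarrow> complex \<Rightarrow> complex \<Rightarrow> real).
        pair_constant M \<and> dist_constant \<epsilon>\<^sub>0 \<and> (\<forall>N\<ge>1. eps_pair_constant (\<delta> N)) \<and>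
        (\<forall>(N::nat) a b \<Omega> \<phi> K F G u U.
           N \<ge> 1 \<longrightarrow> admissible_pair a b \<longrightarrow>
           openin (Rtop N) \<Omega> \<longrightarrow>
           admissible_potential N \<Omega> \<phi> \<longrightarrow>
           compactin (Rtop N) K \<longrightarrow> K \<subseteq> \<Omega> \<longrightarrow>
           F \<in> dual N \<Omega> (H10 N \<Omega>) \<longrightarrow> dirichlet_rep_off N \<Omega> K F G \<longrightarrow>
           dirichlet_weak_solution N \<Omega> a b \<phi> F u U \<longrightarrow>
           (\<forall>\<epsilon>. 0 < \<epsilon> \<and> \<epsilon> < \<epsilon>\<^sub>0 (set_set_dist N K (Rtop N frontier_of \<Omega>)) \<longrightarrow>
              dual_norm N \<Omega> (H10 N \<Omega>) F < \<delta> N \<epsilon> a b \<longrightarrow>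
              Linf_norm N (\<Omega> - K) G \<le> ennreal (1 / M a b) \<longrightarrow>
              ess_support N \<Omega> u \<subseteq> closed_nbhd N K \<epsilon> \<and> closed_nbhd N K \<epsilon> \<subseteq> \<Omega>)))
   \<and>
     (\<exists>(M :: complex \<Rightarrow> complex \<Rightarrow> real) (\<epsilon>\<^sub>0 :: ennreal \<Rightarrow> real)
        (\<delta> :: nat \<Rightarrow> real \<Rightarrow> complex \<Rightarrow> complex \<Rightarrow> real).
        pair_constant M \<and> dist_constant \<epsilon>\<^sub>0 \<and> (\<forall>N\<ge>1. eps_pair_constant (\<delta> N)) \<and>
        (\<forall>(N::nat) a b \<Omega> \<phi> K F G u U.
           N \<ge> 1 \<longrightarrow> admissible_pair a b \<longrightarrow>
           openin (Rtop N) \<Omega> \<longrightarrow>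
           emeasure (leb N \<Omega>) \<Omega> < \<infinity> \<longrightarrow> lipschitz_boundary N \<Omega> \<longrightarrow>
           admissible_potential N \<Omega> \<phi> \<longrightarrow>
           compactin (Rtop N) K \<longrightarrow> K \<subseteq> \<Omega> \<longrightarrow>
           F \<in> dual N \<Omega> (H1 N \<Omega>) \<longrightarrow> neumann_rep_off N \<Omega> K F G \<longrightarrow>
           neumann_weak_solution N \<Omega> a b \<phi> F u U \<longrightarrow>
           (\<forall>\<epsilon>. 0 < \<epsilon> \<and> \<epsilon> < \<epsilon>\<^sub>0 (set_set_dist N K (Rtop N frontier_of \<Omega>)) \<longrightarrow>
              dual_norm N \<Omega> (H1 N \<Omega>) F < \<delta> N \<epsilon> a b \<longrightarrow>
              Linf_norm N (\<Omega> - K) G \<le> ennreal (1 / M a b) \<longrightarrow>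
              ess_support N \<Omega> u \<subseteq> closed_nbhd N K \<epsilon> \<and> closed_nbhd N K \<epsilon> \<subseteq> \<Omega>)))"
proof -
  obtain C where C: "bump_constant C" using ex_bump_constant by blast
  then have C0: "C > 0" unfolding bump_constant_def by blast
  have d: "\<forall>N\<ge>1. eps_pair_constant (threshold C N)" using eps_pair_constant_threshold[OF C0] by blast
  show ?thesis
  proof (intro conjI exI[of _ "\<lambda>a b. 2 / coercivity a b"] exI[of _ "\<lambda>d. enn2real (min d 1)"]
      exI[of _ "threshold C"] pair_constant_coercivity dist_constant_min d allI impI; elim conjE)
  qed (rule dirichlet_support[OF C, THEN conjunct1] dirichlet_support[OF C, THEN conjunct2]
      neumann_support[OF C, THEN conjunct1] neumann_support[OF C, THEN conjunct2]; assumption)+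
qed

end
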